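(* Let $1<p<\infty$ and $p'=p/(p-1)$. Let $(X,d,\mu)$ be a complete geodesic metric measure space such that $\mu$ is doubling and the space supports a $(p,p)$-Poincaré inequality, and let $\Omega\subset X$ be a nonempty bounded open connected set with $\mu(X\setminus\Omega)>0$. Fix a Cheeger differentiable structure on $X$. Let $f\in L^{p'}(\Omega)$ and $g\in N^{1,p}(\Omega)$. Then the solution to the Dirichlet problem for the $p$-Poisson equation (in the Cheeger's setting) with source term $f$ and boundary data $g$ is unique: if $u$ and $v$ are two such solutions, then $u=v$ as elements of $N^{1,p}(\Omega)$, i.e. $\|u-v\|_{N^{1,p}(\Omega)}=0$.
   Context: A metric measure space $(X,d,\mu)$ is a metric space with a Borel regular measure $\mu$; $B(x,r)$ is the open ball, and $u_E=\frac{1}{\mu(E)}\int_E u\,d\mu$ denotes the integral average when $0<\mu(E)<\infty$. The measure is doubling if there is $C_\mu\ge 1$ with $0<\mu(B(x,2r))\le C_\mu\mu(B(x,r))<\infty$ for all $x\in X$, $r>0$. Upper gradients: a Borel function $h:X\to[0,\infty]$ is an upper gradient of $u:X\to\mathbb{R}$ if $|u(\gamma(a))-u(\gamma(b))|\le\int_\gamma h\,ds$ for all nonconstant compact rectifiable curves $\gamma:[a,b]\to X$. It is a $p$-weak upper gradient if this holds for all such curves except a family of $p$-modulus zero, where the $p$-modulus of a curve family $\Gamma$ is $\inf\int_X\rho^p\,d\mu$ over Borel $\rho\ge0$ with $\int_\gamma\rho\,ds\ge1$ for all $\gamma\in\Gamma$. If $u$ has a $p$-weak upper gradient in $L^p(X)$,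 then there is a unique (up to a.e. equality) one with smallest $L^p$ norm, the minimal $p$-weak upper gradient $g_u$. Newtonian spaces: $u\in N^{1,p}(X)$ if $u\in L^p(X)$ and $u$ has a $p$-weak upper gradient in $L^p(X)$; $\|u\|_{N^{1,p}(X)}=\left(\int_X|u|^p+g_u^p\,d\mu\right)^{1/p}$. The space $N^{1,p}(\Omega)$ is defined in the same way with $\Omega$ (with restricted metric and measure) in place of $X$. Elements of $N^{1,p}(\Omega)$ whose difference has norm zero are identified. $N_0^{1,p}(\Omega)$ consists of the restrictions to $\Omega$ of functions $u\in N^{1,p}(X)$ with $u=0$ in $X\setminus\Omega$ (identified with their zero extensions). Poincaré inequality: $X$ supports a $(p,p)$-Poincaré inequality if there are $C_P>0$ and $\lambda\ge1$ such that for every $u\in L^1(X)$, $x\in X$, $r>0$ and every upper gradient $h$ of $u$, $$\left(\frac{1}{\mu(B(x,r))}\int_{B(x,r)}|u-u_{B(x,r)}|^p\,d\mu\right)^{1/p}\le C_P\,r\left(\frac{1}{\mu(B(x,\lambda r))}\int_{B(x,\lambda r)}h^p\,d\mu\right)^{1/p}.$$ Cheeger differentiable structure (known existence theorem for geodesic $X$ as in the claim): A function $u\in N^{1,p}_{\mathrm{loc}}(X)$ is asymptotically generalized linear at $x_0$ if $x_0$ is a Lebesgue point of $g_u^p$ and $\lim_{r\to0}\left(\frac{1}{\mu(B)}\int_{B}g_u^p\,d\mu-\inf_{\varphi}\frac{1}{\mu(B)}\int_{B}g_{u+\varphi}^p\,d\mu\right)=0$, where $B=B(x_0,r)$ and the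 infimum is over Newtonian functions $\varphi$ with compact support in $B$. There exist a positive integer $N$ and countably many measurable sets $U_\alpha$, which may be taken pairwise disjoint, with $\mu(U_\alpha)>0$ and $\mu(X\setminus\bigcup_\alpha U_\alpha)=0$, and for each $\alpha$ 1-Lipschitz functions $f_1^\alpha,\dots,f_{N(\alpha)}^\alpha$ on $X$, $N(\alpha)\le N$, with $\vec f^\alpha=(f_1^\alpha,\dots,f_{N(\alpha)}^\alpha)$, such that: (1) each $f^\alpha_j$ is asymptotically generalized linear at each point of $U_\alpha$; (2) $g_{\vec a\cdot\vec f^\alpha}(x_0)>0$ for all $\vec a\in\mathbb{R}^{N(\alpha)}\setminus\{0\}$, $x_0\in U_\alpha$; (3) for every Lipschitz $u:X\to\mathbb{R}$ there are $V_\alpha(u)\subset U_\alpha$ with $\mu(U_\alpha\setminus V_\alpha(u))=0$ and a Borel map $D^\alpha u:V_\alpha(u)\to\mathbb{R}^{N(\alpha)}$ such that for $x_0\in V_\alpha(u)$, $g_{\vec a\cdot\vec f^\alpha-u}(x_0)=0$ if and only if $\vec a=D^\alpha u(x_0)$. A structure of this kind (not necessarily unique) is fixed. Associated with it there are, for a.e. $x$, an inner product $\langle\cdot,\cdot\rangle_x$ on $\mathbb{R}^N$ with induced norm $|\cdot|_x$, and a bounded linear operator $\nabla:N^{1,p}(X)\to L^p(X:\mathbb{R}^N)$ (the Cheeger gradient) such that $\nabla u=\sum_\alpha D^\alpha u\,\chi_{U_\alpha}$ for Lipschitz $u$ (with $\mathbb{R}^{N(\alpha)}\subset\mathbb{R}^N$),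 $\nabla(uv)=u\nabla v+v\nabla u$ for Lipschitz $u,v\in N^{1,p}(X)$, and $|\nabla u(x)|_x\le g_u(x)\le\sqrt N\,|\nabla u(x)|_x$ for a.e. $x$. For $u\in N^{1,p}(\Omega)$, $\nabla u$ is defined a.e. in $\Omega$ by locality: $\nabla u=\nabla(\eta u)$ a.e. on $\{\eta=1\}$ for every Lipschitz cutoff $\eta$ with compact support in $\Omega$; it is linear in $u$ and satisfies the same two-sided comparison with $g_u$. Solution (in the Cheeger's setting): a solution to the Dirichlet problem for the $p$-Poisson equation with source term $f\in L^{p'}(\Omega)$ and boundary data $g\in N^{1,p}(\Omega)$ is a function $u\in N^{1,p}(\Omega)$ such that $u-g\in N_0^{1,p}(\Omega)$ and $\int_\Omega|\nabla u|_x^{p-2}\langle\nabla u,\nabla\varphi\rangle_x\,d\mu(x)=\int_\Omega f\varphi\,d\mu$ for all $\varphi\in N_0^{1,p}(\Omega)$. *)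

theory Defs
  imports "HOL-Analysis.Analysis"
begin

section \<open>Powers and averages of extended nonnegative functions\<close>

text \<open>Only used for exponents \<open>p > 0\<close>, where \<open>\<infinity>\<^sup>p = \<infinity>\<close> and \<open>0\<^sup>p = 0\<close>.\<close>

definition epowr :: "ennreal \<Rightarrow> real \<Rightarrow> ennreal" where
  "epowr x p = (if x = \<infinity> then \<infinity> else ennreal (enn2real x powr p))"

definition eaverage :: "'a measure \<Rightarrow> 'a set \<Rightarrow> ('a \<Rightarrow> ennreal) \<Rightarrow> ennreal" where
  "eaverage M E h = (\<integral>\<^sup>+x\<in>E. h x \<partial>M) / emeasure M E"

definition average :: "'a measure \<Rightarrow> 'a set \<Rightarrow> ('a \<Rightarrow> real) \<Rightarrow> real" where
  "average M E u = (LINT x:E|M. u x) / measure M E"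


section \<open>Metric measure spaces\<close>

text \<open>A Borel regular (outer) measure is represented by its restriction to the measurable
  sets in the sense of Caratheodory: a complete measure for which every measurable set is
  contained in a Borel set of the same measure.\<close>

definition borel_regular :: "'a::metric_space measure \<Rightarrow> bool" where
  "borel_regular M \<longleftrightarrow>
     complete_measure M \<and> sets borel \<subseteq> sets M \<and>
     (\<forall>A\<in>sets M. \<exists>B\<in>sets borel. A \<subseteq> B \<and> emeasure M B = emeasure M A)"

definition doubling :: "'a::metric_space measure \<Rightarrow> bool" where
  "doubling M \<longleftrightarrow>
     (\<exists>C::real. C \<ge> 1 \<and>
        (\<forall>x. \<forall>r>0. 0 < emeasure M (ball x (2 * r)) \<and>
           emeasure M (ball x (2 * r)) \<le> ennreal C * emeasure M (ball x r) \<and>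
           ennreal C * emeasure M (ball x r) < \<infinity>))"


section \<open>Curves\<close>

text \<open>A compact curve \<open>\<gamma>: [a,b] \<rightarrow> X\<close> is the triple \<open>(\<gamma>, a, b)\<close>; the values of \<open>\<gamma>\<close>
  outside \<open>[a,b]\<close> are irrelevant.\<close>

type_synonym 'a curve = "(real \<Rightarrow> 'a) \<times> real \<times> real"

definition curve_length :: "'a::metric_space curve \<Rightarrow> ennreal" where
  "curve_length = (\<lambda>(\<gamma>, a, b).
     SUP ts\<in>{ts. sorted ts \<and> set ts \<subseteq> {a..b}}.
       \<Sum>i<length ts - 1. ennreal (dist (\<gamma> (ts ! i)) (\<gamma> (ts ! Suc i))))"

definition geodesic :: "'a::metric_space set \<Rightarrow> bool" where
  "geodesic S \<longleftrightarrow>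
     (\<forall>x\<in>S. \<forall>y\<in>S. \<exists>\<gamma> a b. a \<le> b \<and> continuous_on {a..b} \<gamma> \<and> \<gamma> ` {a..b} \<subseteq> S \<and>
        \<gamma> a = x \<and> \<gamma> b = y \<and> curve_length (\<gamma>, a, b) = ennreal (dist x y))"

definition rectifiable_curve :: "'a::metric_space set \<Rightarrow> 'a curve \<Rightarrow> bool" where
  "rectifiable_curve S = (\<lambda>(\<gamma>, a, b).
     a \<le> b \<and> continuous_on {a..b} \<gamma> \<and> \<gamma> ` {a..b} \<subseteq> S \<and>
     curve_length (\<gamma>, a, b) < \<infinity> \<and> \<not> \<gamma> constant_on {a..b})"

text \<open>The arc-length parametrization on \<open>[0, length]\<close>. The choice of \<open>t\<close> is
  immaterial, since a curve is constant wherever its length function is.\<close>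

definition arc_param :: "'a::metric_space curve \<Rightarrow> real \<Rightarrow> 'a" where
  "arc_param = (\<lambda>(\<gamma>, a, b) s.
     \<gamma> (SOME t. t \<in> {a..b} \<and> curve_length (\<gamma>, a, t) = ennreal s))"

definition line_integral :: "('a::metric_space \<Rightarrow> ennreal) \<Rightarrow> 'a curve \<Rightarrow> ennreal" where
  "line_integral h c =
     (\<integral>\<^sup>+s\<in>{0..enn2real (curve_length c)}. h (arc_param c s) \<partial>lborel)"


section \<open>Upper gradients\<close>

text \<open>From here on a set \<open>S\<close> plays the role of the space: \<open>S = UNIV\<close> gives the notions
  on \<open>X\<close>, and \<open>S = \<Omega>\<close> those on \<open>\<Omega>\<close> with the restricted metric and measure. Functions on
  \<open>S\<close> are total functions whose values outside \<open>S\<close> are irrelevant.\<close>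

definition modulus ::
  "real \<Rightarrow> 'a::metric_space measure \<Rightarrow> 'a set \<Rightarrow> 'a curve set \<Rightarrow> ennreal" where
  "modulus p M S \<Gamma> =
     (INF \<rho>\<in>{\<rho>. \<rho> \<in> borel_measurable (restrict_space borel S) \<and>
                (\<forall>c\<in>\<Gamma>. line_integral \<rho> c \<ge> 1)}.
        \<integral>\<^sup>+x\<in>S. epowr (\<rho> x) p \<partial>M)"

definition ug_ineq :: "('a::metric_space \<Rightarrow> real) \<Rightarrow> ('a \<Rightarrow> ennreal) \<Rightarrow> 'a curve \<Rightarrow> bool" where
  "ug_ineq u h = (\<lambda>(\<gamma>, a, b).
     ennreal \<bar>u (\<gamma> a) - u (\<gamma> b)\<bar> \<le> line_integral h (\<gamma>, a, b))"

definition upper_gradient ::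
  "'a::metric_space set \<Rightarrow> ('a \<Rightarrow> real) \<Rightarrow> ('a \<Rightarrow> ennreal) \<Rightarrow> bool" where
  "upper_gradient S u h \<longleftrightarrow>
     h \<in> borel_measurable (restrict_space borel S) \<and>
     (\<forall>c. rectifiable_curve S c \<longrightarrow> ug_ineq u h c)"

definition weak_upper_gradient ::
  "real \<Rightarrow> 'a::metric_space measure \<Rightarrow> 'a set \<Rightarrow> ('a \<Rightarrow> real) \<Rightarrow> ('a \<Rightarrow> ennreal) \<Rightarrow> bool" where
  "weak_upper_gradient p M S u h \<longleftrightarrow>
     h \<in> borel_measurable (restrict_space borel S) \<and>
     modulus p M S {c. rectifiable_curve S c \<and> \<not> ug_ineq u h c} = 0"

definition is_min_weak_ug ::
  "real \<Rightarrow> 'a::metric_space measure \<Rightarrow> 'a set \<Rightarrow> ('a \<Rightarrow> real) \<Rightarrow> ('a \<Rightarrow> ennreal) \<Rightarrow> bool" where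
  "is_min_weak_ug p M S u g \<longleftrightarrow>
     weak_upper_gradient p M S u g \<and> (\<integral>\<^sup>+x\<in>S. epowr (g x) p \<partial>M) < \<infinity> \<and>
     (\<forall>h. weak_upper_gradient p M S u h \<longrightarrow>
        (\<integral>\<^sup>+x\<in>S. epowr (g x) p \<partial>M) \<le> (\<integral>\<^sup>+x\<in>S. epowr (h x) p \<partial>M))"

definition min_weak_ug ::
  "real \<Rightarrow> 'a::metric_space measure \<Rightarrow> 'a set \<Rightarrow> ('a \<Rightarrow> real) \<Rightarrow> 'a \<Rightarrow> ennreal" where
  "min_weak_ug p M S u = (SOME g. is_min_weak_ug p M S u g)"


section \<open>Newtonian spaces\<close>

definition Lp_on :: "real \<Rightarrow> 'a measure \<Rightarrow> 'a set \<Rightarrow> ('a \<Rightarrow> real) \<Rightarrow> bool" where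
  "Lp_on p M S u \<longleftrightarrow>
     u \<in> borel_measurable (restrict_space M S) \<and> (\<integral>\<^sup>+x\<in>S. ennreal (\<bar>u x\<bar> powr p) \<partial>M) < \<infinity>"

definition newtonian ::
  "real \<Rightarrow> 'a::metric_space measure \<Rightarrow> 'a set \<Rightarrow> ('a \<Rightarrow> real) \<Rightarrow> bool" where
  "newtonian p M S u \<longleftrightarrow>
     Lp_on p M S u \<and>
     (\<exists>h. weak_upper_gradient p M S u h \<and> (\<integral>\<^sup>+x\<in>S. epowr (h x) p \<partial>M) < \<infinity>)"

definition newtonian_norm ::
  "real \<Rightarrow> 'a::metric_space measure \<Rightarrow> 'a set \<Rightarrow> ('a \<Rightarrow> real) \<Rightarrow> ennreal" where
  "newtonian_norm p M S u =
     epowr (\<integral>\<^sup>+x\<in>S. (ennreal (\<bar>u x\<bar> powr p) + epowr (min_weak_ug p M S u x) p) \<partial>M) (1 / p)"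

definition newtonian0 ::
  "real \<Rightarrow> 'a::metric_space measure \<Rightarrow> 'a set \<Rightarrow> ('a \<Rightarrow> real) \<Rightarrow> bool" where
  "newtonian0 p M \<Omega> u \<longleftrightarrow>
     (\<exists>w. newtonian p M UNIV w \<and> (\<forall>x. x \<notin> \<Omega> \<longrightarrow> w x = 0) \<and> (\<forall>x\<in>\<Omega>. w x = u x))"

definition poincare :: "real \<Rightarrow> 'a::metric_space measure \<Rightarrow> bool" where
  "poincare p M \<longleftrightarrow>
     (\<exists>C lam::real. C > 0 \<and> lam \<ge> 1 \<and>
        (\<forall>u x r h. integrable M u \<and> r > 0 \<and> upper_gradient UNIV u h \<longrightarrow>
           epowr (eaverage M (ball x r)
                    (\<lambda>y. ennreal (\<bar>u y - average M (ball x r) u\<bar> powr p))) (1 / p)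
           \<le> ennreal (C * r) *
              epowr (eaverage M (ball x (lam * r)) (\<lambda>y. epowr (h y) p)) (1 / p)))"


section \<open>Cheeger differentiable structures\<close>

text \<open>For functions that are only locally Newtonian (such as the Lipschitz coordinate
  functions), the minimal weak upper gradient is the one in \<open>L\<^sup>p\<^bsub>loc\<^esub>\<close> that is a.e. below every
  other one; it agrees a.e. with \<^const>\<open>min_weak_ug\<close> on Newtonian functions.\<close>

definition newtonian_loc ::
  "real \<Rightarrow> 'a::metric_space measure \<Rightarrow> ('a \<Rightarrow> real) \<Rightarrow> bool" where
  "newtonian_loc p M u \<longleftrightarrow> (\<forall>x. \<exists>r>0. newtonian p M (ball x r) u)"

definition loc_Lp_weak_ug ::
  "real \<Rightarrow> 'a::metric_space measure \<Rightarrow> ('a \<Rightarrow> real) \<Rightarrow> ('a \<Rightarrow> ennreal) \<Rightarrow> bool" where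
  "loc_Lp_weak_ug p M u h \<longleftrightarrow>
     weak_upper_gradient p M UNIV u h \<and>
     (\<forall>x. \<exists>r>0. (\<integral>\<^sup>+y\<in>ball x r. epowr (h y) p \<partial>M) < \<infinity>)"

definition loc_min_weak_ug ::
  "real \<Rightarrow> 'a::metric_space measure \<Rightarrow> ('a \<Rightarrow> real) \<Rightarrow> 'a \<Rightarrow> ennreal" where
  "loc_min_weak_ug p M u =
     (SOME g. loc_Lp_weak_ug p M u g \<and>
        (\<forall>h. loc_Lp_weak_ug p M u h \<longrightarrow> (AE x in M. g x \<le> h x)))"

text \<open>Minimal weak upper gradients are determined only a.e. The value of \<open>g\<^sub>u\<close> at a given
  point is that of the representative obtained from averages of \<open>g\<^sub>u\<^sup>p\<close>; at a Lebesgue point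
  the upper limit is a limit. This value does not depend on the choice made in
  \<^const>\<open>loc_min_weak_ug\<close>.\<close>

definition min_ug_at ::
  "real \<Rightarrow> 'a::metric_space measure \<Rightarrow> ('a \<Rightarrow> real) \<Rightarrow> 'a \<Rightarrow> ennreal" where
  "min_ug_at p M u x0 =
     epowr (Limsup (at_right 0)
              (\<lambda>r. eaverage M (ball x0 r) (\<lambda>y. epowr (loc_min_weak_ug p M u y) p))) (1 / p)"

text \<open>Subtraction on \<^typ>\<open>ennreal\<close> truncates at \<open>0\<close>, so \<open>(a - b) + (b - a)\<close> is \<open>\<bar>a - b\<bar>\<close>.\<close>

definition lebesgue_point_min_ug ::
  "real \<Rightarrow> 'a::metric_space measure \<Rightarrow> ('a \<Rightarrow> real) \<Rightarrow> 'a \<Rightarrow> bool" where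
  "lebesgue_point_min_ug p M u x0 \<longleftrightarrow>
     (let G = (\<lambda>y. epowr (loc_min_weak_ug p M u y) p); c = epowr (min_ug_at p M u x0) p in
      ((\<lambda>r. eaverage M (ball x0 r) (\<lambda>y. (G y - c) + (c - G y))) \<longlongrightarrow> 0) (at_right 0))"

text \<open>The infimum below is at most the average it is subtracted from (take \<open>\<phi> = 0\<close>), so
  truncation has no effect here.\<close>

definition asymp_gen_linear ::
  "real \<Rightarrow> 'a::metric_space measure \<Rightarrow> ('a \<Rightarrow> real) \<Rightarrow> 'a \<Rightarrow> bool" where
  "asymp_gen_linear p M u x0 \<longleftrightarrow>
     newtonian_loc p M u \<and> lebesgue_point_min_ug p M u x0 \<and>
     ((\<lambda>r. eaverage M (ball x0 r) (\<lambda>y. epowr (loc_min_weak_ug p M u y) p)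
           - (INF \<phi>\<in>{\<phi>. newtonian p M UNIV \<phi> \<and> compact (closure {x. \<phi> x \<noteq> 0}) \<and>
                          closure {x. \<phi> x \<noteq> 0} \<subseteq> ball x0 r}.
                eaverage M (ball x0 r)
                  (\<lambda>y. epowr (loc_min_weak_ug p M (\<lambda>x. u x + \<phi> x) y) p)))
       \<longlongrightarrow> 0) (at_right 0)"

definition is_lipschitz :: "('a::metric_space \<Rightarrow> real) \<Rightarrow> bool" where
  "is_lipschitz u \<longleftrightarrow> (\<exists>L. L-lipschitz_on UNIV u)"

text \<open>The coordinate subspace of \<open>\<real>\<^sup>N\<close> on the index set \<open>J\<close>; with \<open>N(\<alpha>)\<close> the cardinality
  of \<open>J \<alpha>\<close>, this is \<open>\<real>\<^bsup>N(\<alpha>)\<^esup> \<subseteq> \<real>\<^sup>N\<close>.\<close>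

definition coord_subspace :: "'n set \<Rightarrow> (real ^ 'n) set" where
  "coord_subspace J = {a. \<forall>i. i \<notin> J \<longrightarrow> a $ i = 0}"

definition coord_comb ::
  "'n::finite set \<Rightarrow> ('n \<Rightarrow> 'a \<Rightarrow> real) \<Rightarrow> real ^ 'n \<Rightarrow> 'a \<Rightarrow> real" where
  "coord_comb J f a x = (\<Sum>j\<in>J. a $ j * f j x)"

text \<open>\<open>I\<close> indexes the (finitely or infinitely many) charts \<open>U \<alpha>\<close> with coordinate functions
  \<open>F \<alpha> j\<close> for \<open>j \<in> J \<alpha>\<close>; \<open>D \<alpha> u\<close> is the differential of \<open>u\<close> on \<open>U \<alpha>\<close>, and \<open>N = CARD('n)\<close>.\<close>

definition cheeger_charts ::
  "real \<Rightarrow> 'a::metric_space measure \<Rightarrow> nat set \<Rightarrow> (nat \<Rightarrow> 'a set) \<Rightarrow> (nat \<Rightarrow> 'n::finite set) \<Rightarrow>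
   (nat \<Rightarrow> 'n \<Rightarrow> 'a \<Rightarrow> real) \<Rightarrow> (nat \<Rightarrow> ('a \<Rightarrow> real) \<Rightarrow> 'a \<Rightarrow> real ^ 'n) \<Rightarrow> bool" where
  "cheeger_charts p M I U J F D \<longleftrightarrow>
     disjoint_family_on U I \<and>
     (\<forall>\<alpha>\<in>I. U \<alpha> \<in> sets M \<and> emeasure M (U \<alpha>) > 0) \<and>
     UNIV - (\<Union>\<alpha>\<in>I. U \<alpha>) \<in> null_sets M \<and>
     (\<forall>\<alpha>\<in>I. \<forall>j\<in>J \<alpha>. 1-lipschitz_on UNIV (F \<alpha> j)) \<and>
     (\<forall>\<alpha>\<in>I. \<forall>j\<in>J \<alpha>. \<forall>x\<in>U \<alpha>. asymp_gen_linear p M (F \<alpha> j) x) \<and>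
     (\<forall>\<alpha>\<in>I. \<forall>a\<in>coord_subspace (J \<alpha>) - {0}. \<forall>x\<in>U \<alpha>.
        min_ug_at p M (coord_comb (J \<alpha>) (F \<alpha>) a) x > 0) \<and>
     (\<forall>u. is_lipschitz u \<longrightarrow> (\<forall>\<alpha>\<in>I. \<exists>V\<subseteq>U \<alpha>.
        U \<alpha> - V \<in> null_sets M \<and>
        D \<alpha> u \<in> borel_measurable (restrict_space borel V) \<and>
        D \<alpha> u ` V \<subseteq> coord_subspace (J \<alpha>) \<and>
        (\<forall>x\<in>V. \<forall>a\<in>coord_subspace (J \<alpha>).
           min_ug_at p M (\<lambda>y. coord_comb (J \<alpha>) (F \<alpha>) a y - u y) x = 0 \<longleftrightarrow> a = D \<alpha> u x)))"

definition inner_product :: "(real ^ 'n \<Rightarrow> real ^ 'n \<Rightarrow> real) \<Rightarrow> bool" where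
  "inner_product b \<longleftrightarrow>
     bilinear b \<and> (\<forall>v w. b v w = b w v) \<and> (\<forall>v. v \<noteq> 0 \<longrightarrow> b v v > 0)"

text \<open>\<open>nabla\<close> is a bounded linear operator from \<open>N\<^bsup>1,p\<^esup>(X)\<close> to the space of \<open>L\<^sup>p\<close> fields, where
  the norm of the field \<open>\<xi>\<close> is that of \<open>x \<mapsto> \<bar>\<xi>(x)\<bar>\<^sub>x\<close>; since it acts on representatives,
  identities hold a.e.\<close>

definition cheeger_gradient ::
  "real \<Rightarrow> 'a::metric_space measure \<Rightarrow> nat set \<Rightarrow> (nat \<Rightarrow> 'a set) \<Rightarrow>
   (nat \<Rightarrow> ('a \<Rightarrow> real) \<Rightarrow> 'a \<Rightarrow> real ^ 'n::finite) \<Rightarrow>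
   ('a \<Rightarrow> real ^ 'n \<Rightarrow> real ^ 'n \<Rightarrow> real) \<Rightarrow> (('a \<Rightarrow> real) \<Rightarrow> 'a \<Rightarrow> real ^ 'n) \<Rightarrow> bool" where
  "cheeger_gradient p M I U D ip nabla \<longleftrightarrow>
     (AE x in M. inner_product (ip x)) \<and>
     (\<forall>v w. (\<lambda>x. ip x v w) \<in> borel_measurable M) \<and>
     (\<forall>u. newtonian p M UNIV u \<longrightarrow> nabla u \<in> borel_measurable M) \<and>
     (\<forall>u v (a::real) (b::real). newtonian p M UNIV u \<and> newtonian p M UNIV v \<longrightarrow>
        (AE x in M. nabla (\<lambda>y. a * u y + b * v y) x = a *\<^sub>R nabla u x + b *\<^sub>R nabla v x)) \<and>
     (\<exists>C::real. \<forall>u. newtonian p M UNIV u \<longrightarrow>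
        epowr (\<integral>\<^sup>+x. ennreal (sqrt (ip x (nabla u x) (nabla u x)) powr p) \<partial>M) (1 / p)
        \<le> ennreal C * newtonian_norm p M UNIV u) \<and>
     (\<forall>u. newtonian p M UNIV u \<and> is_lipschitz u \<longrightarrow>
        (\<forall>\<alpha>\<in>I. AE x in M. x \<in> U \<alpha> \<longrightarrow> nabla u x = D \<alpha> u x)) \<and>
     (\<forall>u v. newtonian p M UNIV u \<and> is_lipschitz u \<and> newtonian p M UNIV v \<and> is_lipschitz v \<and>
        newtonian p M UNIV (\<lambda>y. u y * v y) \<longrightarrow>
        (AE x in M. nabla (\<lambda>y. u y * v y) x = u x *\<^sub>R nabla v x + v x *\<^sub>R nabla u x)) \<and>
     (\<forall>u. newtonian p M UNIV u \<longrightarrow>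
        (AE x in M.
           ennreal (sqrt (ip x (nabla u x) (nabla u x))) \<le> min_weak_ug p M UNIV u x \<and>
           min_weak_ug p M UNIV u x
             \<le> ennreal (sqrt (real CARD('n)) * sqrt (ip x (nabla u x) (nabla u x)))))"


section \<open>The p-Poisson equation\<close>

definition lipschitz_cutoff :: "'a::metric_space set \<Rightarrow> ('a \<Rightarrow> real) \<Rightarrow> bool" where
  "lipschitz_cutoff \<Omega> \<eta> \<longleftrightarrow>
     is_lipschitz \<eta> \<and> (\<forall>x. 0 \<le> \<eta> x \<and> \<eta> x \<le> 1) \<and>
     compact (closure {x. \<eta> x \<noteq> 0}) \<and> closure {x. \<eta> x \<noteq> 0} \<subseteq> \<Omega>"

text \<open>The Cheeger gradient of \<open>u \<in> N\<^bsup>1,p\<^esup>(\<Omega>)\<close>, determined a.e. in \<open>\<Omega>\<close>. Note that \<open>\<eta> u\<close> vanishes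
  outside \<open>\<Omega>\<close> whatever the values of \<open>u\<close> there.\<close>

definition is_gradient_on ::
  "'a::metric_space measure \<Rightarrow> (('a \<Rightarrow> real) \<Rightarrow> 'a \<Rightarrow> real ^ 'n::finite) \<Rightarrow> 'a set \<Rightarrow>
   ('a \<Rightarrow> real) \<Rightarrow> ('a \<Rightarrow> real ^ 'n) \<Rightarrow> bool" where
  "is_gradient_on M nabla \<Omega> u G \<longleftrightarrow>
     G \<in> borel_measurable (restrict_space M \<Omega>) \<and>
     (\<forall>\<eta>. lipschitz_cutoff \<Omega> \<eta> \<longrightarrow>
        (AE x in M. \<eta> x = 1 \<longrightarrow> G x = nabla (\<lambda>y. \<eta> y * u y) x))"

definition gradient_on ::
  "'a::metric_space measure \<Rightarrow> (('a \<Rightarrow> real) \<Rightarrow> 'a \<Rightarrow> real ^ 'n::finite) \<Rightarrow> 'a set \<Rightarrow>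
   ('a \<Rightarrow> real) \<Rightarrow> 'a \<Rightarrow> real ^ 'n" where
  "gradient_on M nabla \<Omega> u = (SOME G. is_gradient_on M nabla \<Omega> u G)"

text \<open>Where \<open>\<nabla>u = 0\<close>, the integrand on the left is \<open>0\<close> for every \<open>p\<close>, since \<open>0 powr a = 0\<close>.\<close>

definition p_poisson_solution ::
  "real \<Rightarrow> 'a::metric_space measure \<Rightarrow> ('a \<Rightarrow> real ^ 'n \<Rightarrow> real ^ 'n \<Rightarrow> real) \<Rightarrow>
   (('a \<Rightarrow> real) \<Rightarrow> 'a \<Rightarrow> real ^ 'n::finite) \<Rightarrow> 'a set \<Rightarrow>
   ('a \<Rightarrow> real) \<Rightarrow> ('a \<Rightarrow> real) \<Rightarrow> ('a \<Rightarrow> real) \<Rightarrow> bool" where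
  "p_poisson_solution p M ip nabla \<Omega> f g u \<longleftrightarrow>
     newtonian p M \<Omega> u \<and> newtonian0 p M \<Omega> (\<lambda>x. u x - g x) \<and>
     (\<forall>\<phi>. newtonian0 p M \<Omega> \<phi> \<longrightarrow>
        (let Gu = gradient_on M nabla \<Omega> u; G\<phi> = gradient_on M nabla \<Omega> \<phi> in
         (LINT x:\<Omega>|M. sqrt (ip x (Gu x) (Gu x)) powr (p - 2) * ip x (Gu x) (G\<phi> x))
         = (LINT x:\<Omega>|M. f x * \<phi> x)))"

end

theory Submission
  imports Defs
begin

text \<open>
  Uniqueness is a consequence of the strict monotonicity of \<open>\<xi> \<mapsto> \<bar>\<xi>\<bar>\<^sup>p\<^sup>-\<^sup>2 \<xi>\<close>. If \<open>u\<close> and \<open>v\<close> are two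
  solutions, then \<open>w = u - v\<close>, extended by zero, is a Newtonian function on the whole space and an
  admissible test function. Subtracting the two equations tested with \<open>w\<close> leaves
  \<open>\<integral> \<langle>\<bar>\<nabla>u\<bar>\<^sup>p\<^sup>-\<^sup>2\<nabla>u - \<bar>\<nabla>v\<bar>\<^sup>p\<^sup>-\<^sup>2\<nabla>v, \<nabla>u - \<nabla>v\<rangle> d\<mu> = 0\<close> over \<open>\<Omega>\<close>. The integrand is nonnegative and vanishes only
  where \<open>\<nabla>u = \<nabla>v\<close> (\<open>flux_strictly_monotone\<close>), so \<open>\<nabla>w = 0\<close> almost everywhere, hence the minimal weak
  upper gradient of \<open>w\<close> vanishes. By the Poincare inequality \<open>w\<close> is constant almost everywhere on a ball
  that contains \<open>\<Omega>\<close> and a part of its complement of positive measure; as \<open>w = 0\<close> on that part, the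
  constant is \<open>0\<close> (\<open>zero_energy_vanishes\<close>).

  To make this precise several facts about weak upper gradients are needed. Most of them
  rest on one remark: outside a family of curves of modulus zero, the upper gradient
  inequality holds on all sub-arcs of a curve at once (\<open>weak_upper_gradient_arcs\<close>). In the arc length
  parametrization sub-arcs are intervals, so that properties along curves become elementary statements
  about functions on an interval, which can be cut into pieces.

    \<^item> Minimal weak upper gradients exist (\<open>minimal_weak_upper_gradient_exists\<close>). By uniform
      convexity, minimizing sequences converge.
    \<^item> They vanish where the function vanishes, at least on closed sets (\<open>min_weak_ug_zero_on\<close>): a curve
      is cut at its first and last visits to the closed set. Applied to the closed set where two
      cutoff functions both equal \<open>1\<close>, this makes the gradient on \<open>\<Omega>\<close> well defined
      (\<open>gradient_on_exists\<close>, \<open>is_gradient_on_unique\<close>).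
    \<^item> Cutting off preserves the Newtonian property (\<open>newtonian_cutoff\<close>), by a product rule.
    \<^item> The gradient of a Newtonian function on \<open>\<Omega>\<close> is in \<open>L\<^sup>p\<close> on all of \<open>\<Omega>\<close> (\<open>gradient_on_Lp\<close>), although
      it is defined by cutoffs whose Lipschitz constants blow up at the boundary. On a closed set with a
      neighbourhood where the cutoff is \<open>1\<close>, an upper gradient of the given function may be pasted into the
      minimal one of the cut-off function (\<open>weak_upper_gradient_glue\<close>), which bounds the latter
      independently of the cutoff. This integrability is what allows subtracting the two equations.

  Cutoffs with compact support exist because bounded closed sets in a complete doubling space are
  compact (\<open>doubling_bounded_closed_compact\<close>).
\<close>


section \<open>Arc length\<close>

abbreviation borel_on :: "'a::topological_space set \<Rightarrow> ('a \<Rightarrow> ennreal) set" where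
  "borel_on S \<equiv> borel_measurable (restrict_space borel S)"

fun polygon_length :: "(real \<Rightarrow> 'a::metric_space) \<Rightarrow> real list \<Rightarrow> real" where
  "polygon_length \<gamma> (x # y # ts) = dist (\<gamma> x) (\<gamma> y) + polygon_length \<gamma> (y # ts)"
| "polygon_length \<gamma> _ = 0"

lemma polygon_length_nonneg: "0 \<le> polygon_length \<gamma> ts"
  by (induction \<gamma> ts rule: polygon_length.induct) auto

lemma sum_dist_eq_polygon_length:
  "(\<Sum>i<length ts - 1. ennreal (dist (\<gamma> (ts ! i)) (\<gamma> (ts ! Suc i)))) = ennreal (polygon_length \<gamma> ts)"
proof (induction \<gamma> ts rule: polygon_length.induct)
  case (1 \<gamma> x y ts)
  have "(\<Sum>i<length (x # y # ts) - 1. ennreal (dist (\<gamma> ((x # y # ts) ! i)) (\<gamma> ((x # y # ts) ! Suc i))))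
     = ennreal (dist (\<gamma> x) (\<gamma> y)) +
       (\<Sum>i<length (y # ts) - 1. ennreal (dist (\<gamma> ((y # ts) ! i)) (\<gamma> ((y # ts) ! Suc i))))"
    by (simp add: sum.lessThan_Suc_shift del: sum.lessThan_Suc)
  with 1 show ?case by (simp add: polygon_length_nonneg del: sum.lessThan_Suc)
qed auto

lemma curve_length_eq:
  "curve_length (\<gamma>, a, b) = (SUP ts\<in>{ts. sorted ts \<and> set ts \<subseteq> {a..b}}. ennreal (polygon_length \<gamma> ts))"
  unfolding curve_length_def by (simp only: prod.case sum_dist_eq_polygon_length)

lemma polygon_length_le_curve_length:
  assumes "sorted ts" "set ts \<subseteq> {a..b}"
  shows "ennreal (polygon_length \<gamma> ts) \<le> curve_length (\<gamma>, a, b)"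
  unfolding curve_length_eq by (rule SUP_upper) (use assms in auto)

lemma polygon_length_append_le:
  "polygon_length \<gamma> xs + polygon_length \<gamma> ys \<le> polygon_length \<gamma> (xs @ ys)"
proof (induction \<gamma> xs rule: polygon_length.induct)
  case ("2_2" \<gamma> v)
  then show ?case by (cases ys) auto
qed auto

lemma polygon_length_insert:
  "polygon_length \<gamma> (xs @ ys) \<le> polygon_length \<gamma> (xs @ [c]) + polygon_length \<gamma> (c # ys)"
proof (induction \<gamma> xs rule: polygon_length.induct)
  case ("2_1" \<gamma>)
  then show ?case by (cases ys) auto
next
  case ("2_2" \<gamma> v)
  then show ?case
    by (cases ys) (use dist_triangle[of "\<gamma> v" _ "\<gamma> c"] in \<open>auto simp: polygon_length_nonneg\<close>)
qed auto

lemma polygon_length_insert2: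
  "polygon_length \<gamma> (xs @ ys)
     \<le> polygon_length \<gamma> (xs @ [c]) + dist (\<gamma> c) (\<gamma> d) + polygon_length \<gamma> (d # ys)"
  using polygon_length_insert[of \<gamma> xs ys c] polygon_length_insert[of \<gamma> "[c]" ys d] by simp

lemma curve_length_subinterval:
  assumes "a \<le> c" "d \<le> b"
  shows "curve_length (\<gamma>, c, d) \<le> curve_length (\<gamma>, a, b)"
  unfolding curve_length_eq by (rule SUP_subset_mono) (use assms in auto)

lemma dist_le_curve_length:
  assumes "a \<le> b"
  shows "ennreal (dist (\<gamma> a) (\<gamma> b)) \<le> curve_length (\<gamma>, a, b)"
  using polygon_length_le_curve_length[of "[a,b]" a b \<gamma>] assms by simp

text \<open>A partition with no point strictly between \<open>c\<close> and \<open>d\<close> loses at most the chord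
  from \<open>\<gamma> c\<close> to \<open>\<gamma> d\<close> when it is split there. With \<open>c = d\<close> this is one half of the additivity
  of length; with \<open>c < d\<close> it gives the continuity of the length function.\<close>

lemma polygon_length_split:
  assumes "sorted ts" "set ts \<subseteq> {a..b}" "a \<le> c" "c \<le> d" "d \<le> b" "set ts \<inter> {c<..<d} = {}"
  shows "ennreal (polygon_length \<gamma> ts)
    \<le> curve_length (\<gamma>, a, c) + ennreal (dist (\<gamma> c) (\<gamma> d)) + curve_length (\<gamma>, d, b)"
proof -
  define xs ys where "xs = takeWhile (\<lambda>x. x \<le> c) ts" and "ys = dropWhile (\<lambda>x. x \<le> c) ts"
  have ts: "ts = xs @ ys" by (simp add: xs_def ys_def)
  have xs: "\<forall>x\<in>set xs. x \<le> c" unfolding xs_def by (auto dest: set_takeWhileD)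
  have ys: "\<forall>y\<in>set ys. y > c"
  proof
    fix y assume y: "y \<in> set ys"
    then obtain z zs where zs: "ys = z # zs" by (cases ys) auto
    then have "\<not> z \<le> c" using hd_dropWhile[of "\<lambda>x. x \<le> c" ts] unfolding ys_def by simp
    moreover have "z \<le> y" using \<open>sorted ts\<close> y unfolding ts sorted_append zs by auto
    ultimately show "y > c" by linarith
  qed
  then have yd: "\<forall>y\<in>set ys. y \<ge> d" using assms(6) unfolding ts by fastforce
  have s: "sorted xs" "sorted ys" using \<open>sorted ts\<close> unfolding ts sorted_append by auto
  have "ennreal (polygon_length \<gamma> (xs @ [c])) \<le> curve_length (\<gamma>, a, c)"
    using xs s assms ts by (intro polygon_length_le_curve_length) (auto simp: sorted_append)
  moreover have "ennreal (polygon_length \<gamma> (d # ys)) \<le> curve_length (\<gamma>, d, b)"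
    using yd s assms ts by (intro polygon_length_le_curve_length) auto
  moreover have "ennreal (polygon_length \<gamma> ts)
      \<le> ennreal (polygon_length \<gamma> (xs @ [c])) + ennreal (dist (\<gamma> c) (\<gamma> d)) + ennreal (polygon_length \<gamma> (d # ys))"
    using polygon_length_insert2[of \<gamma> xs ys c d] unfolding ts
    by (simp add: polygon_length_nonneg flip: ennreal_plus)
  ultimately show ?thesis by (meson add_mono order_refl order_trans)
qed

lemma curve_length_refl: "curve_length (\<gamma>, a, a) = 0"
proof -
  have "polygon_length \<gamma> ts = 0" if "set ts \<subseteq> {a}" for ts
    using that by (induction \<gamma> ts rule: polygon_length.induct) auto
  then show ?thesis unfolding curve_length_eq by (intro antisym SUP_least) auto
qed

lemma curve_length_additive:
  assumes "a \<le> c" "c \<le> b"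
  shows "curve_length (\<gamma>, a, b) = curve_length (\<gamma>, a, c) + curve_length (\<gamma>, c, b)"
proof (rule antisym)
  show "curve_length (\<gamma>, a, b) \<le> curve_length (\<gamma>, a, c) + curve_length (\<gamma>, c, b)"
    unfolding curve_length_eq[of _ a b]
    using polygon_length_split[of _ a b c c \<gamma>] assms by (intro SUP_least) auto
  have "ennreal (polygon_length \<gamma> xs) + ennreal (polygon_length \<gamma> ys) \<le> curve_length (\<gamma>, a, b)"
    if "sorted xs" "set xs \<subseteq> {a..c}" "sorted ys" "set ys \<subseteq> {c..b}" for xs ys
  proof -
    have "ennreal (polygon_length \<gamma> xs) + ennreal (polygon_length \<gamma> ys)
        \<le> ennreal (polygon_length \<gamma> (xs @ ys))"
      using polygon_length_append_le[of \<gamma> xs ys]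
      by (simp add: polygon_length_nonneg flip: ennreal_plus)
    also have "\<dots> \<le> curve_length (\<gamma>, a, b)"
      using that assms by (intro polygon_length_le_curve_length) (fastforce simp: sorted_append)+
    finally show ?thesis .
  qed
  note * = this
  have ne: "{ts. sorted ts \<and> set ts \<subseteq> {c..b}} \<noteq> {}" by (auto intro: exI[of _ "[]"])
  have ne': "{ts. sorted ts \<and> set ts \<subseteq> {a..c}} \<noteq> {}" by (auto intro: exI[of _ "[]"])
  have "ennreal (polygon_length \<gamma> xs) + curve_length (\<gamma>, c, b) \<le> curve_length (\<gamma>, a, b)"
    if "sorted xs" "set xs \<subseteq> {a..c}" for xs
    unfolding curve_length_eq[of _ c b] using * that
    by (subst ennreal_SUP_add_right[OF ne]) (auto intro!: SUP_least)
  then show "curve_length (\<gamma>, a, c) + curve_length (\<gamma>, c, b) \<le> curve_length (\<gamma>, a, b)"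
    unfolding curve_length_eq[of _ a c] by (subst ennreal_SUP_add_left[symmetric, OF ne'])
      (auto intro!: SUP_least)
qed

text \<open>Meaningful for curves of finite length only; on others \<^const>\<open>enn2real\<close> turns \<open>\<infinity>\<close> into \<open>0\<close>.\<close>

definition arc_length :: "'a::metric_space curve \<Rightarrow> real \<Rightarrow> real" where
  "arc_length = (\<lambda>(\<gamma>, a, b) t. enn2real (curve_length (\<gamma>, a, t)))"

lemma ennreal_arc_length:
  assumes "curve_length (\<gamma>, a, b) < \<infinity>" "t \<le> b"
  shows "ennreal (arc_length (\<gamma>, a, b) t) = curve_length (\<gamma>, a, t)"
proof -
  have "curve_length (\<gamma>, a, t) < \<infinity>"
    by (rule le_less_trans[OF curve_length_subinterval assms(1)]) (use assms in auto)
  then show ?thesis by (simp add: arc_length_def)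
qed

lemma arc_length_diff:
  assumes "curve_length (\<gamma>, a, b) < \<infinity>" "a \<le> s" "s \<le> t" "t \<le> b"
  shows "curve_length (\<gamma>, s, t) = ennreal (arc_length (\<gamma>, a, b) t - arc_length (\<gamma>, a, b) s)"
    and "arc_length (\<gamma>, a, b) s \<le> arc_length (\<gamma>, a, b) t"
    and "dist (\<gamma> s) (\<gamma> t) \<le> arc_length (\<gamma>, a, b) t - arc_length (\<gamma>, a, b) s"
proof -
  have fin: "curve_length (\<gamma>, s, t) < \<infinity>"
    by (rule le_less_trans[OF curve_length_subinterval assms(1)]) (use assms in auto)
  then obtain r where r: "curve_length (\<gamma>, s, t) = ennreal r" "r \<ge> 0"
    by (cases "curve_length (\<gamma>, s, t)") auto
  have "ennreal (arc_length (\<gamma>, a, b) t) = ennreal (arc_length (\<gamma>, a, b) s) + ennreal r"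
    using curve_length_additive[of a s t \<gamma>] assms by (simp add: ennreal_arc_length r)
  then have eq: "arc_length (\<gamma>, a, b) t = arc_length (\<gamma>, a, b) s + r"
    using r(2) by (simp add: arc_length_def flip: ennreal_plus)
  then show "curve_length (\<gamma>, s, t) = ennreal (arc_length (\<gamma>, a, b) t - arc_length (\<gamma>, a, b) s)"
    "arc_length (\<gamma>, a, b) s \<le> arc_length (\<gamma>, a, b) t"
    using r by auto
  show "dist (\<gamma> s) (\<gamma> t) \<le> arc_length (\<gamma>, a, b) t - arc_length (\<gamma>, a, b) s"
    using dist_le_curve_length[of s t \<gamma>] assms eq r by (simp add: ennreal_le_iff)
qed

text \<open>A partition whose polygon has almost the full length keeps almost the full length when the
  interval between \<open>t\<^sub>0\<close> and a nearby \<open>t\<close> is replaced by a chord, and the chord is short by the continuity of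
  the curve. So the arc between them is short.\<close>

lemma continuous_on_arc_length:
  assumes fin: "curve_length (\<gamma>, a, b) < \<infinity>" and cont: "continuous_on {a..b} \<gamma>" and "a \<le> b"
  shows "continuous_on {a..b} (arc_length (\<gamma>, a, b))"
  unfolding continuous_on_iff
proof (intro ballI allI impI)
  fix t0 e :: real assume t0: "t0 \<in> {a..b}" and e: "e > 0"
  define l where "l = arc_length (\<gamma>, a, b)"
  note fin' = fin[unfolded infinity_ennreal_def]
  have lb: "curve_length (\<gamma>, a, b) = ennreal (l b)"
    using ennreal_arc_length[OF fin] by (simp add: l_def)
  have "l b \<ge> 0" by (simp add: l_def arc_length_def)
  obtain ts where ts: "sorted ts" "set ts \<subseteq> {a..b}" "l b < polygon_length \<gamma> ts + e / 2"
  proof (cases "l b < e / 2")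
    case True
    then show ?thesis using that[of "[]"] e by simp
  next
    case False
    then have "ennreal (l b - e / 2) < (SUP ts\<in>{ts. sorted ts \<and> set ts \<subseteq> {a..b}}. ennreal (polygon_length \<gamma> ts))"
      using lb e unfolding curve_length_eq by (simp add: ennreal_lessI)
    then obtain ts where "sorted ts" "set ts \<subseteq> {a..b}" "ennreal (l b - e / 2) < ennreal (polygon_length \<gamma> ts)"
      unfolding less_SUP_iff by auto
    then show ?thesis using that[of ts] False by (auto simp: ennreal_less_iff)
  qed
  obtain d1 where d1: "d1 > 0" "\<And>t. t \<in> {a..b} \<Longrightarrow> dist t t0 < d1 \<Longrightarrow> dist (\<gamma> t) (\<gamma> t0) < e / 2"
    using cont t0 e unfolding continuous_on_iff by (metis half_gt_zero)
  obtain d2 where d2: "d2 > 0" "\<And>t. t \<in> set ts - {t0} \<Longrightarrow> d2 \<le> dist t0 t"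
    using finite_set_avoid[of "set ts" t0] by auto
  have main: "\<bar>l s - l t\<bar> < e" if st: "a \<le> s" "s \<le> t" "t \<le> b" "t - s < min d1 d2" "s = t0 \<or> t = t0" for s t
  proof -
    have avoid: "set ts \<inter> {s<..<t} = {}"
    proof (rule ccontr)
      assume "set ts \<inter> {s<..<t} \<noteq> {}"
      then obtain x where x: "x \<in> set ts" "s < x" "x < t" by auto
      then have "d2 \<le> dist t0 x" using d2(2)[of x] st by auto
      then show False using x st by (auto simp: dist_real_def)
    qed
    have "ennreal (polygon_length \<gamma> ts) \<le> ennreal (l s) + ennreal (dist (\<gamma> s) (\<gamma> t)) + ennreal (l b - l t)"
      using polygon_length_split[OF ts(1,2) _ _ _ avoid, of \<gamma>] st
        ennreal_arc_length[OF fin, of s] arc_length_diff(1)[OF fin, of t b] by (simp add: l_def)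
    moreover have "l s \<ge> 0" by (simp add: l_def arc_length_def)
    moreover have "l t \<le> l b" "l s \<le> l t" using arc_length_diff(2)[OF fin] st by (auto simp: l_def)
    ultimately have "polygon_length \<gamma> ts \<le> l s + dist (\<gamma> s) (\<gamma> t) + (l b - l t)"
      by (simp flip: ennreal_plus)
    moreover have "dist (\<gamma> s) (\<gamma> t) < e / 2"
      using d1(2)[of s] d1(2)[of t] st by (auto simp: dist_real_def dist_commute)
    moreover have "l b < polygon_length \<gamma> ts + e / 2"
      by (rule ts(3))
    ultimately show ?thesis using \<open>l s \<le> l t\<close> by linarith
  qed
  show "\<exists>d>0. \<forall>x'\<in>{a..b}. dist x' t0 < d \<longrightarrow> dist (arc_length (\<gamma>, a, b) x') (arc_length (\<gamma>, a, b) t0) < e"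
  proof (intro exI conjI ballI impI)
    show "min d1 d2 > 0" using d1 d2 by auto
    fix x' assume "x' \<in> {a..b}" "dist x' t0 < min d1 d2"
    then show "dist (arc_length (\<gamma>, a, b) x') (arc_length (\<gamma>, a, b) t0) < e"
    proof (cases "x' \<le> t0")
      case True
      then show ?thesis using main[of x' t0] t0 \<open>x' \<in> _\<close> \<open>dist x' t0 < _\<close>
        unfolding l_def dist_real_def by simp
    next
      case False
      then show ?thesis using main[of t0 x'] t0 \<open>x' \<in> _\<close> \<open>dist x' t0 < _\<close>
        unfolding l_def dist_real_def by (simp add: abs_minus_commute)
    qed
  qed
qed


abbreviation total_length :: "'a::metric_space curve \<Rightarrow> real" where
  "total_length c \<equiv> enn2real (curve_length c)"

lemma arc_length_onto:
  assumes c: "rectifiable_curve S (\<gamma>, a, b)" and s: "s \<in> {0..total_length (\<gamma>, a, b)}"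
  shows "\<exists>t\<in>{a..b}. arc_length (\<gamma>, a, b) t = s"
proof -
  have "\<exists>t\<ge>a. t \<le> b \<and> arc_length (\<gamma>, a, b) t = s"
  proof (rule IVT')
    show "arc_length (\<gamma>, a, b) a \<le> s" "s \<le> arc_length (\<gamma>, a, b) b"
      using s by (simp_all add: arc_length_def curve_length_refl)
    show "a \<le> b" "continuous_on {a..b} (arc_length (\<gamma>, a, b))"
      using c continuous_on_arc_length[of \<gamma> a b] by (simp_all add: rectifiable_curve_def)
  qed
  then show ?thesis by auto
qed

text \<open>Points with the same arc length agree, so the arbitrary choice in \<^const>\<open>arc_param\<close> does no harm.\<close>

lemma arc_param_arc_length:
  assumes c: "rectifiable_curve S (\<gamma>, a, b)" and t: "t \<in> {a..b}"
  shows "arc_param (\<gamma>, a, b) (arc_length (\<gamma>, a, b) t) = \<gamma> t"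
proof -
  have fin: "curve_length (\<gamma>, a, b) < \<infinity>" using c by (simp add: rectifiable_curve_def)
  define t' where "t' = (SOME t'. t' \<in> {a..b} \<and> curve_length (\<gamma>, a, t') = ennreal (arc_length (\<gamma>, a, b) t))"
  have "t' \<in> {a..b} \<and> curve_length (\<gamma>, a, t') = ennreal (arc_length (\<gamma>, a, b) t)"
    unfolding t'_def by (rule someI[of _ t]) (use t ennreal_arc_length[OF fin] in auto)
  then have t': "t' \<in> {a..b}" "arc_length (\<gamma>, a, b) t' = arc_length (\<gamma>, a, b) t"
    by (auto simp: arc_length_def)
  have "dist (\<gamma> t') (\<gamma> t) \<le> 0"
  proof (cases "t \<le> t'")
    case True
    then show ?thesis
      using arc_length_diff(3)[OF fin, of t t'] t t' unfolding atLeastAtMost_iff dist_commute[of "\<gamma> t'"] by linarith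
  next
    case False
    then show ?thesis
      using arc_length_diff(3)[OF fin, of t' t] t t' unfolding atLeastAtMost_iff by linarith
  qed
  then show ?thesis unfolding arc_param_def prod.case t'_def[symmetric] by simp
qed

lemma arc_param_in:
  assumes c: "rectifiable_curve S c" and s: "s \<in> {0..total_length c}"
  shows "arc_param c s \<in> S"
proof -
  obtain \<gamma> a b where c': "c = (\<gamma>, a, b)" by (cases c)
  obtain t where "t \<in> {a..b}" "arc_length (\<gamma>, a, b) t = s"
    using arc_length_onto[OF c[unfolded c'] s[unfolded c']] by blast
  then have "arc_param c s = \<gamma> t" using arc_param_arc_length[OF c[unfolded c']] c' by auto
  then show ?thesis using c \<open>t \<in> _\<close> by (auto simp: c' rectifiable_curve_def)
qed

lemma arc_param_lipschitz:
  assumes c: "rectifiable_curve S c" and s: "0 \<le> s" "s \<le> t" "t \<le> total_length c"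
  shows "dist (arc_param c s) (arc_param c t) \<le> t - s"
proof -
  obtain \<gamma> a b where c': "c = (\<gamma>, a, b)" by (cases c)
  obtain s' t' where st: "s' \<in> {a..b}" "arc_length (\<gamma>, a, b) s' = s"
     "t' \<in> {a..b}" "arc_length (\<gamma>, a, b) t' = t"
    using arc_length_onto[OF c[unfolded c'], of s] arc_length_onto[OF c[unfolded c'], of t] s
    unfolding c'[symmetric] by auto
  have fin: "curve_length (\<gamma>, a, b) < \<infinity>" using c by (simp add: rectifiable_curve_def c')
  have eq: "arc_param c s = \<gamma> s'" "arc_param c t = \<gamma> t'"
    using arc_param_arc_length[OF c[unfolded c']] st unfolding c'[symmetric] by auto
  show ?thesis
  proof (cases "s' \<le> t'")
    case True
    then show ?thesis using arc_length_diff(3)[OF fin, of s' t'] st unfolding eq by simp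
  next
    case False
    then show ?thesis using arc_length_diff(3)[OF fin, of t' s'] st s unfolding eq dist_commute[of "\<gamma> s'"] by simp
  qed
qed

lemma continuous_on_arc_param:
  assumes "rectifiable_curve S c"
  shows "continuous_on {0..total_length c} (arc_param c)"
proof -
  have "dist (arc_param c s) (arc_param c t) \<le> dist s t"
    if "s \<in> {0..total_length c}" "t \<in> {0..total_length c}" for s t
    using arc_param_lipschitz[OF assms, of s t] arc_param_lipschitz[OF assms, of t s] that
    by (cases "s \<le> t") (auto simp: dist_real_def dist_commute)
  then show ?thesis unfolding continuous_on_iff by (meson le_less_trans)
qed

definition arc_integral :: "('a::metric_space \<Rightarrow> ennreal) \<Rightarrow> 'a curve \<Rightarrow> real \<Rightarrow> real \<Rightarrow> ennreal" where
  "arc_integral h c s t = (\<integral>\<^sup>+r\<in>{s..t}. h (arc_param c r) \<partial>lborel)"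

lemma line_integral_eq: "line_integral h c = arc_integral h c 0 (total_length c)"
  by (simp add: line_integral_def arc_integral_def)

lemma measurable_arc_param:
  fixes h :: "'a::metric_space \<Rightarrow> ennreal"
  assumes c: "rectifiable_curve T c" and h: "h \<in> borel_on S"
    and st: "0 \<le> s" "t \<le> total_length c" and S: "\<And>r. r \<in> {s..t} \<Longrightarrow> arc_param c r \<in> S"
  shows "(\<lambda>r. h (arc_param c r) * indicator {s..t} r) \<in> borel_measurable borel"
proof -
  have "continuous_on {s..t} (arc_param c)"
    by (rule continuous_on_subset[OF continuous_on_arc_param[OF c]]) (use st in auto)
  then have "arc_param c \<in> restrict_space borel {s..t} \<rightarrow>\<^sub>M restrict_space borel S"
    using S by (auto intro!: measurable_restrict_space2 borel_measurable_continuous_on_restrict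
      simp: space_restrict_space)
  then have "(\<lambda>r. h (arc_param c r)) \<in> borel_measurable (restrict_space borel {s..t})"
    using h by (rule measurable_compose)
  then show ?thesis
    by (subst (asm) borel_measurable_restrict_space_iff_ennreal) auto
qed

text \<open>Sub-arcs are intervals of the arc-length parameter, which reduces all statements about
  the subcurves of a curve to statements about one function on an interval.\<close>

lemma sub_arc_is_curve:
  assumes c: "rectifiable_curve T c" and st: "0 \<le> s" "s \<le> t" "t \<le> total_length c"
  obtains \<gamma> a b where "a \<le> b" "continuous_on {a..b} \<gamma>" "curve_length (\<gamma>, a, b) = ennreal (t - s)"
    "\<gamma> a = arc_param c s" "\<gamma> b = arc_param c t" "\<gamma> ` {a..b} = arc_param c ` {s..t}"
    "\<not> \<gamma> constant_on {a..b} \<longrightarrow> (\<forall>x\<in>{s..t}. arc_param (\<gamma>, a, b) (x - s) = arc_param c x)"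
proof -
  obtain \<gamma> a b where c': "c = (\<gamma>, a, b)" by (cases c)
  note c1 = c[unfolded c']
  have fin: "curve_length (\<gamma>, a, b) < \<infinity>" and ab: "a \<le> b" and cont: "continuous_on {a..b} \<gamma>"
    using c1 by (auto simp: rectifiable_curve_def)
  define l where "l = arc_length (\<gamma>, a, b)"
  obtain s' t' where st': "s' \<in> {a..b}" "l s' = s" "t' \<in> {a..b}" "l t' = t" "s' \<le> t'"
  proof -
    obtain s' t' where *: "s' \<in> {a..b}" "l s' = s" "t' \<in> {a..b}" "l t' = t"
      using arc_length_onto[OF c1, of s] arc_length_onto[OF c1, of t] st
      unfolding l_def c'[symmetric] by auto
    show ?thesis
    proof (cases "s' \<le> t'")
      case False
      then have "t \<le> s" using arc_length_diff(2)[OF fin, of t' s'] * by (auto simp: l_def)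
      then show ?thesis using that[of s' s'] * st by auto
    qed (use that * in auto)
  qed
  have len: "curve_length (\<gamma>, s', t') = ennreal (t - s)"
    using arc_length_diff(1)[OF fin, of s' t'] st' by (auto simp: l_def)
  have l_in: "l x \<in> {s..t}" if "x \<in> {s'..t'}" for x
    using arc_length_diff(2)[OF fin, of s' x] arc_length_diff(2)[OF fin, of x t'] st' that
    by (auto simp: l_def)
  have l_onto: "\<exists>x'\<in>{s'..t'}. l x' = x" if "x \<in> {s..t}" for x
  proof -
    have "\<exists>x'\<ge>s'. x' \<le> t' \<and> l x' = x"
      using that st' continuous_on_subset[OF continuous_on_arc_length[OF fin cont ab], of "{s'..t'}"]
      by (intro IVT') (auto simp: l_def)
    then show ?thesis by auto
  qed
  show ?thesis
  proof (rule that[of s' t' \<gamma>])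
    show "s' \<le> t'" by (rule st')
    show cont': "continuous_on {s'..t'} \<gamma>"
      by (rule continuous_on_subset[OF cont]) (use st' in auto)
    show "curve_length (\<gamma>, s', t') = ennreal (t - s)" by (rule len)
    show "\<gamma> s' = arc_param c s" "\<gamma> t' = arc_param c t"
      using arc_param_arc_length[OF c1] st' unfolding c' l_def by auto
    show "\<gamma> ` {s'..t'} = arc_param c ` {s..t}"
    proof (intro equalityI subsetI)
      fix y assume "y \<in> \<gamma> ` {s'..t'}"
      then obtain x where "x \<in> {s'..t'}" "y = \<gamma> x" by auto
      then show "y \<in> arc_param c ` {s..t}"
        using l_in[of x] arc_param_arc_length[OF c1, of x] st' unfolding c' l_def by (auto intro!: rev_image_eqI)
    next
      fix y assume "y \<in> arc_param c ` {s..t}"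
      then obtain x where x: "x \<in> {s..t}" "y = arc_param c x" by auto
      then obtain x' where "x' \<in> {s'..t'}" "l x' = x" using l_onto by blast
      then show "y \<in> \<gamma> ` {s'..t'}"
        using arc_param_arc_length[OF c1, of x'] st' x unfolding c' l_def by (auto intro!: rev_image_eqI)
    qed
    show "\<not> \<gamma> constant_on {s'..t'} \<longrightarrow> (\<forall>x\<in>{s..t}. arc_param (\<gamma>, s', t') (x - s) = arc_param c x)"
    proof (intro impI ballI)
      fix x assume nc: "\<not> \<gamma> constant_on {s'..t'}" and x: "x \<in> {s..t}"
      then obtain x' where x': "x' \<in> {s'..t'}" "l x' = x" using l_onto by blast
      have c2: "rectifiable_curve UNIV (\<gamma>, s', t')"
        using nc cont' len st' by (auto simp: rectifiable_curve_def)
      have "arc_length (\<gamma>, s', t') x' = x - s"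
        using arc_length_diff(1)[OF fin, of s' x'] x' x st' by (auto simp: l_def arc_length_def)
      then show "arc_param (\<gamma>, s', t') (x - s) = arc_param c x"
        using arc_param_arc_length[OF c2, of x'] arc_param_arc_length[OF c1, of x'] x' st'
        unfolding c' l_def by auto
    qed
  qed
qed


section \<open>Powers of extended nonnegative numbers\<close>

lemma epowr_top [simp]: "epowr top p = top"
  by (simp add: epowr_def)

lemma epowr_ennreal: "0 \<le> x \<Longrightarrow> epowr (ennreal x) p = ennreal (x powr p)"
  by (simp add: epowr_def)

lemma epowr_0 [simp]: "epowr 0 p = 0"
  by (simp add: epowr_def)

lemma epowr_mono:
  assumes "x \<le> y" "0 \<le> p" shows "epowr x p \<le> epowr y p"
  using assms by (cases x; cases y) (auto simp: epowr_ennreal top_unique intro!: ennreal_leI powr_mono2)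

lemma epowr_eq_0_iff [simp]: "epowr x p = 0 \<longleftrightarrow> x = 0"
  by (cases x) (auto simp: epowr_ennreal)

lemma epowr_eq_top_iff [simp]: "epowr x p = top \<longleftrightarrow> x = top"
  by (cases x) (auto simp: epowr_ennreal)

lemma epowr_epowr: "epowr (epowr x p) q = epowr x (p * q)"
  by (cases x) (auto simp: epowr_ennreal powr_powr)

lemma epowr_1 [simp]: "epowr x 1 = x"
  by (cases x) (auto simp: epowr_ennreal)

lemma epowr_mult:
  shows "epowr (x * y) p = epowr x p * epowr y p"
proof (cases "x = 0 \<or> y = 0")
  case False
  then show ?thesis
    by (cases x; cases y) (auto simp: epowr_ennreal powr_mult ennreal_mult_top ennreal_top_mult
        simp flip: ennreal_mult)
qed auto

lemma borel_measurable_epowr [measurable (raw)]: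
  assumes [measurable]: "f \<in> borel_measurable M"
  shows "(\<lambda>x. epowr (f x) p) \<in> borel_measurable M"
  unfolding epowr_def by measurable

lemma epowr_add_le:
  assumes "0 \<le> p"
  shows "epowr (x + y) p \<le> ennreal (2 powr p) * (epowr x p + epowr y p)"
proof -
  have "x + y \<le> max x y + max x y" by (intro add_mono) auto
  also have "\<dots> = 2 * max x y" by (simp add: mult_2)
  finally have "epowr (x + y) p \<le> epowr (2 * max x y) p" using assms by (rule epowr_mono)
  also have "\<dots> = ennreal (2 powr p) * epowr (max x y) p"
    using epowr_ennreal[of 2 p] by (simp add: epowr_mult)
  also have "\<dots> \<le> ennreal (2 powr p) * (epowr x p + epowr y p)"
    by (intro mult_left_mono) (auto simp: max_def)
  finally show ?thesis .
qed

lemma le_epowr_inverse: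
  assumes "epowr x p \<le> y" "0 < p" shows "x \<le> epowr y (1 / p)"
  using epowr_mono[OF assms(1), of "1 / p"] assms(2) by (simp add: epowr_epowr)

text \<open>Each term is at most the \<open>p\<close>-th root of the sum on the right. This serves to combine countably many
  functions of small energy into one.\<close>

lemma epowr_SUP_le:
  assumes "0 < p"
  shows "epowr (SUP i. f i) p \<le> (\<Sum>i. epowr (f (i::nat)) p)"
proof -
  have "f i \<le> epowr (\<Sum>i. epowr (f i) p) (1 / p)" for i
    using sum_le_suminf[of "\<lambda>i. epowr (f i) p" "{i}"] assms by (intro le_epowr_inverse) auto
  then have "epowr (SUP i. f i) p \<le> epowr (epowr (\<Sum>i. epowr (f i) p) (1 / p)) p"
    using assms by (intro epowr_mono SUP_least) auto
  then show ?thesis using assms by (simp add: epowr_epowr)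
qed


section \<open>Integrals along an interval\<close>

lemma nn_integral_interval_split:
  fixes H :: "real \<Rightarrow> ennreal"
  assumes H: "(\<lambda>r. H r * indicator {a..c} r) \<in> borel_measurable borel" and "a \<le> b" "b \<le> c"
  shows "(\<integral>\<^sup>+r\<in>{a..c}. H r \<partial>lborel) = (\<integral>\<^sup>+r\<in>{a..b}. H r \<partial>lborel) + (\<integral>\<^sup>+r\<in>{b..c}. H r \<partial>lborel)"
proof -
  note [measurable] = H
  have "(\<integral>\<^sup>+r\<in>{a..c}. H r \<partial>lborel)
      = (\<integral>\<^sup>+r. (H r * indicator {a..c} r) * indicator {a..b} r + (H r * indicator {a..c} r) * indicator {b<..c} r \<partial>lborel)"
    using assms by (intro nn_integral_cong) (auto split: split_indicator)
  also have "\<dots> = (\<integral>\<^sup>+r. (H r * indicator {a..c} r) * indicator {a..b} r \<partial>lborel)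
      + (\<integral>\<^sup>+r. (H r * indicator {a..c} r) * indicator {b<..c} r \<partial>lborel)"
    by (rule nn_integral_add) measurable
  also have "(\<integral>\<^sup>+r. (H r * indicator {a..c} r) * indicator {a..b} r \<partial>lborel) = (\<integral>\<^sup>+r\<in>{a..b}. H r \<partial>lborel)"
    using assms by (intro nn_integral_cong) (auto split: split_indicator)
  also have "(\<integral>\<^sup>+r. (H r * indicator {a..c} r) * indicator {b<..c} r \<partial>lborel) = (\<integral>\<^sup>+r\<in>{b..c}. H r \<partial>lborel)"
    using assms(2,3) by (intro nn_integral_cong_AE eventually_mono[OF AE_lborel_singleton[of b]])
      (auto simp: indicator_def)
  finally show ?thesis .
qed

lemma measurable_subinterval:
  fixes H :: "real \<Rightarrow> ennreal"
  assumes "(\<lambda>r. H r * indicator {a..d} r) \<in> borel_measurable borel" "a \<le> b" "c \<le> d"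
  shows "(\<lambda>r. H r * indicator {b..c} r) \<in> borel_measurable borel"
proof -
  note [measurable] = assms(1)
  have "(\<lambda>r. (H r * indicator {a..d} r) * indicator {b..c} r) \<in> borel_measurable borel" by measurable
  also have "(\<lambda>r. (H r * indicator {a..d} r) * indicator {b..c} r) = (\<lambda>r. H r * indicator {b..c} r)"
    using assms by (auto split: split_indicator)
  finally show ?thesis .
qed

lemma ennreal_abs_diff_triangle:
  fixes x y z :: real
  assumes "ennreal \<bar>x - y\<bar> \<le> A" "ennreal \<bar>y - z\<bar> \<le> B"
  shows "ennreal \<bar>x - z\<bar> \<le> A + B"
proof -
  have "ennreal \<bar>x - z\<bar> \<le> ennreal (\<bar>x - y\<bar> + \<bar>y - z\<bar>)" by (intro ennreal_leI) auto
  also have "\<dots> \<le> A + B" using assms by (simp add: add_mono)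
  finally show ?thesis .
qed

text \<open>An interval is exhausted by steps of length \<open>\<delta> / 2\<close>; differences satisfy the triangle inequality and
  integrals are additive.\<close>

lemma short_intervals_suffice:
  fixes H :: "real \<Rightarrow> ennreal" and f :: "real \<Rightarrow> real"
  assumes H: "(\<lambda>r. H r * indicator {s..t} r) \<in> borel_measurable borel" and "s \<le> t" "0 < \<delta>"
    and short: "\<And>a b. s \<le> a \<Longrightarrow> a \<le> b \<Longrightarrow> b \<le> t \<Longrightarrow> b - a < \<delta> \<Longrightarrow>
      ennreal \<bar>f a - f b\<bar> \<le> (\<integral>\<^sup>+r\<in>{a..b}. H r \<partial>lborel)"
  shows "ennreal \<bar>f s - f t\<bar> \<le> (\<integral>\<^sup>+r\<in>{s..t}. H r \<partial>lborel)"
proof -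
  have "ennreal \<bar>f a - f t\<bar> \<le> (\<integral>\<^sup>+r\<in>{a..t}. H r \<partial>lborel)"
    if "s \<le> a" "a \<le> t" "t - a < real n * (\<delta> / 2)" for a n
    using that
  proof (induction n arbitrary: a)
    case (Suc n)
    show ?case
    proof (cases "t - a < \<delta>")
      case False
      define m where "m = a + \<delta> / 2"
      have m: "a \<le> m" "m \<le> t" "m - a < \<delta>" "t - m < real n * (\<delta> / 2)"
        using False Suc.prems \<open>0 < \<delta>\<close> by (auto simp: m_def algebra_simps)
      have "ennreal \<bar>f a - f t\<bar> \<le> (\<integral>\<^sup>+r\<in>{a..m}. H r \<partial>lborel) + (\<integral>\<^sup>+r\<in>{m..t}. H r \<partial>lborel)"
        by (rule ennreal_abs_diff_triangle[OF short Suc.IH]) (use m Suc.prems in auto)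
      also have "\<dots> = (\<integral>\<^sup>+r\<in>{a..t}. H r \<partial>lborel)"
        using m Suc.prems by (intro nn_integral_interval_split[symmetric] measurable_subinterval[OF H]) auto
      finally show ?thesis .
    qed (use Suc.prems short in auto)
  qed auto
  moreover obtain n where "t - s < real n * (\<delta> / 2)"
    using \<open>0 < \<delta>\<close> by (metis reals_Archimedean3 half_gt_zero)
  ultimately show ?thesis using \<open>s \<le> t\<close> by auto
qed

text \<open>A path is cut at its first and last visits to the zero set \<open>K\<close>: the two end pieces carry
  the whole difference of the end values, and the part between them contributes nothing.\<close>

lemma first_last_visit:
  fixes H :: "real \<Rightarrow> ennreal" and f :: "real \<Rightarrow> real" and \<sigma> :: "real \<Rightarrow> 'a::metric_space"
  assumes H: "(\<lambda>r. H r * indicator {s..t} r) \<in> borel_measurable borel" and "s \<le> t"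
    and cont: "continuous_on {s..t} \<sigma>" and "closed K"
    and zero: "\<And>r. r \<in> {s..t} \<Longrightarrow> \<sigma> r \<in> K \<Longrightarrow> f r = 0"
    and off: "\<And>a b. s \<le> a \<Longrightarrow> a \<le> b \<Longrightarrow> b \<le> t \<Longrightarrow> (\<And>r. r \<in> {a<..<b} \<Longrightarrow> \<sigma> r \<notin> K) \<Longrightarrow>
      ennreal \<bar>f a - f b\<bar> \<le> (\<integral>\<^sup>+r\<in>{a..b}. H r \<partial>lborel)"
  shows "ennreal \<bar>f s - f t\<bar> \<le> (\<integral>\<^sup>+r\<in>{s..t}. H r \<partial>lborel)"
proof (cases "\<exists>r\<in>{s..t}. \<sigma> r \<in> K")
  case False
  then show ?thesis using \<open>s \<le> t\<close> by (intro off) auto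
next
  case True
  define Z where "Z = {s..t} \<inter> \<sigma> -` K"
  have "closed Z" unfolding Z_def
    using continuous_closed_preimage[OF cont _ \<open>closed K\<close>] by simp
  then have "compact Z" unfolding Z_def by (metis compact_Icc compact_Int_closed inf.right_idem inf_commute)
  moreover have "Z \<noteq> {}" using True by (auto simp: Z_def)
  ultimately obtain t1 t2 where t1: "t1 \<in> Z" "\<And>r. r \<in> Z \<Longrightarrow> t1 \<le> r"
    and t2: "t2 \<in> Z" "\<And>r. r \<in> Z \<Longrightarrow> r \<le> t2"
    using compact_attains_inf[of Z] compact_attains_sup[of Z] by metis
  have in12: "s \<le> t1" "t1 \<le> t2" "t2 \<le> t" "f t1 = 0" "f t2 = 0"
    using t1 t2 zero by (auto simp: Z_def)
  have "ennreal \<bar>f s - f t1\<bar> \<le> (\<integral>\<^sup>+r\<in>{s..t1}. H r \<partial>lborel)"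
  proof (rule off)
    fix r assume r: "r \<in> {s<..<t1}"
    show "\<sigma> r \<notin> K"
    proof
      assume "\<sigma> r \<in> K"
      then show False using t1(2)[of r] r in12 by (auto simp: Z_def)
    qed
  qed (use in12 in auto)
  moreover have "ennreal \<bar>f t2 - f t\<bar> \<le> (\<integral>\<^sup>+r\<in>{t2..t}. H r \<partial>lborel)"
  proof (rule off)
    fix r assume r: "r \<in> {t2<..<t}"
    show "\<sigma> r \<notin> K"
    proof
      assume "\<sigma> r \<in> K"
      then show False using t2(2)[of r] r in12 by (auto simp: Z_def)
    qed
  qed (use in12 in auto)
  ultimately have "ennreal \<bar>f s - f t\<bar> \<le> (\<integral>\<^sup>+r\<in>{s..t1}. H r \<partial>lborel) + (\<integral>\<^sup>+r\<in>{t2..t}. H r \<partial>lborel)"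
    by (intro ennreal_abs_diff_triangle[where y=0]) (use in12 in auto)
  also have "\<dots> \<le> (\<integral>\<^sup>+r\<in>{s..t1}. H r \<partial>lborel) + ((\<integral>\<^sup>+r\<in>{t1..t2}. H r \<partial>lborel) + (\<integral>\<^sup>+r\<in>{t2..t}. H r \<partial>lborel))"
    by (intro add_left_mono) (simp add: add_increasing)
  also have "\<dots> = (\<integral>\<^sup>+r\<in>{s..t1}. H r \<partial>lborel) + (\<integral>\<^sup>+r\<in>{t1..t}. H r \<partial>lborel)"
    using in12 by (subst nn_integral_interval_split[of H t1 t t2]) (auto intro!: measurable_subinterval[OF H])
  also have "\<dots> = (\<integral>\<^sup>+r\<in>{s..t}. H r \<partial>lborel)"
    using in12 by (subst nn_integral_interval_split[of H s t t1]) (auto intro!: H)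
  finally show ?thesis .
qed


section \<open>Line integrals and sub-arcs\<close>

lemma measurable_along_curve:
  fixes h :: "'a::metric_space \<Rightarrow> ennreal"
  assumes "rectifiable_curve S c" "h \<in> borel_on S"
    "0 \<le> s" "t \<le> total_length c"
  shows "(\<lambda>r. h (arc_param c r) * indicator {s..t} r) \<in> borel_measurable borel"
  using assms by (intro measurable_arc_param[OF assms(1,2)] arc_param_in[OF assms(1)]) auto

lemma arc_integral_cmult:
  assumes "rectifiable_curve S c" "h \<in> borel_on S"
    "0 \<le> s" "t \<le> total_length c"
  shows "arc_integral (\<lambda>x. k * h x) c s t = k * arc_integral h c s t"
proof -
  have [measurable]: "(\<lambda>r. h (arc_param c r) * indicator {s..t} r) \<in> borel_measurable borel"
    using assms by (rule measurable_along_curve)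
  show ?thesis unfolding arc_integral_def mult.assoc by (rule nn_integral_cmult) measurable
qed

lemma arc_integral_add:
  assumes "rectifiable_curve S c" "h \<in> borel_on S"
    "h' \<in> borel_on S" "0 \<le> s" "t \<le> total_length c"
  shows "arc_integral (\<lambda>x. h x + h' x) c s t = arc_integral h c s t + arc_integral h' c s t"
proof -
  have [measurable]: "(\<lambda>r. h (arc_param c r) * indicator {s..t} r) \<in> borel_measurable borel"
    "(\<lambda>r. h' (arc_param c r) * indicator {s..t} r) \<in> borel_measurable borel"
    using assms measurable_along_curve by blast+
  show ?thesis unfolding arc_integral_def distrib_right by (rule nn_integral_add) measurable
qed

lemma arc_integral_mono:
  assumes "\<And>r. r \<in> {s..t} \<Longrightarrow> h (arc_param c r) \<le> h' (arc_param c r)"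
  shows "arc_integral h c s t \<le> arc_integral h' c s t"
  unfolding arc_integral_def by (intro nn_integral_mono) (auto split: split_indicator intro: assms)

lemma arc_integral_subinterval:
  assumes "s \<le> s'" "t' \<le> t"
  shows "arc_integral h c s' t' \<le> arc_integral h c s t"
  unfolding arc_integral_def by (intro nn_integral_mono) (use assms in \<open>auto split: split_indicator\<close>)

lemma line_integral_mono:
  assumes "rectifiable_curve S c" "\<And>x. x \<in> S \<Longrightarrow> h x \<le> h' x"
  shows "line_integral h c \<le> line_integral h' c"
  unfolding line_integral_eq by (intro arc_integral_mono assms(2) arc_param_in[OF assms(1)])

lemma arc_param_endpoints:
  assumes "rectifiable_curve S (\<gamma>, a, b)"
  shows "arc_param (\<gamma>, a, b) 0 = \<gamma> a" "arc_param (\<gamma>, a, b) (total_length (\<gamma>, a, b)) = \<gamma> b"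
proof -
  have ab: "a \<le> b" using assms by (simp add: rectifiable_curve_def)
  have "arc_length (\<gamma>, a, b) a = 0" "arc_length (\<gamma>, a, b) b = total_length (\<gamma>, a, b)"
    by (auto simp: arc_length_def curve_length_refl)
  then show "arc_param (\<gamma>, a, b) 0 = \<gamma> a" "arc_param (\<gamma>, a, b) (total_length (\<gamma>, a, b)) = \<gamma> b"
    using arc_param_arc_length[OF assms, of a] arc_param_arc_length[OF assms, of b] ab by auto
qed

definition ug_on_arcs :: "'a::metric_space set \<Rightarrow> ('a \<Rightarrow> real) \<Rightarrow> ('a \<Rightarrow> ennreal) \<Rightarrow> 'a curve \<Rightarrow> bool" where
  "ug_on_arcs S u h c \<longleftrightarrow> (\<forall>s t. 0 \<le> s \<longrightarrow> s \<le> t \<longrightarrow> t \<le> total_length c \<longrightarrow> arc_param c ` {s..t} \<subseteq> S \<longrightarrow>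
     ennreal \<bar>u (arc_param c s) - u (arc_param c t)\<bar> \<le> arc_integral h c s t)"

lemma ug_on_arcsD:
  assumes "ug_on_arcs S u h c" "0 \<le> s" "s \<le> t" "t \<le> total_length c" "arc_param c ` {s..t} \<subseteq> S"
  shows "ennreal \<bar>u (arc_param c s) - u (arc_param c t)\<bar> \<le> arc_integral h c s t"
  using assms by (simp add: ug_on_arcs_def)

lemma ug_ineq_iff:
  assumes "rectifiable_curve S c"
  shows "ug_ineq u h c \<longleftrightarrow>
    ennreal \<bar>u (arc_param c 0) - u (arc_param c (total_length c))\<bar> \<le> arc_integral h c 0 (total_length c)"
proof -
  obtain \<gamma> a b where c: "c = (\<gamma>, a, b)" by (cases c)
  show ?thesis
    using arc_param_endpoints[OF assms[unfolded c]] unfolding c ug_ineq_def line_integral_eq by simp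
qed

lemma arc_integral_subcurve:
  assumes c: "rectifiable_curve T c" and st: "0 \<le> s" "s \<le> t" "t \<le> total_length c"
    and S: "arc_param c ` {s..t} \<subseteq> S" and ne: "arc_param c s \<noteq> arc_param c t"
  obtains c' where "rectifiable_curve S c'" "arc_param c' 0 = arc_param c s"
    "arc_param c' (total_length c') = arc_param c t"
    "\<And>h. h \<in> borel_on S \<Longrightarrow> line_integral h c' = arc_integral h c s t"
proof -
  obtain \<gamma> a b where *: "a \<le> b" "continuous_on {a..b} \<gamma>" "curve_length (\<gamma>, a, b) = ennreal (t - s)"
    "\<gamma> a = arc_param c s" "\<gamma> b = arc_param c t" "\<gamma> ` {a..b} = arc_param c ` {s..t}"
    "\<not> \<gamma> constant_on {a..b} \<longrightarrow> (\<forall>x\<in>{s..t}. arc_param (\<gamma>, a, b) (x - s) = arc_param c x)"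
    using sub_arc_is_curve[OF c st] by metis
  have nc: "\<not> \<gamma> constant_on {a..b}"
    using ne * unfolding constant_on_def by (metis atLeastAtMost_iff order_refl)
  have c': "rectifiable_curve S (\<gamma>, a, b)"
    using * nc S by (auto simp: rectifiable_curve_def)
  have L: "total_length (\<gamma>, a, b) = t - s" using *(3) st by simp
  show thesis
  proof (rule that[OF c'])
    show "arc_param (\<gamma>, a, b) 0 = arc_param c s"
      "arc_param (\<gamma>, a, b) (total_length (\<gamma>, a, b)) = arc_param c t"
      using arc_param_endpoints[OF c'] * by auto
    fix h :: "'a \<Rightarrow> ennreal" assume h: "h \<in> borel_on S"
    have "(\<lambda>r. h (arc_param (\<gamma>, a, b) r) * indicator {0..t - s} r) \<in> borel_measurable borel"
      using c' h L by (intro measurable_along_curve) auto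
    from nn_integral_real_affine[OF this, of 1 "-s"]
    have "line_integral h (\<gamma>, a, b)
        = (\<integral>\<^sup>+r. h (arc_param (\<gamma>, a, b) (r - s)) * indicator {0..t - s} (r - s) \<partial>lborel)"
      unfolding line_integral_eq arc_integral_def L by simp
    also have "\<dots> = arc_integral h c s t"
      unfolding arc_integral_def using *(7) nc by (intro nn_integral_cong) (auto simp: indicator_def)
    finally show "line_integral h (\<gamma>, a, b) = arc_integral h c s t" .
  qed
qed


section \<open>Families of curves of modulus zero\<close>

locale metric_measure =
  fixes M :: "'a::metric_space measure" and p :: real
  assumes regular: "borel_regular M" and p_gt_1: "1 < p"
begin

sublocale complete_measure M
  using regular by (simp add: borel_regular_def)

lemma sets_borel: "sets borel \<subseteq> sets M"
  using regular by (simp add: borel_regular_def)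

abbreviation energy :: "'a set \<Rightarrow> ('a \<Rightarrow> ennreal) \<Rightarrow> ennreal" where
  "energy S h \<equiv> (\<integral>\<^sup>+x\<in>S. epowr (h x) p \<partial>M)"

lemma space_M: "space M = UNIV"
proof -
  have "UNIV \<in> sets M" using sets_borel by (metis sets.top space_borel subsetD)
  then show ?thesis using sets.sets_into_space by blast
qed

lemma borel_imp_measurable:
  fixes f :: "'a \<Rightarrow> 'b::topological_space"
  assumes "f \<in> borel_measurable borel" shows "f \<in> borel_measurable M"
proof (rule measurableI)
  fix A :: "'b set" assume "A \<in> sets borel"
  then have "f -` A \<inter> space borel \<in> sets borel" using assms by (rule measurable_sets[rotated])
  then show "f -` A \<inter> space M \<in> sets M" using sets_borel by (auto simp: space_M)
qed simp

lemma zero_extension_borel: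
  fixes h :: "'a \<Rightarrow> ennreal"
  assumes "S \<in> sets borel" "h \<in> borel_on S"
  shows "(\<lambda>x. h x * indicator S x) \<in> borel_measurable borel"
  using assms by (subst (asm) borel_measurable_restrict_space_iff_ennreal) auto

lemma zero_extension_measurable:
  fixes h :: "'a \<Rightarrow> ennreal"
  assumes "S \<in> sets borel" "h \<in> borel_on S"
  shows "(\<lambda>x. h x * indicator S x) \<in> borel_measurable M"
  using zero_extension_borel[OF assms] by (rule borel_imp_measurable)

lemma energy_integrand_measurable:
  assumes "S \<in> sets borel" "h \<in> borel_on S"
  shows "(\<lambda>x. epowr (h x) p * indicator S x) \<in> borel_measurable M"
proof -
  have "(\<lambda>x. epowr (h x * indicator S x) p) \<in> borel_measurable M"
    using zero_extension_measurable[OF assms] by measurable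
  also have "(\<lambda>x. epowr (h x * indicator S x) p) = (\<lambda>x. epowr (h x) p * indicator S x)"
    by (auto simp: indicator_def)
  finally show ?thesis .
qed

lemma energy_cmult:
  assumes "S \<in> sets borel" "h \<in> borel_on S"
  shows "energy S (\<lambda>x. k * h x) = epowr k p * energy S h"
  using nn_integral_cmult[OF energy_integrand_measurable[OF assms], of "epowr k p"]
  by (simp add: epowr_mult mult.assoc)

lemma energy_add_finite:
  assumes "S \<in> sets borel" "h \<in> borel_on S"
    "h' \<in> borel_on S" "energy S h < \<infinity>" "energy S h' < \<infinity>"
  shows "energy S (\<lambda>x. h x + h' x) < \<infinity>"
proof -
  have "energy S (\<lambda>x. h x + h' x)
      \<le> (\<integral>\<^sup>+x. ennreal (2 powr p) * (epowr (h x) p * indicator S x + epowr (h' x) p * indicator S x) \<partial>M)"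
    using p_gt_1 epowr_add_le[of p] by (intro nn_integral_mono) (auto split: split_indicator)
  also have "\<dots> = ennreal (2 powr p) * (energy S h + energy S h')"
    using energy_integrand_measurable assms by (subst nn_integral_cmult, measurable) (subst nn_integral_add, auto)
  also have "\<dots> < \<infinity>" using assms by (auto simp: ennreal_mult_less_top)
  finally show ?thesis .
qed

lemma energy_SUP_le:
  fixes \<rho> :: "nat \<Rightarrow> 'a \<Rightarrow> ennreal"
  assumes "S \<in> sets borel" "\<And>i. \<rho> i \<in> borel_on S" and "0 \<le> e"
    and le: "\<And>i. energy S (\<rho> i) \<le> ennreal (e * (1 / 2) ^ Suc i)"
  shows "energy S (\<lambda>x. SUP i. \<rho> i x) \<le> ennreal e"
proof -
  have "energy S (\<lambda>x. SUP i. \<rho> i x) \<le> (\<integral>\<^sup>+x. (\<Sum>i. epowr (\<rho> i x) p * indicator S x) \<partial>M)"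
    using p_gt_1 by (intro nn_integral_mono) (auto split: split_indicator intro!: epowr_SUP_le)
  also have "\<dots> = (\<Sum>i. energy S (\<rho> i))"
    using energy_integrand_measurable[OF assms(1,2)] by (rule nn_integral_suminf)
  also have "\<dots> \<le> (\<Sum>i. ennreal (e * (1 / 2) ^ Suc i))" by (intro suminf_le le) auto
  also have "\<dots> = ennreal e"
    using sums_mult[OF power_half_series, of e] \<open>0 \<le> e\<close>
    by (subst suminf_ennreal2) (auto simp: sums_iff)
  finally show ?thesis .
qed

lemma modulus_zeroI:
  assumes "\<And>e::real. 0 < e \<Longrightarrow> \<exists>\<rho>. \<rho> \<in> borel_on S \<and>
    (\<forall>c\<in>\<Gamma>. 1 \<le> line_integral \<rho> c) \<and> energy S \<rho> \<le> ennreal e"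
  shows "modulus p M S \<Gamma> = 0"
proof -
  have "modulus p M S \<Gamma> \<le> 0 + ennreal e" if "0 < e" for e
  proof -
    obtain \<rho> where \<rho>: "\<rho> \<in> borel_on S"
      "\<forall>c\<in>\<Gamma>. 1 \<le> line_integral \<rho> c" "energy S \<rho> \<le> ennreal e" using assms \<open>0 < e\<close> by blast
    then have "modulus p M S \<Gamma> \<le> energy S \<rho>" unfolding modulus_def by (intro INF_lower) auto
    then show ?thesis using \<rho> by simp
  qed
  then have "modulus p M S \<Gamma> \<le> 0" by (rule ennreal_le_epsilon)
  then show ?thesis by simp
qed

lemma modulus_zeroE:
  assumes "modulus p M S \<Gamma> = 0" "0 < e"
  obtains \<rho> where "\<rho> \<in> borel_on S"
    "\<And>c. c \<in> \<Gamma> \<Longrightarrow> 1 \<le> line_integral \<rho> c" "energy S \<rho> \<le> ennreal e"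
proof -
  have "modulus p M S \<Gamma> < ennreal e" using assms by simp
  then show thesis unfolding modulus_def INF_less_iff using that by (auto intro: less_imp_le)
qed

lemma modulus_zero_subset:
  assumes "modulus p M S \<Gamma>' = 0" "\<Gamma> \<subseteq> \<Gamma>'"
  shows "modulus p M S \<Gamma> = 0"
proof (rule modulus_zeroI)
  fix e :: real assume "0 < e"
  show "\<exists>\<rho>. \<rho> \<in> borel_on S \<and>
    (\<forall>c\<in>\<Gamma>. 1 \<le> line_integral \<rho> c) \<and> energy S \<rho> \<le> ennreal e"
    using modulus_zeroE[OF assms(1) \<open>0 < e\<close>] assms(2) by (metis subsetD)
qed

lemma modulus_zero_UN:
  fixes \<Gamma> :: "nat \<Rightarrow> 'a curve set"
  assumes S: "S \<in> sets borel" and zero: "\<And>i. modulus p M S (\<Gamma> i) = 0"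
  shows "modulus p M S (\<Union>i. \<Gamma> i) = 0"
proof (rule modulus_zeroI)
  fix e :: real assume "0 < e"
  have "\<exists>\<rho>. \<rho> \<in> borel_on S \<and> (\<forall>c\<in>\<Gamma> i. 1 \<le> line_integral \<rho> c) \<and>
      energy S \<rho> \<le> ennreal (e * (1 / 2) ^ Suc i)" for i
    using modulus_zeroE[OF zero[of i], of "e * (1 / 2) ^ Suc i"] \<open>0 < e\<close> by (metis mult_pos_pos zero_less_power half_gt_zero zero_less_one)
  then obtain \<rho> where \<rho>: "\<And>i. \<rho> i \<in> borel_on S"
    "\<And>i c. c \<in> \<Gamma> i \<Longrightarrow> 1 \<le> line_integral (\<rho> i) c"
    "\<And>i. energy S (\<rho> i) \<le> ennreal (e * (1 / 2) ^ Suc i)" by metis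
  show "\<exists>\<rho>. \<rho> \<in> borel_on S \<and>
    (\<forall>c\<in>(\<Union>i. \<Gamma> i). 1 \<le> line_integral \<rho> c) \<and> energy S \<rho> \<le> ennreal e"
  proof (intro exI conjI ballI)
    show "(\<lambda>x. SUP i. \<rho> i x) \<in> borel_on S" using \<rho>(1) by measurable
    show "energy S (\<lambda>x. SUP i. \<rho> i x) \<le> ennreal e"
      using \<rho> S \<open>0 < e\<close> by (intro energy_SUP_le) auto
    fix c assume "c \<in> (\<Union>i. \<Gamma> i)"
    then obtain i where "c \<in> \<Gamma> i" by auto
    then have "1 \<le> line_integral (\<rho> i) c" by (rule \<rho>)
    also have "\<dots> \<le> line_integral (\<lambda>x. SUP i. \<rho> i x) c"
      unfolding line_integral_eq by (intro arc_integral_mono SUP_upper) auto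
    finally show "1 \<le> line_integral (\<lambda>x. SUP i. \<rho> i x) c" .
  qed
qed

lemma modulus_zero_Un:
  assumes "S \<in> sets borel" "modulus p M S \<Gamma> = 0" "modulus p M S \<Gamma>' = 0"
  shows "modulus p M S (\<Gamma> \<union> \<Gamma>') = 0"
proof -
  have "modulus p M S (\<Union>i::nat. if i = 0 then \<Gamma> else \<Gamma>') = 0"
    using assms by (intro modulus_zero_UN) auto
  then show ?thesis by (rule modulus_zero_subset) (auto split: if_splits intro: exI[of _ 0] exI[of _ 1])
qed

text \<open>A function of finite energy has infinite integral only along negligibly many curves, because any small
  multiple of it is admissible for them. Conversely, a negligible family is contained in such a set
  of curves, even for a function of arbitrarily small energy: take the supremum of the \<open>(i + 1)\<close>-fold
  of admissible functions \<open>\<rho>\<^sub>i\<close> whose energies decrease fast enough to compensate for the factors.\<close>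

lemma modulus_zero_infinite_line_integral:
  assumes S: "S \<in> sets borel" and h: "h \<in> borel_on S"
    and fin: "energy S h < \<infinity>"
  shows "modulus p M S {c. rectifiable_curve S c \<and> line_integral h c = \<infinity>} = 0"
proof (rule modulus_zeroI)
  fix e :: real assume "0 < e"
  obtain E where E: "energy S h = ennreal E" "0 \<le> E" using fin by (cases "energy S h") auto
  define k where "k = (e / (E + 1)) powr (1 / p)"
  have k: "0 < k" "k powr p = e / (E + 1)"
    using \<open>0 < e\<close> E p_gt_1 by (auto simp: k_def powr_powr)
  show "\<exists>\<rho>. \<rho> \<in> borel_on S \<and>
    (\<forall>c\<in>{c. rectifiable_curve S c \<and> line_integral h c = \<infinity>}. 1 \<le> line_integral \<rho> c) \<and>
    energy S \<rho> \<le> ennreal e"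
  proof (intro exI conjI ballI)
    show "(\<lambda>x. ennreal k * h x) \<in> borel_on S" using h by measurable
    have "energy S (\<lambda>x. ennreal k * h x) = ennreal (k powr p * E)"
      using k(1) E by (simp only: energy_cmult[OF S h] epowr_ennreal less_imp_le ennreal_mult powr_ge_zero)
    also have "\<dots> \<le> ennreal e"
      using k E \<open>0 < e\<close> by (intro ennreal_leI) (auto simp: field_simps)
    finally show "energy S (\<lambda>x. ennreal k * h x) \<le> ennreal e" .
    fix c assume "c \<in> {c. rectifiable_curve S c \<and> line_integral h c = \<infinity>}"
    then have c: "rectifiable_curve S c" "line_integral h c = \<infinity>" by auto
    then have "line_integral (\<lambda>x. ennreal k * h x) c = \<infinity>"
      using k arc_integral_cmult[OF c(1) h, of 0 "total_length c" "ennreal k"]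
      by (simp add: line_integral_eq ennreal_mult_top)
    then show "1 \<le> line_integral (\<lambda>x. ennreal k * h x) c" by simp
  qed
qed

lemma modulus_zero_infinite_witness:
  assumes S: "S \<in> sets borel" and zero: "modulus p M S \<Gamma> = 0"
    and rect: "\<And>c. c \<in> \<Gamma> \<Longrightarrow> rectifiable_curve S c" and "0 < e"
  obtains \<rho> where "\<rho> \<in> borel_on S"
    "\<And>c. c \<in> \<Gamma> \<Longrightarrow> line_integral \<rho> c = \<infinity>" "energy S \<rho> \<le> ennreal e"
proof -
  define k where "k i = e * (1 / 2) ^ Suc i / (real (Suc i) powr p)" for i
  have kpos: "0 < k i" for i using \<open>0 < e\<close> by (simp add: k_def)
  have "\<exists>\<rho>. \<rho> \<in> borel_on S \<and> (\<forall>c\<in>\<Gamma>. 1 \<le> line_integral \<rho> c) \<and>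
      energy S \<rho> \<le> ennreal (k i)" for i
    using modulus_zeroE[OF zero kpos[of i]] by metis
  then obtain \<rho> where \<rho>: "\<And>i. \<rho> i \<in> borel_on S"
    "\<And>i c. c \<in> \<Gamma> \<Longrightarrow> 1 \<le> line_integral (\<rho> i) c"
    "\<And>i. energy S (\<rho> i) \<le> ennreal (k i)" by metis
  define \<tau> where "\<tau> i x = ennreal (real (Suc i)) * \<rho> i x" for i x
  have \<tau>: "\<tau> i \<in> borel_on S" for i
    unfolding \<tau>_def using \<rho>(1)[of i] by measurable
  show thesis
  proof (rule that)
    show "(\<lambda>x. SUP i. \<tau> i x) \<in> borel_on S" using \<tau> by measurable
    have "energy S (\<tau> i) \<le> ennreal (e * (1 / 2) ^ Suc i)" for i
    proof -
      have "energy S (\<tau> i) = ennreal (real (Suc i) powr p) * energy S (\<rho> i)"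
        unfolding \<tau>_def using energy_cmult[OF S \<rho>(1), of "ennreal (real (Suc i))" i]
          epowr_ennreal[of "real (Suc i)" p] by simp
      also have "\<dots> \<le> ennreal (real (Suc i) powr p) * ennreal (k i)" by (intro mult_left_mono \<rho>) auto
      also have "\<dots> = ennreal (e * (1 / 2) ^ Suc i)"
        using kpos[of i] by (subst ennreal_mult[symmetric]) (auto simp: k_def)
      finally show ?thesis .
    qed
    then show "energy S (\<lambda>x. SUP i. \<tau> i x) \<le> ennreal e"
      using \<tau> S \<open>0 < e\<close> by (intro energy_SUP_le) auto
    fix c assume c: "c \<in> \<Gamma>"
    have "of_nat n \<le> line_integral (\<lambda>x. SUP i. \<tau> i x) c" for n
    proof -
      have "(of_nat n :: ennreal) \<le> ennreal (real (Suc n)) * 1" by (simp add: ennreal_of_nat_eq_real_of_nat)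
      also have "\<dots> \<le> ennreal (real (Suc n)) * line_integral (\<rho> n) c" by (intro mult_left_mono \<rho> c) auto
      also have "\<dots> = line_integral (\<tau> n) c"
        unfolding \<tau>_def line_integral_eq
        using arc_integral_cmult[OF rect[OF c] \<rho>(1), of 0 "total_length c" "ennreal (real (Suc n))" n] by simp
      also have "\<dots> \<le> line_integral (\<lambda>x. SUP i. \<tau> i x) c"
        unfolding line_integral_eq by (intro arc_integral_mono SUP_upper) auto
      finally show ?thesis .
    qed
    then have "(SUP n. of_nat n :: ennreal) \<le> line_integral (\<lambda>x. SUP i. \<tau> i x) c" by (intro SUP_least)
    then show "line_integral (\<lambda>x. SUP i. \<tau> i x) c = \<infinity>" by (simp add: ennreal_SUP_of_nat_eq_top top_unique)
  qed
qed


section \<open>Weak upper gradients\<close>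

lemma weak_upper_gradientI:
  assumes "h \<in> borel_on S" "modulus p M S \<Gamma> = 0"
    and "\<And>c. rectifiable_curve S c \<Longrightarrow> c \<notin> \<Gamma> \<Longrightarrow>
      ennreal \<bar>u (arc_param c 0) - u (arc_param c (total_length c))\<bar> \<le> arc_integral h c 0 (total_length c)"
  shows "weak_upper_gradient p M S u h"
proof -
  have "modulus p M S {c. rectifiable_curve S c \<and> \<not> ug_ineq u h c} = 0"
    using assms(3) ug_ineq_iff[of S] by (intro modulus_zero_subset[OF assms(2)]) blast
  then show ?thesis using assms(1) by (simp add: weak_upper_gradient_def)
qed

lemma weak_upper_gradient_measurable:
  "weak_upper_gradient p M S u h \<Longrightarrow> h \<in> borel_on S"
  by (simp add: weak_upper_gradient_def)

text \<open>If a curve contains a sub-arc in \<open>S\<close> from an exceptional family, then any function that is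
  admissible for that family is admissible for the larger curve as well. Hence almost every
  curve satisfies the upper gradient inequality on all its sub-arcs in \<open>S\<close> simultaneously.\<close>

lemma weak_upper_gradient_arcs:
  assumes wug: "weak_upper_gradient p M S u h" and S: "S \<in> sets borel"
  obtains \<Gamma> where "modulus p M T \<Gamma> = 0"
    "\<And>c. rectifiable_curve T c \<Longrightarrow> c \<notin> \<Gamma> \<Longrightarrow> ug_on_arcs S u h c"
proof -
  let ?\<Gamma> = "{c. rectifiable_curve T c \<and> \<not> ug_on_arcs S u h c}"
  have h: "h \<in> borel_on S"
    and zero: "modulus p M S {c. rectifiable_curve S c \<and> \<not> ug_ineq u h c} = 0"
    using wug by (auto simp: weak_upper_gradient_def)
  have "modulus p M T ?\<Gamma> = 0"
  proof (rule modulus_zeroI)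
    fix e :: real assume "0 < e"
    then obtain \<rho> where \<rho>: "\<rho> \<in> borel_on S"
      "\<And>c. c \<in> {c. rectifiable_curve S c \<and> \<not> ug_ineq u h c} \<Longrightarrow> 1 \<le> line_integral \<rho> c"
      "energy S \<rho> \<le> ennreal e" using modulus_zeroE[OF zero] by blast
    show "\<exists>\<rho>. \<rho> \<in> borel_on T \<and>
      (\<forall>c\<in>?\<Gamma>. 1 \<le> line_integral \<rho> c) \<and> energy T \<rho> \<le> ennreal e"
    proof (intro exI conjI ballI)
      show "(\<lambda>x. \<rho> x * indicator S x) \<in> borel_on T"
        using zero_extension_borel[OF S \<rho>(1)] by (rule measurable_restrict_space1)
      have "energy T (\<lambda>x. \<rho> x * indicator S x) \<le> energy S \<rho>"
        by (intro nn_integral_mono) (auto simp: indicator_def)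
      then show "energy T (\<lambda>x. \<rho> x * indicator S x) \<le> ennreal e" using \<rho>(3) by simp
      fix c assume "c \<in> ?\<Gamma>"
      then have c: "rectifiable_curve T c" by simp
      obtain s t where st: "0 \<le> s" "s \<le> t" "t \<le> total_length c" "arc_param c ` {s..t} \<subseteq> S"
        and fail: "\<not> ennreal \<bar>u (arc_param c s) - u (arc_param c t)\<bar> \<le> arc_integral h c s t"
        using \<open>c \<in> ?\<Gamma>\<close> unfolding ug_on_arcs_def by blast
      have "arc_param c s \<noteq> arc_param c t" using fail by auto
      then obtain c' where c': "rectifiable_curve S c'" "arc_param c' 0 = arc_param c s"
        "arc_param c' (total_length c') = arc_param c t"
        "\<And>h. h \<in> borel_on S \<Longrightarrow> line_integral h c' = arc_integral h c s t"
        using arc_integral_subcurve[OF c st] by metis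
      have "\<not> ug_ineq u h c'"
        using fail c' h unfolding ug_ineq_iff[OF c'(1)] by (simp flip: line_integral_eq)
      then have "1 \<le> line_integral \<rho> c'" using c' by (intro \<rho>) auto
      also have "\<dots> = arc_integral \<rho> c s t" by (rule c'(4)[OF \<rho>(1)])
      also have "\<dots> \<le> arc_integral (\<lambda>x. \<rho> x * indicator S x) c s t"
        using st by (intro arc_integral_mono) (auto simp: indicator_def image_subset_iff)
      also have "\<dots> \<le> line_integral (\<lambda>x. \<rho> x * indicator S x) c"
        unfolding line_integral_eq using st by (intro arc_integral_subinterval)
      finally show "1 \<le> line_integral (\<lambda>x. \<rho> x * indicator S x) c" .
    qed
  qed
  then show thesis using that[of ?\<Gamma>] by blast
qed

lemma weak_upper_gradient_restrict:
  assumes "weak_upper_gradient p M T u h" "S \<subseteq> T" "S \<in> sets borel" "T \<in> sets borel"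
    "\<And>x. x \<in> S \<Longrightarrow> u x = w x"
  shows "weak_upper_gradient p M S w h"
proof -
  have h: "h \<in> borel_on T"
    by (rule weak_upper_gradient_measurable[OF assms(1)])
  have hS: "h' \<in> borel_on S"
    if "h' \<in> borel_on T" for h' :: "'a \<Rightarrow> ennreal"
    using measurable_restrict_space1[OF that, of S] assms(2-4) by (simp add: restrict_restrict_space Int_absorb1 Int_absorb2)
  obtain \<Gamma> where \<Gamma>: "modulus p M S \<Gamma> = 0"
    "\<And>c. rectifiable_curve S c \<Longrightarrow> c \<notin> \<Gamma> \<Longrightarrow> ug_on_arcs T u h c"
    using weak_upper_gradient_arcs[OF assms(1,4), of S] by blast
  show ?thesis
  proof (rule weak_upper_gradientI[OF hS[OF h] \<Gamma>(1)])
    fix c assume c: "rectifiable_curve S c" "c \<notin> \<Gamma>"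
    have in_S: "arc_param c r \<in> S" if "0 \<le> r" "r \<le> total_length c" for r
      using arc_param_in[OF c(1)] that by auto
    have "ennreal \<bar>u (arc_param c 0) - u (arc_param c (total_length c))\<bar> \<le> arc_integral h c 0 (total_length c)"
      by (rule ug_on_arcsD[OF \<Gamma>(2)[OF c]]) (use in_S assms(2) in auto)
    then show "ennreal \<bar>w (arc_param c 0) - w (arc_param c (total_length c))\<bar> \<le> arc_integral h c 0 (total_length c)"
      using in_S assms(5) by simp
  qed
qed

lemma weak_upper_gradient_lincomb:
  assumes "weak_upper_gradient p M S u h" "weak_upper_gradient p M S v k" "S \<in> sets borel"
  shows "weak_upper_gradient p M S (\<lambda>x. a * u x + b * v x) (\<lambda>x. ennreal \<bar>a\<bar> * h x + ennreal \<bar>b\<bar> * k x)"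
proof -
  have h [measurable]: "h \<in> borel_on S" "k \<in> borel_on S"
    using assms by (auto dest: weak_upper_gradient_measurable)
  let ?bad = "\<lambda>u h. {c. rectifiable_curve S c \<and> \<not> ug_ineq u h c}"
  have "modulus p M S (?bad u h \<union> ?bad v k) = 0"
    using assms by (intro modulus_zero_Un) (auto simp: weak_upper_gradient_def)
  then show ?thesis
  proof (rule weak_upper_gradientI[rotated])
    fix c assume c: "rectifiable_curve S c" "c \<notin> ?bad u h \<union> ?bad v k"
    define L where "L = total_length c"
    have *: "ennreal \<bar>u (arc_param c 0) - u (arc_param c L)\<bar> \<le> arc_integral h c 0 L"
      "ennreal \<bar>v (arc_param c 0) - v (arc_param c L)\<bar> \<le> arc_integral k c 0 L"
      using c ug_ineq_iff[OF c(1)] by (auto simp: L_def)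
    have "\<bar>a * u (arc_param c 0) + b * v (arc_param c 0) - (a * u (arc_param c L) + b * v (arc_param c L))\<bar>
      \<le> \<bar>a\<bar> * \<bar>u (arc_param c 0) - u (arc_param c L)\<bar> + \<bar>b\<bar> * \<bar>v (arc_param c 0) - v (arc_param c L)\<bar>"
      unfolding abs_mult[symmetric] by (rule order_trans[OF _ abs_triangle_ineq]) (simp add: algebra_simps)
    then have "ennreal \<bar>a * u (arc_param c 0) + b * v (arc_param c 0) - (a * u (arc_param c L) + b * v (arc_param c L))\<bar>
      \<le> ennreal \<bar>a\<bar> * ennreal \<bar>u (arc_param c 0) - u (arc_param c L)\<bar> + ennreal \<bar>b\<bar> * ennreal \<bar>v (arc_param c 0) - v (arc_param c L)\<bar>"
      by (simp flip: ennreal_mult ennreal_plus add: ennreal_leI)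
    also have "\<dots> \<le> ennreal \<bar>a\<bar> * arc_integral h c 0 L + ennreal \<bar>b\<bar> * arc_integral k c 0 L"
      using * by (intro add_mono mult_left_mono) auto
    also have "\<dots> = arc_integral (\<lambda>x. ennreal \<bar>a\<bar> * h x + ennreal \<bar>b\<bar> * k x) c 0 L"
      using c(1) by (subst arc_integral_add[of S]) (auto simp: L_def arc_integral_cmult[of S])
    finally show "ennreal \<bar>a * u (arc_param c 0) + b * v (arc_param c 0)
        - (a * u (arc_param c (total_length c)) + b * v (arc_param c (total_length c)))\<bar>
      \<le> arc_integral (\<lambda>x. ennreal \<bar>a\<bar> * h x + ennreal \<bar>b\<bar> * k x) c 0 (total_length c)"
      by (simp add: L_def)
  qed measurable
qed

end


section \<open>Existence of minimal weak upper gradients\<close>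

lemma powr_strict_midpoint:
  fixes p t :: real
  assumes "1 < p" "0 \<le> t" "t < 1"
  shows "((1 + t) / 2) powr p < (1 + t powr p) / 2"
proof -
  define x where "x = (1 + t) / 2"
  have x: "t < x" "x < 1" "0 < x" using assms by (auto simp: x_def)
  have cont: "continuous_on A (\<lambda>z. z powr p)" if "A \<subseteq> {0..}" for A
    using assms that by (intro continuous_on_powr' continuous_intros) auto
  have diff: "((\<lambda>z. z powr p) has_real_derivative p * z powr (p - 1)) (at z)" if "0 < z" for z
    using that by (rule has_real_derivative_powr)
  have mvt: "\<exists>z. a < z \<and> z < b \<and> b powr p - a powr p = (b - a) * (p * z powr (p - 1))"
    if ab: "0 \<le> a" "a < b" for a b
  proof -
    have "\<exists>l z. a < z \<and> z < b \<and> DERIV (\<lambda>z. z powr p) z :> l \<and> b powr p - a powr p = (b - a) * l"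
    proof (rule MVT)
      show "(\<lambda>z. z powr p) differentiable (at z)" if "a < z" for z
        using diff[of z] that ab real_differentiable_def by fastforce
    qed (use ab in \<open>auto intro!: cont\<close>)
    then obtain l z where "a < z" "z < b" "DERIV (\<lambda>z. z powr p) z :> l" "b powr p - a powr p = (b - a) * l"
      by blast
    then show ?thesis using DERIV_unique[OF _ diff[of z]] ab by (intro exI[of _ z]) auto
  qed
  obtain z1 where z1: "t < z1" "z1 < x" "x powr p - t powr p = (x - t) * (p * z1 powr (p - 1))"
    using mvt[of t x] assms x by auto
  obtain z2 where z2: "x < z2" "z2 < 1" "1 powr p - x powr p = (1 - x) * (p * z2 powr (p - 1))"
    using mvt[of x 1] x by auto
  have "z1 powr (p - 1) < z2 powr (p - 1)"
    using z1 z2 assms by (intro powr_less_mono2) auto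
  then have "(x - t) * (p * z1 powr (p - 1)) < (1 - x) * (p * z2 powr (p - 1))"
  proof -
    assume *: "z1 powr (p - 1) < z2 powr (p - 1)"
    have eq: "1 - x = x - t" by (simp add: x_def field_simps)
    show ?thesis unfolding eq using * x assms by (intro mult_strict_left_mono) auto
  qed
  then show ?thesis using z1(3) z2(3) by (simp add: x_def)
qed

text \<open>The uniform convexity of \<open>L\<^sup>p\<close> in pointwise form: if the mean of the \<open>p\<close>-th powers of
  two numbers exceeds the power of their midpoint by little, then the two numbers are close. By
  homogeneity the larger one may be taken to be \<open>1\<close>, and then the gap has a positive minimum over
  the compact set where the other one stays away from \<open>1\<close>.\<close>

lemma powr_midpoint_gap:
  fixes p \<epsilon> :: real
  assumes p: "1 < p" and "0 < \<epsilon>"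
  obtains C where "0 < C" "\<And>a b. 0 \<le> a \<Longrightarrow> 0 \<le> b \<Longrightarrow>
    \<bar>a - b\<bar> powr p + C * ((a + b) / 2) powr p \<le> (\<epsilon> + C / 2) * (a powr p + b powr p)"
proof -
  define \<eta> where "\<eta> = min (\<epsilon> powr (1 / p)) (1 / 2)"
  have \<eta>: "0 < \<eta>" "\<eta> < 1" using \<open>0 < \<epsilon>\<close> by (auto simp: \<eta>_def)
  have "\<eta> powr p \<le> (\<epsilon> powr (1 / p)) powr p" using \<eta> p by (intro powr_mono2) (auto simp: \<eta>_def)
  also have "\<dots> = \<epsilon>" using \<open>0 < \<epsilon>\<close> p by (simp add: powr_powr)
  finally have \<eta>_le: "\<eta> powr p \<le> \<epsilon>" .
  define f where "f t = (1 + t powr p) / 2 - ((1 + t) / 2) powr p" for t :: real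
  have "continuous_on {0..1 - \<eta>} f"
    unfolding f_def using p by (intro continuous_intros continuous_on_powr') auto
  then obtain t0 where t0: "t0 \<in> {0..1 - \<eta>}" "\<And>t. t \<in> {0..1 - \<eta>} \<Longrightarrow> f t0 \<le> f t"
    using continuous_attains_inf[of "{0..1 - \<eta>}" f] \<eta> by auto
  define m where "m = f t0"
  have m: "0 < m" using powr_strict_midpoint[of p t0] t0(1) \<eta> p by (simp add: m_def f_def)
  have f_nonneg: "0 \<le> f t" if "0 \<le> t" "t \<le> 1" for t
  proof (cases "t = 1")
    case False
    then show ?thesis using powr_strict_midpoint[of p t] that p by (simp add: f_def)
  qed (simp add: f_def)
  have ordered: "\<bar>a - b\<bar> powr p + (1 / m) * ((a + b) / 2) powr p \<le> (\<epsilon> + (1 / m) / 2) * (a powr p + b powr p)"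
    if "0 \<le> b" "b \<le> a" for a b
  proof (cases "a = 0")
    case True
    then show ?thesis using that by simp
  next
    case False
    define t where "t = b / a"
    have a: "0 < a" and t: "0 \<le> t" "t \<le> 1" and b: "b = t * a" using that False by (auto simp: t_def)
    have mid: "((a + b) / 2) powr p = a powr p * ((1 + t) / 2) powr p"
      using a t by (simp add: b powr_mult[symmetric] algebra_simps)
    have diff: "\<bar>a - b\<bar> powr p = a powr p * (1 - t) powr p"
    proof -
      have "\<bar>a - b\<bar> = a * (1 - t)" using a t by (simp add: b algebra_simps mult_left_le)
      then show ?thesis using a t by (simp add: powr_mult)
    qed
    have bp: "b powr p = a powr p * t powr p" using a t by (simp add: b powr_mult)
    have key: "(1 - t) powr p \<le> \<epsilon> * (1 + t powr p) + (1 / m) * f t"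
    proof (cases "t \<le> 1 - \<eta>")
      case True
      then have "m \<le> f t" using t0(2)[of t] t by (simp add: m_def)
      then have "1 \<le> (1 / m) * f t" using m by simp
      moreover have "(1 - t) powr p \<le> 1" using t p by (intro powr_le1) auto
      moreover have "0 \<le> \<epsilon> * (1 + t powr p)" using \<open>0 < \<epsilon>\<close> by simp
      ultimately show ?thesis by linarith
    next
      case False
      then have "(1 - t) powr p \<le> \<eta> powr p" using t p by (intro powr_mono2) auto
      also have "\<dots> \<le> \<epsilon> * 1" using \<eta>_le by simp
      also have "\<dots> \<le> \<epsilon> * (1 + t powr p)" using \<open>0 < \<epsilon>\<close> by (intro mult_left_mono) auto
      finally show ?thesis using f_nonneg[of t] t m by (simp add: add_increasing2)
    qed
    have "a powr p * ((1 - t) powr p + (1 / m) * ((1 + t) / 2) powr p)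
        \<le> a powr p * ((\<epsilon> + (1 / m) / 2) * (1 + t powr p))"
      using key by (intro mult_left_mono) (auto simp: f_def algebra_simps add_divide_distrib)
    then show ?thesis unfolding mid diff bp by (simp add: algebra_simps add_divide_distrib)
  qed
  show thesis
  proof (rule that[of "1 / m"])
    fix a b :: real assume "0 \<le> a" "0 \<le> b"
    then show "\<bar>a - b\<bar> powr p + (1 / m) * ((a + b) / 2) powr p \<le> (\<epsilon> + (1 / m) / 2) * (a powr p + b powr p)"
      using ordered[of b a] ordered[of a b] by (cases "b \<le> a") (auto simp: abs_minus_commute add.commute)
  qed (use m in auto)
qed

context metric_measure
begin

text \<open>The mean of two weak upper gradients is again one, so its energy is at least the infimum \<open>i\<close>. Two
  weak upper gradients of energy near \<open>i\<close> thus have a small convexity gap, and are close in \<open>L\<^sup>p\<close>.\<close>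

lemma near_minimal_weak_ugs_close:
  assumes S: "S \<in> sets borel" and "0 \<le> i"
    and i: "\<And>h. weak_upper_gradient p M S u h \<Longrightarrow> ennreal i \<le> energy S h" and "0 < \<tau>"
  obtains \<delta> where "0 < \<delta>" "\<And>g h. weak_upper_gradient p M S u g \<Longrightarrow> weak_upper_gradient p M S u h \<Longrightarrow>
    energy S g \<le> ennreal (i + \<delta>) \<Longrightarrow> energy S h \<le> ennreal (i + \<delta>) \<Longrightarrow>
    (\<integral>\<^sup>+x\<in>S. ennreal (\<bar>enn2real (g x) - enn2real (h x)\<bar> powr p) \<partial>M) \<le> ennreal \<tau>"
proof -
  (* chosen such that 2 * \<epsilon> * (i + \<delta>) and C * \<delta> are both at most \<tau> / 2 *)
  define \<epsilon> where "\<epsilon> = \<tau> / (4 * (i + 1))"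
  have \<epsilon>: "0 < \<epsilon>" using \<open>0 < \<tau>\<close> \<open>0 \<le> i\<close> by (simp add: \<epsilon>_def)
  obtain C where C: "0 < C" "\<And>a b. 0 \<le> a \<Longrightarrow> 0 \<le> b \<Longrightarrow>
    \<bar>a - b\<bar> powr p + C * ((a + b) / 2) powr p \<le> (\<epsilon> + C / 2) * (a powr p + b powr p)"
    using powr_midpoint_gap[OF p_gt_1 \<epsilon>] by metis
  define \<delta> where "\<delta> = min 1 (\<tau> / (2 * C))"
  have \<delta>: "0 < \<delta>" "\<delta> \<le> 1" "C * \<delta> \<le> \<tau> / 2"
    using C \<open>0 < \<tau>\<close> by (auto simp: \<delta>_def min_def field_simps)
  show thesis
  proof (rule that[OF \<delta>(1)])
    fix g h assume g: "weak_upper_gradient p M S u g" "energy S g \<le> ennreal (i + \<delta>)"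
      and h: "weak_upper_gradient p M S u h" "energy S h \<le> ennreal (i + \<delta>)"
    define D where "D = (\<integral>\<^sup>+x\<in>S. ennreal (\<bar>enn2real (g x) - enn2real (h x)\<bar> powr p) \<partial>M)"
    define k where "k = (\<lambda>x. ennreal (1 / 2) * g x + ennreal (1 / 2) * h x)"
    have k: "weak_upper_gradient p M S u k"
      using weak_upper_gradient_lincomb[OF g(1) h(1) S, of "1 / 2" "1 / 2"] unfolding k_def by simp
    note gm = weak_upper_gradient_measurable[OF g(1)] and hm = weak_upper_gradient_measurable[OF h(1)]
      and km = weak_upper_gradient_measurable[OF k]
    have pointwise: "ennreal (\<bar>enn2real (g x) - enn2real (h x)\<bar> powr p) + ennreal C * epowr (k x) p
        \<le> ennreal (\<epsilon> + C / 2) * (epowr (g x) p + epowr (h x) p)" for x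
    proof (cases "g x = top \<or> h x = top")
      case True
      have "0 < \<epsilon> + C / 2" using \<epsilon> C by simp
      then show ?thesis using True by (auto simp: ennreal_mult_top)
    next
      case False
      then obtain a b where ab: "g x = ennreal a" "0 \<le> a" "h x = ennreal b" "0 \<le> b"
        by (cases "g x"; cases "h x") auto
      have "k x = ennreal ((a + b) / 2)"
      proof -
        have "ennreal ((a + b) / 2) = ennreal (1 / 2 * a) + ennreal (1 / 2 * b)"
          using ab by (subst ennreal_plus[symmetric]) (auto simp: add_divide_distrib)
        also have "\<dots> = k x"
          unfolding k_def ab by (simp only: ennreal_mult' zero_le_divide_1_iff zero_le_numeral)
        finally show ?thesis by simp
      qed
      then have "epowr (k x) p = ennreal (((a + b) / 2) powr p)" using ab by (simp add: epowr_ennreal)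
      then show ?thesis
        using C(2)[of a b] ab C(1) \<epsilon> by (simp add: epowr_ennreal ennreal_leI flip: ennreal_mult ennreal_plus)
    qed
    have Dm: "(\<lambda>x. ennreal (\<bar>enn2real (g x) - enn2real (h x)\<bar> powr p) * indicator S x) \<in> borel_measurable M"
    proof -
      have "(\<lambda>x. ennreal (\<bar>enn2real (g x) - enn2real (h x)\<bar> powr p)) \<in> borel_on S"
        using gm hm by measurable
      then show ?thesis by (rule zero_extension_measurable[OF S])
    qed
    have "D + ennreal C * ennreal i \<le> D + ennreal C * energy S k"
      using i[OF k] by (intro add_left_mono mult_left_mono) auto
    also have "\<dots> = (\<integral>\<^sup>+x. ennreal (\<bar>enn2real (g x) - enn2real (h x)\<bar> powr p) * indicator S x
        + ennreal C * (epowr (k x) p * indicator S x) \<partial>M)"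
      unfolding D_def using energy_integrand_measurable[OF S km] Dm
      by (subst nn_integral_cmult[symmetric], simp) (rule nn_integral_add[symmetric], auto)
    also have "\<dots> \<le> (\<integral>\<^sup>+x. ennreal (\<epsilon> + C / 2) * (epowr (g x) p * indicator S x + epowr (h x) p * indicator S x) \<partial>M)"
      using pointwise by (intro nn_integral_mono) (auto simp: indicator_def)
    also have "\<dots> = ennreal (\<epsilon> + C / 2) * (energy S g + energy S h)"
      using energy_integrand_measurable[OF S gm] energy_integrand_measurable[OF S hm]
      by (subst nn_integral_cmult, measurable) (subst nn_integral_add, auto)
    also have "\<dots> \<le> ennreal (\<epsilon> + C / 2) * (ennreal (i + \<delta>) + ennreal (i + \<delta>))"
      using g h by (intro mult_left_mono add_mono) auto
    also have "\<dots> = ennreal ((2 * \<epsilon> * (i + \<delta>) + C * \<delta>) + C * i)"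
      using \<epsilon> C \<delta> \<open>0 \<le> i\<close> by (simp add: algebra_simps flip: ennreal_mult ennreal_plus)
    also have "\<dots> = ennreal (2 * \<epsilon> * (i + \<delta>) + C * \<delta>) + ennreal C * ennreal i"
      using \<epsilon> C \<delta> \<open>0 \<le> i\<close> by (simp flip: ennreal_mult ennreal_plus)
    finally have "D \<le> ennreal (2 * \<epsilon> * (i + \<delta>) + C * \<delta>)"
      using C \<open>0 \<le> i\<close> by (simp add: ennreal_mult_less_top add.commute flip: ennreal_mult)
    also have "\<dots> \<le> ennreal \<tau>"
    proof (rule ennreal_leI)
      have "2 * \<epsilon> * (i + \<delta>) \<le> 2 * \<epsilon> * (i + 1)" using \<epsilon> \<delta> by (intro mult_left_mono) auto
      also have "\<dots> = \<tau> / 2" using \<open>0 \<le> i\<close> by (simp add: \<epsilon>_def field_simps)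
      finally show "2 * \<epsilon> * (i + \<delta>) + C * \<delta> \<le> \<tau>" using \<delta> by simp
    qed
    finally show "(\<integral>\<^sup>+x\<in>S. ennreal (\<bar>enn2real (g x) - enn2real (h x)\<bar> powr p) \<partial>M) \<le> ennreal \<tau>"
      by (simp add: D_def)
  qed
qed

text \<open>A supremum of finite energy has finite integral along almost every curve, and there it dominates the
  sequence, so that the reverse Fatou lemma applies along the curve.\<close>

lemma weak_upper_gradient_limsup:
  fixes g :: "nat \<Rightarrow> 'a \<Rightarrow> ennreal"
  assumes S: "S \<in> sets borel" and g: "\<And>k. weak_upper_gradient p M S u (g k)"
    and fin: "energy S (\<lambda>x. SUP k. g k x) < \<infinity>"
  shows "weak_upper_gradient p M S u (\<lambda>x. limsup (\<lambda>k. g k x))"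
proof -
  have [measurable]: "g k \<in> borel_on S" for k
    using g by (rule weak_upper_gradient_measurable)
  define w where "w x = (SUP k. g k x)" for x
  have wm: "w \<in> borel_on S" unfolding w_def by measurable
  let ?bad = "\<lambda>k. {c. rectifiable_curve S c \<and> \<not> ug_ineq u (g k) c}"
  let ?inf = "{c. rectifiable_curve S c \<and> line_integral w c = \<infinity>}"
  have "modulus p M S (\<Union>k. ?bad k) = 0"
    using g by (intro modulus_zero_UN S) (auto simp: weak_upper_gradient_def)
  moreover have "modulus p M S ?inf = 0"
    using fin by (intro modulus_zero_infinite_line_integral[OF S wm]) (simp add: w_def)
  ultimately have "modulus p M S ((\<Union>k. ?bad k) \<union> ?inf) = 0" by (intro modulus_zero_Un S)
  then show ?thesis
  proof (rule weak_upper_gradientI[rotated])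
    fix c assume c: "rectifiable_curve S c" "c \<notin> (\<Union>k. ?bad k) \<union> ?inf"
    define L where "L = total_length c"
    define d where "d = ennreal \<bar>u (arc_param c 0) - u (arc_param c L)\<bar>"
    have d: "d \<le> arc_integral (g k) c 0 L" for k
      using c ug_ineq_iff[OF c(1)] by (auto simp: L_def d_def)
    have meas: "(\<lambda>r. h (arc_param c r) * indicator {0..L} r) \<in> borel_measurable lborel"
      if "h \<in> borel_on S" for h :: "'a \<Rightarrow> ennreal"
      using measurable_along_curve[OF c(1) that] by (simp add: L_def)
    have "d \<le> limsup (\<lambda>k. arc_integral (g k) c 0 L)"
      using d by (intro le_Limsup) auto
    also have "\<dots> \<le> (\<integral>\<^sup>+r. limsup (\<lambda>k. g k (arc_param c r) * indicator {0..L} r) \<partial>lborel)"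
      unfolding arc_integral_def
    proof (rule nn_integral_limsup)
      show "(\<lambda>r. w (arc_param c r) * indicator {0..L} r) \<in> borel_measurable lborel" by (rule meas[OF wm])
      show "(\<integral>\<^sup>+r\<in>{0..L}. w (arc_param c r) \<partial>lborel) < \<infinity>"
        using c by (auto simp: line_integral_eq arc_integral_def L_def less_top)
      show "AE r in lborel. g k (arc_param c r) * indicator {0..L} r \<le> w (arc_param c r) * indicator {0..L} r" for k
        by (intro AE_I2 mult_right_mono) (auto simp: w_def intro: SUP_upper)
    qed (rule meas, measurable)
    also have "\<dots> = arc_integral (\<lambda>x. limsup (\<lambda>k. g k x)) c 0 L"
      unfolding arc_integral_def by (intro nn_integral_cong) (auto simp: indicator_def Limsup_const)
    finally show "ennreal \<bar>u (arc_param c 0) - u (arc_param c (total_length c))\<bar>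
      \<le> arc_integral (\<lambda>x. limsup (\<lambda>k. g k x)) c 0 (total_length c)" by (simp add: d_def L_def)
  qed measurable
qed


text \<open>Near-minimal weak upper gradients are close to each other in \<open>L\<^sup>p\<close>, so a minimizing
  sequence that is chosen fast enough converges almost everywhere and below a majorant of finite
  energy. Its limit is a weak upper gradient, and its energy is minimal by Fatou's lemma.\<close>

theorem minimal_weak_upper_gradient_exists:
  assumes S: "S \<in> sets borel" and h0: "weak_upper_gradient p M S u h0" "energy S h0 < \<infinity>"
  shows "\<exists>g. is_min_weak_ug p M S u g"
proof -
  define I where "I = (INF h\<in>{h. weak_upper_gradient p M S u h}. energy S h)"
  have "I \<le> energy S h0" unfolding I_def using h0(1) by (intro INF_lower) simp
  then obtain i where i: "I = ennreal i" "0 \<le> i" using h0(2) by (cases I) (auto simp: top_unique)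
  have lower: "ennreal i \<le> energy S h" if "weak_upper_gradient p M S u h" for h
    using that unfolding i(1)[symmetric] I_def by (intro INF_lower) simp
  define near where "near k \<delta> \<longleftrightarrow> (\<forall>g h. weak_upper_gradient p M S u g \<longrightarrow> weak_upper_gradient p M S u h \<longrightarrow>
      energy S g \<le> ennreal (i + \<delta>) \<longrightarrow> energy S h \<le> ennreal (i + \<delta>) \<longrightarrow>
      (\<integral>\<^sup>+x\<in>S. ennreal (\<bar>enn2real (g x) - enn2real (h x)\<bar> powr p) \<partial>M) \<le> ennreal (((1 / 4) ^ k) powr p))"
    for k :: nat and \<delta> :: real
  have "\<exists>\<delta>>0. near k \<delta>" for k
  proof -
    have pos: "0 < ((1 / 4 :: real) ^ k) powr p" by simp
    show ?thesis
    proof (rule near_minimal_weak_ugs_close[OF S i(2) lower pos])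
      fix \<delta> :: real assume *: "0 < \<delta>" "\<And>g h. weak_upper_gradient p M S u g \<Longrightarrow> weak_upper_gradient p M S u h \<Longrightarrow>
        energy S g \<le> ennreal (i + \<delta>) \<Longrightarrow> energy S h \<le> ennreal (i + \<delta>) \<Longrightarrow>
        (\<integral>\<^sup>+x\<in>S. ennreal (\<bar>enn2real (g x) - enn2real (h x)\<bar> powr p) \<partial>M) \<le> ennreal (((1 / 4) ^ k) powr p)"
      then have "near k \<delta>" unfolding near_def by simp
      with *(1) show "\<exists>\<delta>>0. near k \<delta>" by auto
    qed
  qed
  then obtain \<delta> where \<delta>: "\<And>k. 0 < \<delta> k" "\<And>k. near k (\<delta> k)" by metis
  note close = \<delta>(2)[unfolded near_def, rule_format]
  (* The minimum makes g j near-minimal for all k \<le> j, so that consecutive members are close. *)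
  define e where "e k = Min (insert (1 / real (Suc k)) (\<delta> ` {..k}))" for k
  have e: "0 < e k" "e k \<le> 1 / real (Suc k)" for k
    using \<delta>(1) unfolding e_def by (auto intro: Min_le)
  have e_le: "e j \<le> \<delta> k" if "k \<le> j" for j k using that unfolding e_def by (intro Min_le) auto
  have "\<exists>g. weak_upper_gradient p M S u g \<and> energy S g \<le> ennreal (i + e k)" for k
  proof -
    have "I < ennreal (i + e k)" using e(1)[of k] i by (simp add: ennreal_lessI)
    then show ?thesis unfolding I_def INF_less_iff by (auto intro: less_imp_le)
  qed
  then obtain g where g: "\<And>k. weak_upper_gradient p M S u (g k)" "\<And>k. energy S (g k) \<le> ennreal (i + e k)"
    by metis
  have gm [measurable]: "g k \<in> borel_on S" for k
    using g(1) by (rule weak_upper_gradient_measurable)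
  have g_delta: "energy S (g j) \<le> ennreal (i + \<delta> k)" if "k \<le> j" for j k
    using g(2)[of j] e_le[OF that] by (metis add_left_mono ennreal_leI order_trans)
  define d where "d k x = \<bar>enn2real (g k x) - enn2real (g (Suc k) x)\<bar>" for k x
  have d_int: "(\<integral>\<^sup>+x\<in>S. ennreal (d k x powr p) \<partial>M) \<le> ennreal (((1 / 4) ^ k) powr p)" for k
    unfolding d_def using g g_delta by (intro close) auto
  have d_meas: "(\<lambda>x. ennreal (d k x powr p)) \<in> borel_on S" for k
    unfolding d_def by measurable
  note d_meas_M = zero_extension_measurable[OF S d_meas]
  (* The norm of d k is at most 4 ^ -k, so that Q is integrable and hence finite almost everywhere.
     By construction d k is at most 2 ^ -k times Q ^ (1/p), which is summable in k. *)
  define Q where "Q x = (\<Sum>k. ennreal ((2 ^ k) powr p) * ennreal (d k x powr p))" for x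
  have Qm [measurable]: "Q \<in> borel_on S"
    unfolding Q_def using d_meas by measurable
  have Q_int: "(\<integral>\<^sup>+x\<in>S. Q x \<partial>M) < \<infinity>"
  proof -
    have "(\<integral>\<^sup>+x\<in>S. Q x \<partial>M)
        = (\<integral>\<^sup>+x. (\<Sum>k. ennreal ((2 ^ k) powr p) * (ennreal (d k x powr p) * indicator S x)) \<partial>M)"
      by (intro nn_integral_cong) (auto simp: Q_def indicator_def)
    also have "\<dots> = (\<Sum>k. ennreal ((2 ^ k) powr p) * (\<integral>\<^sup>+x\<in>S. ennreal (d k x powr p) \<partial>M))"
      using d_meas_M by (subst nn_integral_suminf, measurable) (subst nn_integral_cmult, auto)
    also have "\<dots> \<le> (\<Sum>k. ennreal ((1 / 2) ^ k))"
    proof (intro suminf_le)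
      fix k
      have "ennreal ((2 ^ k) powr p) * (\<integral>\<^sup>+x\<in>S. ennreal (d k x powr p) \<partial>M)
          \<le> ennreal ((2 ^ k) powr p) * ennreal (((1 / 4) ^ k) powr p)" by (intro mult_left_mono d_int) auto
      also have "\<dots> = ennreal (((1 / 2) ^ k) powr p)"
        by (simp add: ennreal_mult[symmetric] powr_mult[symmetric] power_mult_distrib[symmetric])
      also have "\<dots> \<le> ennreal (((1 / 2) ^ k) powr 1)"
        using p_gt_1 by (intro ennreal_leI powr_mono') (auto simp: power_le_one)
      finally show "ennreal ((2 ^ k) powr p) * (\<integral>\<^sup>+x\<in>S. ennreal (d k x powr p) \<partial>M) \<le> ennreal ((1 / 2) ^ k)"
        by simp
    qed auto
    also have "\<dots> = ennreal (\<Sum>k. (1 / 2) ^ k)" by (intro suminf_ennreal2) (auto intro: summable_geometric)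
    finally show ?thesis by (simp add: order_le_less_trans[OF _ ennreal_less_top])
  qed
  have fin: "energy S (g k) < \<infinity>" for k using g(2)[of k] by (simp add: order_le_less_trans[OF _ ennreal_less_top])
  have AE_fin: "AE x in M. x \<in> S \<longrightarrow> Q x < top \<and> (\<forall>k. g k x < top)"
  proof -
    have "AE x in M. Q x * indicator S x \<noteq> \<infinity>"
      using Q_int by (intro nn_integral_PInf_AE zero_extension_measurable[OF S Qm]) auto
    moreover have "AE x in M. \<forall>k. epowr (g k x) p * indicator S x \<noteq> \<infinity>"
      unfolding AE_all_countable
      by (intro allI nn_integral_PInf_AE energy_integrand_measurable[OF S gm] less_imp_neq fin)
    ultimately show ?thesis by eventually_elim (auto simp: less_top[symmetric])
  qed
  have pointwise: "\<exists>l\<ge>0. (\<lambda>k. enn2real (g k x)) \<longlonglongrightarrow> l" (is ?lim)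
    and majorant: "g k x \<le> g 0 x + 2 * epowr (Q x) (1 / p)" (is ?maj)
    if x: "Q x < top" "\<forall>k. g k x < top" for x k
  proof -
    obtain q where q: "Q x = ennreal q" "0 \<le> q" using x(1) by (cases "Q x") auto
    define a where "a = (\<lambda>k. enn2real (g k x))"
    define b where "b = q powr (1 / p)"
    have step: "\<bar>a (Suc j) - a j\<bar> \<le> (1 / 2) ^ j * b" for j
    proof -
      have "ennreal ((2 ^ j) powr p) * ennreal (d j x powr p) \<le> Q x"
        unfolding Q_def using sum_le_suminf[of "\<lambda>k. ennreal ((2 ^ k) powr p) * ennreal (d k x powr p)" "{j}"] by simp
      then have "(2 ^ j * d j x) powr p \<le> q"
        using q by (simp add: powr_mult d_def flip: ennreal_mult)
      then have "((2 ^ j * d j x) powr p) powr (1 / p) \<le> b"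
        unfolding b_def using p_gt_1 by (intro powr_mono2) auto
      then have "2 ^ j * d j x \<le> b" using p_gt_1 by (simp add: powr_powr d_def)
      then show ?thesis by (simp add: d_def a_def field_simps abs_minus_commute)
    qed
    have geo: "summable (\<lambda>j. (1 / 2) ^ j * b)" by (intro summable_mult2 summable_geometric) simp
    have "summable (\<lambda>j. a (Suc j) - a j)"
      by (rule summable_comparison_test'[OF geo, of 0]) (use step in auto)
    then have "(\<lambda>n. \<Sum>j<n. a (Suc j) - a j) \<longlonglongrightarrow> (\<Sum>j. a (Suc j) - a j)" by (rule summable_LIMSEQ)
    then have "(\<lambda>n. a n - a 0) \<longlonglongrightarrow> (\<Sum>j. a (Suc j) - a j)" by (simp add: sum_lessThan_telescope)
    from tendsto_add[OF this tendsto_const[of "a 0"]] obtain l where l: "a \<longlonglongrightarrow> l" by auto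
    moreover have "0 \<le> l" by (rule LIMSEQ_le_const[OF l]) (auto simp: a_def)
    ultimately show ?lim by (auto simp: a_def)
    have "a k \<le> a 0 + (\<Sum>j<k. (1 / 2) ^ j * b)"
    proof (induction k)
      case (Suc k)
      then show ?case using step[of k] by (simp add: abs_le_iff)
    qed simp
    also have "(\<Sum>j<k. (1 / 2) ^ j * b) \<le> (\<Sum>j. (1 / 2) ^ j * b)"
      by (rule sum_le_suminf[OF geo]) (auto simp: b_def)
    also have "\<dots> = 2 * b" by (subst suminf_mult2[symmetric]) (auto simp: suminf_geometric intro: summable_geometric)
    finally have "ennreal (a k) \<le> ennreal (a 0 + 2 * b)" by (intro ennreal_leI) simp
    moreover have "ennreal (a k) = g k x" "ennreal (a 0) = g 0 x" using x(2) by (auto simp: a_def)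
    moreover have "epowr (Q x) (1 / p) = ennreal b" using q by (simp add: b_def epowr_ennreal)
    moreover have "ennreal (a 0 + 2 * b) = ennreal (a 0) + 2 * ennreal b"
      by (simp add: a_def b_def ennreal_mult)
    ultimately show ?maj by simp
  qed
  define G where "G x = limsup (\<lambda>k. g k x)" for x
  have G_wug: "weak_upper_gradient p M S u G"
    unfolding G_def
  proof (rule weak_upper_gradient_limsup[OF S g(1)])
    have "energy S (\<lambda>x. SUP k. g k x) \<le> energy S (\<lambda>x. g 0 x + 2 * epowr (Q x) (1 / p))"
    proof (rule nn_integral_mono_AE)
      show "AE x in M. epowr (SUP k. g k x) p * indicator S x
          \<le> epowr (g 0 x + 2 * epowr (Q x) (1 / p)) p * indicator S x"
        using AE_fin by eventually_elim
          (use p_gt_1 majorant in \<open>auto simp: indicator_def intro!: epowr_mono SUP_least\<close>)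
    qed
    also have "\<dots> < \<infinity>"
    proof (rule energy_add_finite[OF S gm _ fin])
      have "energy S (\<lambda>x. epowr (Q x) (1 / p)) = (\<integral>\<^sup>+x\<in>S. Q x \<partial>M)"
        using p_gt_1 by (simp add: epowr_epowr)
      then show "energy S (\<lambda>x. 2 * epowr (Q x) (1 / p)) < \<infinity>"
        using Q_int epowr_ennreal[of 2 p] by (subst energy_cmult[OF S]) (auto simp: ennreal_mult_less_top)
    qed measurable
    finally show "energy S (\<lambda>x. SUP k. g k x) < \<infinity>" .
  qed
  have "energy S G \<le> ennreal i"
  proof -
    have "energy S G \<le> (\<integral>\<^sup>+x. liminf (\<lambda>k. epowr (g k x) p * indicator S x) \<partial>M)"
    proof (rule nn_integral_mono_AE)
      show "AE x in M. epowr (G x) p * indicator S x \<le> liminf (\<lambda>k. epowr (g k x) p * indicator S x)"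
        using AE_fin
      proof eventually_elim
        case (elim x)
        show ?case
        proof (cases "x \<in> S")
          case True
          then obtain l where l: "0 \<le> l" "(\<lambda>k. enn2real (g k x)) \<longlonglongrightarrow> l" using pointwise elim by blast
          have gx: "g k x = ennreal (enn2real (g k x))" for k using elim True by simp
          have "(\<lambda>k. g k x) \<longlonglongrightarrow> ennreal l" by (subst gx) (intro tendsto_ennrealI l)
          then have "G x = ennreal l" unfolding G_def by (intro lim_imp_Limsup) auto
          moreover have "(\<lambda>k. epowr (g k x) p) \<longlonglongrightarrow> ennreal (l powr p)"
          proof -
            have "(\<lambda>k. enn2real (g k x) powr p) \<longlonglongrightarrow> l powr p"
              using l p_gt_1 by (intro tendsto_powr' tendsto_const) auto
            then have "(\<lambda>k. ennreal (enn2real (g k x) powr p)) \<longlonglongrightarrow> ennreal (l powr p)" by (rule tendsto_ennrealI)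
            moreover have "epowr (g k x) p = ennreal (enn2real (g k x) powr p)" for k
              by (subst gx) (simp add: epowr_ennreal)
            ultimately show ?thesis by simp
          qed
          then have "liminf (\<lambda>k. epowr (g k x) p) = ennreal (l powr p)" by (intro lim_imp_Liminf) auto
          ultimately show ?thesis using True l by (simp add: epowr_ennreal)
        qed simp
      qed
    qed
    also have "\<dots> \<le> liminf (\<lambda>k. energy S (g k))"
      by (intro nn_integral_liminf energy_integrand_measurable[OF S gm])
    also have "\<dots> \<le> liminf (\<lambda>k. ennreal (i + 1 / real (Suc k)))"
      using g(2) e(2) by (intro Liminf_mono always_eventually allI) (meson add_left_mono ennreal_leI order_trans)
    also have "\<dots> = ennreal i"
    proof (intro lim_imp_Liminf tendsto_ennrealI)
      show "(\<lambda>k. i + 1 / real (Suc k)) \<longlonglongrightarrow> i"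
        using tendsto_add[OF tendsto_const[of i] LIMSEQ_inverse_real_of_nat] by (simp add: inverse_eq_divide)
    qed simp
    finally show ?thesis .
  qed
  then have "energy S G < \<infinity>" "\<And>h. weak_upper_gradient p M S u h \<Longrightarrow> energy S G \<le> energy S h"
    using lower by (auto intro: order_trans order_le_less_trans[OF _ ennreal_less_top])
  then have "is_min_weak_ug p M S u G" using G_wug by (auto simp: is_min_weak_ug_def)
  then show ?thesis by blast
qed

lemma min_weak_ug:
  assumes "S \<in> sets borel" "newtonian p M S u"
  shows "is_min_weak_ug p M S u (min_weak_ug p M S u)"
proof -
  have "\<exists>g. is_min_weak_ug p M S u g"
    using minimal_weak_upper_gradient_exists[OF assms(1)] assms(2) unfolding newtonian_def by blast
  then show ?thesis unfolding min_weak_ug_def by (rule someI_ex)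
qed


section \<open>Newtonian functions\<close>

lemma measurable_restrict_UNIV [simp]:
  "u \<in> borel_measurable (restrict_space M UNIV) \<longleftrightarrow> u \<in> borel_measurable M"
  by (intro arg_cong2[where f = "(\<in>)"] measurable_cong_sets) (auto simp: sets_restrict_space)

lemma min_weak_ug_props:
  assumes "S \<in> sets borel" "newtonian p M S u"
  shows "weak_upper_gradient p M S u (min_weak_ug p M S u)"
    and "energy S (min_weak_ug p M S u) < \<infinity>"
    and "\<And>h. weak_upper_gradient p M S u h \<Longrightarrow> energy S (min_weak_ug p M S u) \<le> energy S h"
  using min_weak_ug[OF assms] by (auto simp: is_min_weak_ug_def)

lemma Lp_on_lincomb:
  assumes "S \<in> sets borel" "Lp_on p M S u" "Lp_on p M S v"
  shows "Lp_on p M S (\<lambda>x. a * u x + b * v x)"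
proof -
  have [measurable]: "u \<in> borel_measurable (restrict_space M S)" "v \<in> borel_measurable (restrict_space M S)"
    using assms by (auto simp: Lp_on_def)
  have S: "S \<inter> space M \<in> sets M" using assms(1) sets_borel by (auto simp: space_M)
  have meas: "(\<lambda>x. ennreal (\<bar>w x\<bar> powr p) * indicator S x) \<in> borel_measurable M"
    if [measurable]: "w \<in> borel_measurable (restrict_space M S)" for w :: "'a \<Rightarrow> real"
  proof -
    have "(\<lambda>x. ennreal (\<bar>w x\<bar> powr p)) \<in> borel_measurable (restrict_space M S)" by measurable
    then show ?thesis by (subst (asm) borel_measurable_restrict_space_iff_ennreal[OF S])
  qed
  have bound: "ennreal (\<bar>a * x + b * y\<bar> powr p)
      \<le> ennreal ((2 * \<bar>a\<bar>) powr p) * ennreal (\<bar>x\<bar> powr p) + ennreal ((2 * \<bar>b\<bar>) powr p) * ennreal (\<bar>y\<bar> powr p)" for x y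
  proof -
    have "ennreal (\<bar>a * x + b * y\<bar> powr p) = epowr (ennreal \<bar>a * x + b * y\<bar>) p" by (simp add: epowr_ennreal)
    also have "\<dots> \<le> epowr (ennreal \<bar>a * x\<bar> + ennreal \<bar>b * y\<bar>) p"
      using p_gt_1 by (intro epowr_mono) (auto simp flip: ennreal_plus intro!: ennreal_leI)
    also have "\<dots> \<le> ennreal (2 powr p) * (epowr (ennreal \<bar>a * x\<bar>) p + epowr (ennreal \<bar>b * y\<bar>) p)"
      using p_gt_1 by (intro epowr_add_le) auto
    also have "\<dots> = ennreal ((2 * \<bar>a\<bar>) powr p) * ennreal (\<bar>x\<bar> powr p) + ennreal ((2 * \<bar>b\<bar>) powr p) * ennreal (\<bar>y\<bar> powr p)"
      by (simp add: epowr_mult epowr_ennreal abs_mult powr_mult ennreal_mult distrib_left mult.assoc)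
    finally show ?thesis .
  qed
  have "(\<integral>\<^sup>+x\<in>S. ennreal (\<bar>a * u x + b * v x\<bar> powr p) \<partial>M)
      \<le> (\<integral>\<^sup>+x. ennreal ((2 * \<bar>a\<bar>) powr p) * (ennreal (\<bar>u x\<bar> powr p) * indicator S x)
          + ennreal ((2 * \<bar>b\<bar>) powr p) * (ennreal (\<bar>v x\<bar> powr p) * indicator S x) \<partial>M)"
    using bound by (intro nn_integral_mono) (auto simp: indicator_def)
  also have "\<dots> = ennreal ((2 * \<bar>a\<bar>) powr p) * (\<integral>\<^sup>+x\<in>S. ennreal (\<bar>u x\<bar> powr p) \<partial>M)
      + ennreal ((2 * \<bar>b\<bar>) powr p) * (\<integral>\<^sup>+x\<in>S. ennreal (\<bar>v x\<bar> powr p) \<partial>M)"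
    using meas[of u] meas[of v] by (subst nn_integral_add, measurable) (simp add: nn_integral_cmult)
  also have "\<dots> < \<infinity>" using assms by (auto simp: Lp_on_def ennreal_mult_less_top)
  finally show ?thesis by (simp add: Lp_on_def)
qed

lemma newtonian_lincomb:
  assumes S: "S \<in> sets borel" and u: "newtonian p M S u" and v: "newtonian p M S v"
  shows "newtonian p M S (\<lambda>x. a * u x + b * v x)"
proof -
  obtain h k where h: "weak_upper_gradient p M S u h" "energy S h < \<infinity>"
    and k: "weak_upper_gradient p M S v k" "energy S k < \<infinity>"
    using u v by (auto simp: newtonian_def)
  note [measurable] = h(1)[THEN weak_upper_gradient_measurable] k(1)[THEN weak_upper_gradient_measurable]
  have "energy S (\<lambda>x. ennreal \<bar>a\<bar> * h x + ennreal \<bar>b\<bar> * k x) < \<infinity>"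
  proof (rule energy_add_finite[OF S])
    show "energy S (\<lambda>x. ennreal \<bar>a\<bar> * h x) < \<infinity>" "energy S (\<lambda>x. ennreal \<bar>b\<bar> * k x) < \<infinity>"
      using h k by (auto simp: energy_cmult[OF S] epowr_ennreal ennreal_mult_less_top)
  qed measurable
  then show ?thesis
    using weak_upper_gradient_lincomb[OF h(1) k(1) S, of a b] Lp_on_lincomb[OF S, of u v a b] u v
    unfolding newtonian_def by blast
qed

lemma newtonian_restrict:
  assumes u: "newtonian p M UNIV u" and S: "S \<in> sets borel" and eq: "\<And>x. x \<in> S \<Longrightarrow> u x = w x"
  shows "newtonian p M S w"
proof -
  obtain h where h: "weak_upper_gradient p M UNIV u h" "energy UNIV h < \<infinity>"
    using u by (auto simp: newtonian_def)
  have "weak_upper_gradient p M S w h"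
    by (rule weak_upper_gradient_restrict[OF h(1)]) (use S eq in auto)
  moreover have "energy S h \<le> energy UNIV h" by (intro nn_integral_mono) (auto simp: indicator_def)
  moreover have "Lp_on p M S w"
  proof -
    have "u \<in> borel_measurable M" using u by (simp add: newtonian_def Lp_on_def)
    then have "u \<in> borel_measurable (restrict_space M S)" by (rule measurable_restrict_space1)
    then have "w \<in> borel_measurable (restrict_space M S)"
      by (subst measurable_cong[of _ _ u]) (auto simp: space_restrict_space eq)
    moreover have "(\<integral>\<^sup>+x\<in>S. ennreal (\<bar>w x\<bar> powr p) \<partial>M) \<le> (\<integral>\<^sup>+x\<in>UNIV. ennreal (\<bar>u x\<bar> powr p) \<partial>M)"
      by (intro nn_integral_mono) (auto simp: indicator_def eq)
    ultimately show ?thesis using u by (auto simp: newtonian_def Lp_on_def intro: order_le_less_trans)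
  qed
  ultimately show ?thesis using h(2) unfolding newtonian_def by (blast intro: order_le_less_trans)
qed


section \<open>Locality of minimal weak upper gradients\<close>

text \<open>A piece of a curve that meets \<open>K\<close> at most at its ends has the same integral whether or not \<open>h\<close> is set to
  zero on \<open>K\<close>. So the first and the last such piece give the inequality for the smaller function.\<close>

lemma weak_upper_gradient_off_zero_set:
  assumes h: "weak_upper_gradient p M UNIV w h" and K: "closed K" and w: "\<And>x. x \<in> K \<Longrightarrow> w x = 0"
  shows "weak_upper_gradient p M UNIV w (\<lambda>x. h x * indicator (- K) x)"
proof -
  have [measurable]: "h \<in> borel_measurable borel"
    using weak_upper_gradient_measurable[OF h] by simp
  have [measurable]: "K \<in> sets borel" using K by simp
  have h': "(\<lambda>x. h x * indicator (- K) x) \<in> borel_on UNIV" by simp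
  obtain \<Gamma> where \<Gamma>: "modulus p M UNIV \<Gamma> = 0"
    "\<And>c. rectifiable_curve UNIV c \<Longrightarrow> c \<notin> \<Gamma> \<Longrightarrow> ug_on_arcs UNIV w h c"
    using weak_upper_gradient_arcs[OF h, of UNIV] by auto
  show ?thesis
  proof (rule weak_upper_gradientI[OF h' \<Gamma>(1)])
    fix c assume c: "rectifiable_curve UNIV c" "c \<notin> \<Gamma>"
    show "ennreal \<bar>w (arc_param c 0) - w (arc_param c (total_length c))\<bar>
        \<le> arc_integral (\<lambda>x. h x * indicator (- K) x) c 0 (total_length c)"
      unfolding arc_integral_def
    proof (rule first_last_visit[where f = "\<lambda>r. w (arc_param c r)" and K = K and \<sigma> = "arc_param c"])
      show "(\<lambda>r. h (arc_param c r) * indicator (- K) (arc_param c r) * indicator {0..total_length c} r)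
          \<in> borel_measurable borel"
        using measurable_along_curve[OF c(1) h', of 0 "total_length c"] by simp
      fix a b assume ab: "0 \<le> a" "a \<le> b" "b \<le> total_length c"
        and off: "\<And>r. r \<in> {a<..<b} \<Longrightarrow> arc_param c r \<notin> K"
      have "ennreal \<bar>w (arc_param c a) - w (arc_param c b)\<bar> \<le> arc_integral h c a b"
        using ug_on_arcsD[OF \<Gamma>(2)[OF c] ab] by simp
      also have "\<dots> = (\<integral>\<^sup>+r\<in>{a..b}. h (arc_param c r) * indicator (- K) (arc_param c r) \<partial>lborel)"
        unfolding arc_integral_def
      proof (rule nn_integral_cong_AE)
        show "AE r in lborel. h (arc_param c r) * indicator {a..b} r
            = h (arc_param c r) * indicator (- K) (arc_param c r) * indicator {a..b} r"
          using AE_lborel_singleton[of a] AE_lborel_singleton[of b]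
          by eventually_elim (use off in \<open>auto simp: indicator_def\<close>)
      qed
      finally show "ennreal \<bar>w (arc_param c a) - w (arc_param c b)\<bar>
          \<le> (\<integral>\<^sup>+r\<in>{a..b}. h (arc_param c r) * indicator (- K) (arc_param c r) \<partial>lborel)" .
    qed (use K w continuous_on_arc_param[OF c(1)] in auto)
  qed
qed

lemma energy_split:
  assumes "h \<in> borel_measurable borel" "K \<in> sets borel"
  shows "energy UNIV h = energy K h + energy (- K) h"
proof -
  have h: "h \<in> borel_on K" "h \<in> borel_on (- K)"
    using assms(1) by (auto intro: measurable_restrict_space1)
  have "energy UNIV h = (\<integral>\<^sup>+x. epowr (h x) p * indicator K x + epowr (h x) p * indicator (- K) x \<partial>M)"
    by (intro nn_integral_cong) (auto simp: indicator_def)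
  also have "\<dots> = energy K h + energy (- K) h"
    using assms h by (intro nn_integral_add energy_integrand_measurable) auto
  finally show ?thesis .
qed

text \<open>Minimality turns every competitor that equals the minimal weak upper gradient off \<open>K\<close> into
  an estimate on \<open>K\<close>.\<close>

lemma energy_min_weak_ug_le:
  assumes w: "newtonian p M UNIV w" and K: "K \<in> sets borel"
    and h: "weak_upper_gradient p M UNIV w (\<lambda>x. if x \<in> K then h x else min_weak_ug p M UNIV w x)"
  shows "energy K (min_weak_ug p M UNIV w) \<le> energy K h"
proof -
  define g where "g = min_weak_ug p M UNIV w"
  define k where "k x = (if x \<in> K then h x else g x)" for x
  have g: "weak_upper_gradient p M UNIV w g" "energy UNIV g < \<infinity>"
    and k: "weak_upper_gradient p M UNIV w k" "energy UNIV g \<le> energy UNIV k"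
    using min_weak_ug_props[OF _ w] h unfolding g_def k_def by auto
  have "energy K g + energy (- K) g \<le> energy K k + energy (- K) k"
    using k(2) energy_split[OF _ K] weak_upper_gradient_measurable[OF g(1)] weak_upper_gradient_measurable[OF k(1)]
    by simp
  moreover have "energy K k = energy K h" "energy (- K) k = energy (- K) g"
    unfolding k_def by (auto intro!: nn_integral_cong simp: indicator_def)
  moreover have "energy (- K) g \<le> energy UNIV g" by (intro nn_integral_mono) (auto simp: indicator_def)
  then have "energy (- K) g < top" using g(2) by (auto intro: order_le_less_trans)
  ultimately have "energy K g \<le> energy K h"
    by (auto simp: add.commute[of _ "energy (- K) g"] ennreal_add_left_cancel_le)
  then show ?thesis by (simp add: g_def)
qed

lemma min_weak_ug_zero_on:
  assumes w: "newtonian p M UNIV w" and K: "closed K" "\<And>x. x \<in> K \<Longrightarrow> w x = 0"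
  shows "AE x in M. x \<in> K \<longrightarrow> min_weak_ug p M UNIV w x = 0"
proof -
  define g where "g = min_weak_ug p M UNIV w"
  have g: "weak_upper_gradient p M UNIV w g" using min_weak_ug_props[OF _ w] by (simp add: g_def)
  have "(\<lambda>x. g x * indicator (- K) x) = (\<lambda>x. if x \<in> K then 0 else g x)" by (auto simp: indicator_def)
  then have "energy K g \<le> energy K (\<lambda>x. 0)"
    using weak_upper_gradient_off_zero_set[OF g K] K(1) w unfolding g_def
    by (intro energy_min_weak_ug_le) auto
  then have "energy K g = 0" by simp
  moreover have "(\<lambda>x. epowr (g x) p * indicator K x) \<in> borel_measurable M"
    using weak_upper_gradient_measurable[OF g] K by (intro energy_integrand_measurable measurable_restrict_space1) auto
  ultimately have "AE x in M. epowr (g x) p * indicator K x = 0" by (simp add: nn_integral_0_iff_AE)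
  then show ?thesis by eventually_elim (auto simp: g_def)
qed

text \<open>Near \<open>K\<close> the functions \<open>w\<close> and \<open>u\<close> agree. A curve is cut into pieces so short that those
  meeting \<open>K\<close> stay in a small neighbourhood of \<open>K\<close>; on these \<open>h\<close> is used, on the others \<open>g\<close>. As the
  neighbourhood shrinks to \<open>K\<close>, the excess disappears by dominated convergence along the curve.\<close>

lemma weak_upper_gradient_glue:
  assumes "open \<Omega>" and h: "weak_upper_gradient p M \<Omega> u h" "energy \<Omega> h < \<infinity>"
    and g: "weak_upper_gradient p M UNIV w g"
    and K: "closed K" "0 < \<delta>" "\<And>x y. x \<in> K \<Longrightarrow> dist x y < \<delta> \<Longrightarrow> y \<in> \<Omega> \<and> w y = u y"
  shows "weak_upper_gradient p M UNIV w (\<lambda>x. if x \<in> K then h x else g x)"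
proof -
  have \<Omega>: "\<Omega> \<in> sets borel" using \<open>open \<Omega>\<close> by simp
  have K\<Omega>: "K \<subseteq> \<Omega>" using K by auto
  have [measurable]: "K \<in> sets borel" using K by simp
  have gm [measurable]: "g \<in> borel_measurable borel" using weak_upper_gradient_measurable[OF g] by simp
  define h0 where "h0 x = h x * indicator \<Omega> x" for x
  have h0m [measurable]: "h0 \<in> borel_measurable borel"
    unfolding h0_def by (rule zero_extension_borel[OF \<Omega> weak_upper_gradient_measurable[OF h(1)]])
  obtain m0 :: nat where m0: "1 / real (Suc m0) < \<delta>" using nat_approx_posE[OF K(2)] by auto
  define A where "A m = (\<Union>x\<in>K. ball x (1 / real (Suc (m0 + m))))" for m
  have A_open: "open (A m)" for m unfolding A_def by auto
  then have [measurable]: "A m \<in> sets borel" for m by simp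
  have A_dec: "A (Suc m) \<subseteq> A m" for m
    unfolding A_def by (fastforce intro: order_less_le_trans simp: frac_le)
  have K_A: "K \<subseteq> A m" for m unfolding A_def by force
  have A_Inf: "\<exists>m. x \<notin> A m" if "x \<notin> K" for x
  proof -
    have "open (- K)" "x \<in> - K" using K(1) that by auto
    then obtain e where e: "0 < e" "ball x e \<subseteq> - K" by (rule openE)
    obtain n :: nat where n: "1 / real (Suc n) < e" using nat_approx_posE[OF e(1)] by auto
    have "1 / real (Suc (m0 + n)) \<le> 1 / real (Suc n)" by (intro divide_left_mono) auto
    then have "ball x (1 / real (Suc (m0 + n))) \<subseteq> - K" using e(2) n subset_ball[of "1 / real (Suc (m0 + n))" e x] by auto
    then have "x \<notin> A n" unfolding A_def by (auto simp: dist_commute[of _ x] subset_iff)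
    then show ?thesis by blast
  qed
  define k where "k x = (if x \<in> K then h x else g x)" for x
  have k_eq: "k x = h0 x * indicator K x + g x * indicator (- K) x" for x
    using K\<Omega> by (auto simp: k_def h0_def indicator_def)
  have km: "k \<in> borel_on UNIV" unfolding k_eq[abs_def] by simp
  obtain \<Gamma>1 where \<Gamma>1: "modulus p M UNIV \<Gamma>1 = 0"
    "\<And>c. rectifiable_curve UNIV c \<Longrightarrow> c \<notin> \<Gamma>1 \<Longrightarrow> ug_on_arcs \<Omega> u h c"
    using weak_upper_gradient_arcs[OF h(1) \<Omega>, of UNIV] by auto
  obtain \<Gamma>2 where \<Gamma>2: "modulus p M UNIV \<Gamma>2 = 0"
    "\<And>c. rectifiable_curve UNIV c \<Longrightarrow> c \<notin> \<Gamma>2 \<Longrightarrow> ug_on_arcs UNIV w g c"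
    using weak_upper_gradient_arcs[OF g, of UNIV] by auto
  let ?\<Gamma>3 = "{c. rectifiable_curve UNIV c \<and> line_integral h0 c = \<infinity>}"
  have "energy UNIV h0 = energy \<Omega> h" by (intro nn_integral_cong) (auto simp: h0_def indicator_def)
  then have \<Gamma>3: "modulus p M UNIV ?\<Gamma>3 = 0"
    using h(2) by (intro modulus_zero_infinite_line_integral) auto
  have "modulus p M UNIV (\<Gamma>1 \<union> (\<Gamma>2 \<union> ?\<Gamma>3)) = 0"
    using \<Gamma>1(1) \<Gamma>2(1) \<Gamma>3 by (intro modulus_zero_Un) auto
  then have "weak_upper_gradient p M UNIV w k"
  proof (rule weak_upper_gradientI[OF km])
    fix c assume c: "rectifiable_curve UNIV c" "c \<notin> \<Gamma>1 \<union> (\<Gamma>2 \<union> ?\<Gamma>3)"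
    have arcs: "ug_on_arcs \<Omega> u h c" "ug_on_arcs UNIV w g c" using \<Gamma>1(2) \<Gamma>2(2) c by blast+
    define L where "L = total_length c"
    define d where "d = ennreal \<bar>w (arc_param c 0) - w (arc_param c L)\<bar>"
    define a where "a m = arc_integral (\<lambda>x. h0 x * indicator (A m) x) c 0 L" for m
    define b where "b = arc_integral (\<lambda>x. g x * indicator (- K) x) c 0 L"
    have meas: "(\<lambda>r. f (arc_param c r) * indicator {0..L} r) \<in> borel_measurable borel"
      if "f \<in> borel_measurable borel" for f :: "'a \<Rightarrow> ennreal"
      unfolding L_def using that c by (intro measurable_along_curve[of UNIV]) auto
    have step: "d \<le> a m + b" for m
    proof -
      define H where "H x = h0 x * indicator (A m) x + g x * indicator (- K) x" for x
      define \<epsilon> where "\<epsilon> = 1 / real (Suc (m0 + m))"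
      have \<epsilon>: "0 < \<epsilon>" "\<epsilon> < \<delta>"
      proof -
        have "\<epsilon> \<le> 1 / real (Suc m0)" unfolding \<epsilon>_def by (intro divide_left_mono) auto
        then show "0 < \<epsilon>" "\<epsilon> < \<delta>" using m0 by (auto simp: \<epsilon>_def)
      qed
      have Hm: "H \<in> borel_measurable borel" unfolding H_def[abs_def] by measurable
      have "d \<le> (\<integral>\<^sup>+r\<in>{0..L}. H (arc_param c r) \<partial>lborel)"
        unfolding d_def
      proof (rule short_intervals_suffice[where f = "\<lambda>r. w (arc_param c r)", OF meas[OF Hm] _ \<epsilon>(1)])
        show "0 \<le> L" by (simp add: L_def)
        fix s t assume st: "0 \<le> s" "s \<le> t" "t \<le> L" "t - s < \<epsilon>"
        show "ennreal \<bar>w (arc_param c s) - w (arc_param c t)\<bar> \<le> (\<integral>\<^sup>+r\<in>{s..t}. H (arc_param c r) \<partial>lborel)"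
        proof (cases "\<exists>r0\<in>{s..t}. arc_param c r0 \<in> K")
          case True
          then obtain r0 where r0: "r0 \<in> {s..t}" "arc_param c r0 \<in> K" by auto
          have near: "dist (arc_param c r0) (arc_param c r) < \<epsilon>" if "r \<in> {s..t}" for r
          proof (cases "r0 \<le> r")
            case True
            then show ?thesis using arc_param_lipschitz[OF c(1), of r0 r] r0 that st by (auto simp: L_def)
          next
            case False
            then show ?thesis using arc_param_lipschitz[OF c(1), of r r0] r0 that st
              by (auto simp: L_def dist_commute)
          qed
          have inA: "arc_param c r \<in> A m" "arc_param c r \<in> \<Omega>" "w (arc_param c r) = u (arc_param c r)"
            if "r \<in> {s..t}" for r
            using near[OF that] r0(2) K(3)[OF r0(2), of "arc_param c r"] \<epsilon> unfolding A_def \<epsilon>_def by auto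
          have "ennreal \<bar>w (arc_param c s) - w (arc_param c t)\<bar> = ennreal \<bar>u (arc_param c s) - u (arc_param c t)\<bar>"
            using inA st by simp
          also have "\<dots> \<le> arc_integral h c s t"
          proof (rule ug_on_arcsD[OF arcs(1)])
            show "arc_param c ` {s..t} \<subseteq> \<Omega>" using inA by auto
          qed (use c(2) st in \<open>simp_all add: L_def\<close>)
          also have "\<dots> \<le> arc_integral H c s t"
            using inA by (intro arc_integral_mono) (auto simp: H_def h0_def)
          finally show ?thesis by (simp add: arc_integral_def)
        next
          case False
          have "ennreal \<bar>w (arc_param c s) - w (arc_param c t)\<bar> \<le> arc_integral g c s t"
            by (rule ug_on_arcsD[OF arcs(2)]) (use c(2) st in \<open>simp_all add: L_def\<close>)
          also have "\<dots> \<le> arc_integral H c s t"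
            using False by (intro arc_integral_mono) (auto simp: H_def indicator_def)
          finally show ?thesis by (simp add: arc_integral_def)
        qed
      qed
      also have "\<dots> = arc_integral H c 0 L" by (simp add: arc_integral_def)
      also have "\<dots> = a m + b"
        unfolding H_def[abs_def] a_def b_def
        using c by (intro arc_integral_add[of UNIV]) (auto simp: L_def)
      finally show ?thesis .
    qed
    have "d \<le> (INF m. a m + b)" using step by (intro INF_greatest)
    also have "\<dots> = (INF m. a m) + b" by (rule INF_ennreal_add_const)
    also have "(INF m. a m) = arc_integral (\<lambda>x. h0 x * indicator K x) c 0 L"
    proof -
      have "(INF m. a m) = (\<integral>\<^sup>+r. (INF m. h0 (arc_param c r) * indicator (A m) (arc_param c r) * indicator {0..L} r) \<partial>lborel)"
        unfolding a_def arc_integral_def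
      proof (rule nn_integral_monotone_convergence_INF_decseq[symmetric, where i = 0])
        show "decseq (\<lambda>m r. h0 (arc_param c r) * indicator (A m) (arc_param c r) * indicator {0..L} r)"
          using A_dec by (intro decseq_SucI) (auto simp: le_fun_def indicator_def)
        show "(\<lambda>r. h0 (arc_param c r) * indicator (A m) (arc_param c r) * indicator {0..L} r) \<in> borel_measurable lborel" for m
          using meas[of "\<lambda>x. h0 x * indicator (A m) x"] by simp
        have "arc_integral (\<lambda>x. h0 x * indicator (A 0) x) c 0 L \<le> line_integral h0 c"
          unfolding line_integral_eq L_def by (intro arc_integral_mono) (auto simp: indicator_def)
        also have "\<dots> < \<infinity>" using c by (auto simp: less_top)
        finally show "(\<integral>\<^sup>+r\<in>{0..L}. h0 (arc_param c r) * indicator (A 0) (arc_param c r) \<partial>lborel) < \<infinity>"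
          by (simp add: arc_integral_def)
      qed
      also have "\<dots> = arc_integral (\<lambda>x. h0 x * indicator K x) c 0 L"
        unfolding arc_integral_def
      proof (rule nn_integral_cong)
        fix r
        let ?F = "\<lambda>m. h0 (arc_param c r) * indicator (A m) (arc_param c r) * indicator {0..L} r"
        show "(INF m. ?F m) = h0 (arc_param c r) * indicator K (arc_param c r) * indicator {0..L} r"
        proof (cases "arc_param c r \<in> K")
          case True
          then have "?F m = h0 (arc_param c r) * indicator {0..L} r" for m using K_A by (auto simp: indicator_def)
          then show ?thesis using True by simp
        next
          case False
          then obtain m where "arc_param c r \<notin> A m" using A_Inf by blast
          then have "(INF m. ?F m) \<le> 0" by (intro INF_lower2[of m]) auto
          then show ?thesis using False by simp
        qed
      qed
      finally show ?thesis .
    qed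
    also have "arc_integral (\<lambda>x. h0 x * indicator K x) c 0 L + b = arc_integral k c 0 L"
      unfolding b_def k_eq[abs_def] using c by (intro arc_integral_add[of UNIV, symmetric]) (auto simp: L_def)
    finally show "ennreal \<bar>w (arc_param c 0) - w (arc_param c (total_length c))\<bar> \<le> arc_integral k c 0 (total_length c)"
      by (simp add: d_def L_def)
  qed
  then show ?thesis by (simp add: k_def[abs_def])
qed


section \<open>Cutting off\<close>

text \<open>Superlevel sets of an \<open>L\<^sup>p\<close> function have finite measure, so Borel regularity gives Borel
  sets of the same measure around them; from these a Borel majorant is assembled.\<close>

lemma Lp_borel_majorant:
  assumes S: "S \<in> sets borel" and u: "Lp_on p M S u"
  obtains V :: "'a \<Rightarrow> ennreal" where "V \<in> borel_measurable borel"
    "\<And>x. x \<in> S \<Longrightarrow> ennreal \<bar>u x\<bar> \<le> V x" "energy S V < \<infinity>"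
proof -
  have SM: "S \<in> sets M" using S sets_borel by auto
  define v where "v x = indicator S x * \<bar>u x\<bar>" for x
  have "u \<in> borel_measurable (restrict_space M S)" using u by (simp add: Lp_on_def)
  then have "(\<lambda>x. \<bar>u x\<bar>) \<in> borel_measurable (restrict_space M S)" by measurable
  then have vm [measurable]: "v \<in> borel_measurable M"
    using SM unfolding v_def[abs_def] by (subst (asm) borel_measurable_restrict_space_iff) (auto simp: space_M)
  have v_int: "(\<integral>\<^sup>+x. ennreal (v x powr p) \<partial>M) < \<infinity>"
  proof -
    have "(\<integral>\<^sup>+x. ennreal (v x powr p) \<partial>M) = (\<integral>\<^sup>+x\<in>S. ennreal (\<bar>u x\<bar> powr p) \<partial>M)"
      by (intro nn_integral_cong) (auto simp: v_def indicator_def)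
    then show ?thesis using u by (simp add: Lp_on_def)
  qed
  have "\<exists>B. B \<in> sets borel \<and> (0 < q \<longrightarrow> {x. q < v x} \<subseteq> B \<and> B - {x. q < v x} \<in> null_sets M)" for q :: real
  proof (cases "0 < q")
    case True
    define A where "A = {x. q < v x}"
    have AM: "A \<in> sets M"
    proof -
      have "{x \<in> space M. q < v x} \<in> sets M" by measurable
      then show ?thesis by (simp add: A_def space_M)
    qed
    obtain B where B: "B \<in> sets borel" "A \<subseteq> B" "emeasure M B = emeasure M A"
      using regular AM unfolding borel_regular_def by blast
    have BM: "B \<in> sets M" using B sets_borel by auto
    have "ennreal (q powr p) * emeasure M A = (\<integral>\<^sup>+x. ennreal (q powr p) * indicator A x \<partial>M)"
      using AM by (simp add: nn_integral_cmult_indicator)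
    also have "\<dots> \<le> (\<integral>\<^sup>+x. ennreal (v x powr p) \<partial>M)"
      using p_gt_1 True by (intro nn_integral_mono) (auto simp: A_def indicator_def intro!: ennreal_leI powr_mono2)
    also have "\<dots> < \<infinity>" by (rule v_int)
    finally have "emeasure M A < \<infinity>" using True by (auto simp: ennreal_mult_less_top)
    then have "emeasure M (B - A) = 0"
      using B AM BM by (subst emeasure_Diff) auto
    then have "B - A \<in> null_sets M" using AM BM by auto
    then show ?thesis using B by (auto simp: A_def)
  next
    case False
    then show ?thesis by (intro exI[of _ "{}"]) auto
  qed
  then obtain B :: "real \<Rightarrow> 'a set" where B: "\<And>q. B q \<in> sets borel"
    "\<And>q. 0 < q \<Longrightarrow> {x. q < v x} \<subseteq> B q" "\<And>q. 0 < q \<Longrightarrow> B q - {x. q < v x} \<in> null_sets M" by metis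
  (* The factor 2 gives V \<ge> v: every positive v x exceeds some rational q > v x / 2. *)
  define V where "V x = (SUP q::rat. ennreal (2 * of_rat q) * indicator (B (of_rat q)) x)" for x
  show thesis
  proof (rule that[of V])
    note [measurable] = B(1)
    show "V \<in> borel_measurable borel" unfolding V_def[abs_def] by measurable
    show "ennreal \<bar>u x\<bar> \<le> V x" if "x \<in> S" for x
    proof (cases "u x = 0")
      case False
      then have vx: "v x = \<bar>u x\<bar>" "0 < v x" using that by (auto simp: v_def)
      then obtain q :: rat where q: "v x / 2 < of_rat q" "of_rat q < v x"
        using of_rat_dense[of "v x / 2" "v x"] by auto
      then have "0 < (of_rat q :: real)" using vx by linarith
      then have "x \<in> B (of_rat q)" using B(2)[of "of_rat q"] q by auto
      then have "ennreal (v x) \<le> ennreal (2 * of_rat q) * indicator (B (of_rat q)) x"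
        using q by (auto intro!: ennreal_leI)
      also have "\<dots> \<le> V x" unfolding V_def by (rule SUP_upper) simp
      finally show ?thesis using vx by simp
    qed simp
    have "AE x in M. \<forall>q::rat. 0 < (of_rat q :: real) \<longrightarrow> x \<in> B (of_rat q) \<longrightarrow> of_rat q < v x"
      unfolding AE_all_countable
    proof
      fix q :: rat
      show "AE x in M. 0 < (of_rat q :: real) \<longrightarrow> x \<in> B (of_rat q) \<longrightarrow> of_rat q < v x"
      proof (cases "0 < (of_rat q :: real)")
        case True
        from AE_not_in[OF B(3)[OF True]] show ?thesis by eventually_elim auto
      qed simp
    qed
    then have "AE x in M. V x \<le> ennreal (2 * v x)"
    proof eventually_elim
      case (elim x)
      have "ennreal (2 * of_rat q) * indicator (B (of_rat q)) x \<le> ennreal (2 * v x)" for q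
        using elim by (cases "0 < (of_rat q :: real)")
          (auto simp: indicator_def ennreal_neg less_imp_le intro!: ennreal_leI)
      then show ?case unfolding V_def by (intro SUP_least)
    qed
    then have "energy S V \<le> (\<integral>\<^sup>+x. ennreal (2 powr p) * ennreal (v x powr p) \<partial>M)"
    proof (intro nn_integral_mono_AE, eventually_elim)
      case (elim x)
      have "0 \<le> v x" by (simp add: v_def)
      have "epowr (V x) p * indicator S x \<le> epowr (V x) p" by (simp add: indicator_def)
      also have "\<dots> \<le> epowr (ennreal (2 * v x)) p" using elim p_gt_1 by (intro epowr_mono) auto
      also have "\<dots> = ennreal (2 powr p) * ennreal (v x powr p)"
        using \<open>0 \<le> v x\<close> epowr_ennreal[of 2 p] by (simp add: epowr_ennreal epowr_mult ennreal_mult)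
      finally show ?case .
    qed
    also have "\<dots> = ennreal (2 powr p) * (\<integral>\<^sup>+x. ennreal (v x powr p) \<partial>M)" by (rule nn_integral_cmult) measurable
    also have "\<dots> < \<infinity>" using v_int by (simp add: ennreal_mult_less_top)
    finally show "energy S V < \<infinity>" .
  qed
qed

text \<open>On a short piece of a curve \<open>\<bar>u\<bar>\<close> exceeds its mean value by at most the integral of \<open>h\<close>. This
  gives the product rule with a crude constant, first for pieces of length at most \<open>1\<close> inside
  \<open>\<Omega>\<close>; the pieces where \<open>\<eta>\<close> vanishes are then skipped.\<close>

lemma newtonian_cutoff:
  assumes "open \<Omega>" and u: "newtonian p M \<Omega> u" and \<eta>: "lipschitz_cutoff \<Omega> \<eta>"
  shows "newtonian p M UNIV (\<lambda>x. \<eta> x * u x)"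
proof -
  have \<Omega>: "\<Omega> \<in> sets borel" using \<open>open \<Omega>\<close> by simp
  have \<Omega>M: "\<Omega> \<in> sets M" using \<Omega> sets_borel by auto
  obtain L where L: "L-lipschitz_on UNIV \<eta>" using \<eta> by (auto simp: lipschitz_cutoff_def is_lipschitz_def)
  have L0: "0 \<le> L" using L by (rule lipschitz_on_nonneg)
  have \<eta>_lip: "\<bar>\<eta> x - \<eta> y\<bar> \<le> L * dist x y" for x y using lipschitz_onD[OF L, of x y] by (simp add: dist_real_def)
  have \<eta>01: "0 \<le> \<eta> x" "\<eta> x \<le> 1" for x using \<eta> by (auto simp: lipschitz_cutoff_def)
  have supp: "closure {x. \<eta> x \<noteq> 0} \<subseteq> \<Omega>" using \<eta> by (simp add: lipschitz_cutoff_def)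
  have \<eta>_out: "\<eta> x = 0" if "x \<notin> \<Omega>" for x using that supp closure_subset[of "{x. \<eta> x \<noteq> 0}"] by auto
  have \<eta>_cont: "continuous_on UNIV \<eta>" using L by (rule lipschitz_on_continuous_on)
  obtain h where h: "weak_upper_gradient p M \<Omega> u h" "energy \<Omega> h < \<infinity>" and Lp: "Lp_on p M \<Omega> u"
    using u by (auto simp: newtonian_def)
  obtain V :: "'a \<Rightarrow> ennreal" where V [measurable]: "V \<in> borel_measurable borel"
    and V_ge: "\<And>x. x \<in> \<Omega> \<Longrightarrow> ennreal \<bar>u x\<bar> \<le> V x" and V_fin: "energy \<Omega> V < \<infinity>"
    using Lp_borel_majorant[OF \<Omega> Lp] by metis
  note hm [measurable] = weak_upper_gradient_measurable[OF h(1)]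
  define H where "H x = ennreal (1 + L) * h x + ennreal L * V x" for x
  have VS: "V \<in> borel_on \<Omega>" using V by (rule measurable_restrict_space1)
  note [measurable] = VS
  have Hm: "H \<in> borel_on \<Omega>" unfolding H_def[abs_def] by measurable
  define H0 where "H0 x = H x * indicator \<Omega> x" for x
  have H0m: "H0 \<in> borel_on UNIV"
    unfolding H0_def using zero_extension_borel[OF \<Omega> Hm] by simp
  define w where "w x = \<eta> x * u x" for x
  obtain \<Gamma> where \<Gamma>: "modulus p M UNIV \<Gamma> = 0"
    "\<And>c. rectifiable_curve UNIV c \<Longrightarrow> c \<notin> \<Gamma> \<Longrightarrow> ug_on_arcs \<Omega> u h c"
    using weak_upper_gradient_arcs[OF h(1) \<Omega>, of UNIV] by auto
  have "weak_upper_gradient p M UNIV w H0"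
  proof (rule weak_upper_gradientI[OF H0m \<Gamma>(1)])
    fix c assume c: "rectifiable_curve UNIV c" "c \<notin> \<Gamma>"
    define l where "l = total_length c"
    define \<sigma> where "\<sigma> = arc_param c"
    have H0_meas: "(\<lambda>r. H0 (\<sigma> r) * indicator {s..t} r) \<in> borel_measurable borel" if "0 \<le> s" "t \<le> l" for s t
      using measurable_along_curve[OF c(1) H0m] that by (simp add: \<sigma>_def l_def)
    have short: "ennreal \<bar>w (\<sigma> s) - w (\<sigma> t)\<bar> \<le> (\<integral>\<^sup>+r\<in>{s..t}. H0 (\<sigma> r) \<partial>lborel)"
      if st: "0 \<le> s" "s \<le> t" "t \<le> l" "t - s < 1" and inside: "\<sigma> ` {s..t} \<subseteq> \<Omega>" for s t
    proof -
      define A where "A = arc_integral h c s t"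
      define B where "B = arc_integral V c s t"
      have in_\<Omega>: "\<sigma> r \<in> \<Omega>" if "r \<in> {s..t}" for r using inside that by auto
      have uA: "ennreal \<bar>u (\<sigma> s) - u (\<sigma> t)\<bar> \<le> A"
        unfolding A_def \<sigma>_def by (rule ug_on_arcsD[OF \<Gamma>(2)[OF c]]) (use st inside in \<open>auto simp: l_def \<sigma>_def\<close>)
      have hM: "(\<lambda>r. h (\<sigma> r) * indicator {s..t} r) \<in> borel_measurable borel"
        unfolding \<sigma>_def by (rule measurable_arc_param[OF c(1) hm]) (use st in_\<Omega> in \<open>auto simp: l_def \<sigma>_def\<close>)
      have VM: "(\<lambda>r. V (\<sigma> r) * indicator {s..t} r) \<in> borel_measurable borel"
        unfolding \<sigma>_def using st V by (intro measurable_along_curve[OF c(1)]) (auto simp: l_def)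
      have "ennreal \<bar>u (\<sigma> t)\<bar> * ennreal (t - s) = (\<integral>\<^sup>+r\<in>{s..t}. ennreal \<bar>u (\<sigma> t)\<bar> \<partial>lborel)"
        using st by (simp add: nn_integral_cmult_indicator)
      also have "\<dots> \<le> (\<integral>\<^sup>+r. V (\<sigma> r) * indicator {s..t} r + A * indicator {s..t} r \<partial>lborel)"
      proof (rule nn_integral_mono)
        fix r
        show "ennreal \<bar>u (\<sigma> t)\<bar> * indicator {s..t} r \<le> V (\<sigma> r) * indicator {s..t} r + A * indicator {s..t} r"
        proof (cases "r \<in> {s..t}")
          case True
          have "ennreal \<bar>u (\<sigma> r) - u (\<sigma> t)\<bar> \<le> arc_integral h c r t"
            unfolding \<sigma>_def
            by (rule ug_on_arcsD[OF \<Gamma>(2)[OF c]]) (use st True in_\<Omega> in \<open>auto simp: l_def \<sigma>_def\<close>)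
          also have "\<dots> \<le> A" unfolding A_def using True by (intro arc_integral_subinterval) auto
          finally have "ennreal \<bar>u (\<sigma> r) - u (\<sigma> t)\<bar> \<le> A" .
          moreover have "ennreal \<bar>0 - u (\<sigma> r)\<bar> \<le> V (\<sigma> r)" using V_ge[OF in_\<Omega>[OF True]] by simp
          ultimately have "ennreal \<bar>0 - u (\<sigma> t)\<bar> \<le> V (\<sigma> r) + A" by (intro ennreal_abs_diff_triangle[where y = "u (\<sigma> r)"])
          then show ?thesis using True by simp
        qed simp
      qed
      also have "\<dots> = B + A * ennreal (t - s)"
        unfolding B_def arc_integral_def \<sigma>_def[symmetric] using st VM
        by (subst nn_integral_add) (auto simp: nn_integral_cmult_indicator)
      also have "\<dots> \<le> B + A * 1" using st by (intro add_left_mono mult_left_mono) (auto simp: ennreal_le_1)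
      (* the value of u at the end point is at most a mean value plus the oscillation; here both sides
         are multiplied by the length of the piece *)
      finally have mean: "ennreal \<bar>u (\<sigma> t)\<bar> * ennreal (t - s) \<le> B + A" by simp
      have "\<bar>w (\<sigma> s) - w (\<sigma> t)\<bar> \<le> \<bar>u (\<sigma> s) - u (\<sigma> t)\<bar> + L * (\<bar>u (\<sigma> t)\<bar> * (t - s))"
      proof -
        have "w (\<sigma> s) - w (\<sigma> t) = \<eta> (\<sigma> s) * (u (\<sigma> s) - u (\<sigma> t)) + u (\<sigma> t) * (\<eta> (\<sigma> s) - \<eta> (\<sigma> t))"
          by (simp add: w_def algebra_simps)
        then have "\<bar>w (\<sigma> s) - w (\<sigma> t)\<bar> \<le> \<bar>\<eta> (\<sigma> s)\<bar> * \<bar>u (\<sigma> s) - u (\<sigma> t)\<bar> + \<bar>u (\<sigma> t)\<bar> * \<bar>\<eta> (\<sigma> s) - \<eta> (\<sigma> t)\<bar>"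
          by (metis abs_mult abs_triangle_ineq)
        moreover have "\<bar>\<eta> (\<sigma> s)\<bar> * \<bar>u (\<sigma> s) - u (\<sigma> t)\<bar> \<le> 1 * \<bar>u (\<sigma> s) - u (\<sigma> t)\<bar>"
          using \<eta>01[of "\<sigma> s"] by (intro mult_right_mono) auto
        moreover have "\<bar>u (\<sigma> t)\<bar> * \<bar>\<eta> (\<sigma> s) - \<eta> (\<sigma> t)\<bar> \<le> \<bar>u (\<sigma> t)\<bar> * (L * (t - s))"
        proof (rule mult_left_mono)
          have "dist (\<sigma> s) (\<sigma> t) \<le> t - s" unfolding \<sigma>_def using st arc_param_lipschitz[OF c(1)] by (simp add: l_def)
          then show "\<bar>\<eta> (\<sigma> s) - \<eta> (\<sigma> t)\<bar> \<le> L * (t - s)" using \<eta>_lip[of "\<sigma> s" "\<sigma> t"] L0 mult_left_mono by fastforce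
        qed simp
        ultimately show ?thesis by (simp add: mult.left_commute)
      qed
      then have "ennreal \<bar>w (\<sigma> s) - w (\<sigma> t)\<bar> \<le> ennreal (\<bar>u (\<sigma> s) - u (\<sigma> t)\<bar> + L * (\<bar>u (\<sigma> t)\<bar> * (t - s)))"
        by (rule ennreal_leI)
      also have "\<dots> = ennreal \<bar>u (\<sigma> s) - u (\<sigma> t)\<bar> + ennreal L * (ennreal \<bar>u (\<sigma> t)\<bar> * ennreal (t - s))"
        using L0 st by (simp add: ennreal_mult)
      also have "\<dots> \<le> A + ennreal L * (B + A)" using uA mean by (intro add_mono mult_left_mono) auto
      also have "\<dots> = ennreal (1 + L) * A + ennreal L * B"
        using L0 by (simp add: distrib_left distrib_right add_ac)
      also have "\<dots> = (\<integral>\<^sup>+r. ennreal (1 + L) * (h (\<sigma> r) * indicator {s..t} r) + ennreal L * (V (\<sigma> r) * indicator {s..t} r) \<partial>lborel)"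
        unfolding A_def B_def arc_integral_def \<sigma>_def[symmetric] using hM VM
        by (subst nn_integral_add, simp, simp) (simp add: nn_integral_cmult)
      also have "\<dots> = (\<integral>\<^sup>+r\<in>{s..t}. H0 (\<sigma> r) \<partial>lborel)"
        using in_\<Omega> by (intro nn_integral_cong) (auto simp: H0_def H_def indicator_def)
      finally show ?thesis .
    qed
    have cont: "continuous_on {0..l} \<sigma>" unfolding \<sigma>_def l_def by (rule continuous_on_arc_param[OF c(1)])
    have "ennreal \<bar>w (\<sigma> 0) - w (\<sigma> l)\<bar> \<le> (\<integral>\<^sup>+r\<in>{0..l}. H0 (\<sigma> r) \<partial>lborel)"
    proof (rule first_last_visit[where f = "\<lambda>r. w (\<sigma> r)" and K = "\<eta> -` {0}" and \<sigma> = \<sigma>])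
      show "closed (\<eta> -` {0})" using \<eta>_cont by (intro closed_vimage) (auto simp: continuous_on_eq_continuous_at)
      fix a b assume ab: "0 \<le> a" "a \<le> b" "b \<le> l" and off: "\<And>r. r \<in> {a<..<b} \<Longrightarrow> \<sigma> r \<notin> \<eta> -` {0}"
      show "ennreal \<bar>w (\<sigma> a) - w (\<sigma> b)\<bar> \<le> (\<integral>\<^sup>+r\<in>{a..b}. H0 (\<sigma> r) \<partial>lborel)"
      proof (cases "a = b")
        case False
        have "\<sigma> ` {a..b} = \<sigma> ` closure {a<..<b}" using ab False by simp
        also have "\<dots> \<subseteq> closure (\<sigma> ` {a<..<b})"
          using ab False by (intro image_closure_subset continuous_on_subset[OF cont] closure_subset) (auto simp: closure_greaterThanLessThan)
        also have "\<dots> \<subseteq> closure {x. \<eta> x \<noteq> 0}" using off by (intro closure_mono) auto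
        finally have inside: "\<sigma> ` {a..b} \<subseteq> \<Omega>" using supp by blast
        show ?thesis
        proof (rule short_intervals_suffice[where f = "\<lambda>r. w (\<sigma> r)" and \<delta> = 1])
          show "(\<lambda>r. H0 (\<sigma> r) * indicator {a..b} r) \<in> borel_measurable borel" using ab by (intro H0_meas)
          fix s t assume "a \<le> s" "s \<le> t" "t \<le> b" "t - s < 1"
          moreover from this have "\<sigma> ` {s..t} \<subseteq> \<Omega>" using inside by auto
          ultimately show "ennreal \<bar>w (\<sigma> s) - w (\<sigma> t)\<bar> \<le> (\<integral>\<^sup>+r\<in>{s..t}. H0 (\<sigma> r) \<partial>lborel)"
            using ab by (intro short) auto
        qed (use ab in auto)
      qed simp
    qed (use cont H0_meas[of 0 l] in \<open>auto simp: w_def l_def\<close>)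
    then show "ennreal \<bar>w (arc_param c 0) - w (arc_param c (total_length c))\<bar> \<le> arc_integral H0 c 0 (total_length c)"
      by (simp add: arc_integral_def \<sigma>_def l_def)
  qed
  moreover have "energy UNIV H0 < \<infinity>"
  proof -
    have "energy UNIV H0 = energy \<Omega> H" by (intro nn_integral_cong) (auto simp: H0_def indicator_def)
    also have "\<dots> < \<infinity>" unfolding H_def
    proof (rule energy_add_finite[OF \<Omega>])
      show "energy \<Omega> (\<lambda>x. ennreal (1 + L) * h x) < \<infinity>" "energy \<Omega> (\<lambda>x. ennreal L * V x) < \<infinity>"
        using h(2) V_fin L0 epowr_ennreal[of "1 + L" p] epowr_ennreal[of L p]
        unfolding energy_cmult[OF \<Omega> hm] energy_cmult[OF \<Omega> VS]
        by (auto simp: ennreal_mult_less_top simp del: ennreal_plus)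
    qed measurable
    finally show ?thesis .
  qed
  moreover have "Lp_on p M UNIV w"
  proof -
    have "u \<in> borel_measurable (restrict_space M \<Omega>)" using Lp by (simp add: Lp_on_def)
    then have [measurable]: "(\<lambda>x. indicator \<Omega> x * u x) \<in> borel_measurable M"
      using \<Omega>M by (subst (asm) borel_measurable_restrict_space_iff) (auto simp: space_M)
    have [measurable]: "\<eta> \<in> borel_measurable M"
      using \<eta>_cont by (intro borel_imp_measurable borel_measurable_continuous_onI)
    have "w = (\<lambda>x. \<eta> x * (indicator \<Omega> x * u x))"
    proof (rule ext)
      fix x show "w x = \<eta> x * (indicator \<Omega> x * u x)"
        using \<eta>_out[of x] by (cases "x \<in> \<Omega>") (auto simp: w_def)
    qed
    then have "w \<in> borel_measurable M" by simp
    moreover have "(\<integral>\<^sup>+x\<in>UNIV. ennreal (\<bar>w x\<bar> powr p) \<partial>M) \<le> (\<integral>\<^sup>+x\<in>\<Omega>. ennreal (\<bar>u x\<bar> powr p) \<partial>M)"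
    proof (rule nn_integral_mono)
      fix x
      have "\<bar>w x\<bar> \<le> \<bar>u x\<bar>" using \<eta>01[of x] by (simp add: w_def abs_mult mult_left_le_one_le)
      then show "ennreal (\<bar>w x\<bar> powr p) * indicator UNIV x \<le> ennreal (\<bar>u x\<bar> powr p) * indicator \<Omega> x"
        using p_gt_1 \<eta>_out[of x] by (auto simp: indicator_def w_def intro!: ennreal_leI powr_mono2)
    qed
    ultimately show ?thesis using Lp by (auto simp: Lp_on_def intro: order_le_less_trans)
  qed
  ultimately show ?thesis unfolding newtonian_def w_def[abs_def] by blast
qed

text \<open>The Poincare inequality is about genuine upper gradients. The exceptional curves of a weak upper
  gradient are taken care of by adding a function of small energy with infinite integral along them.\<close>

lemma upper_gradient_of_small_energy:
  assumes g: "weak_upper_gradient p M UNIV u g" "energy UNIV g = 0" and "0 < e"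
  obtains h where "upper_gradient UNIV u h" "energy UNIV h \<le> ennreal e"
proof -
  let ?bad = "{c. rectifiable_curve UNIV c \<and> \<not> ug_ineq u g c}"
  have gm [measurable]: "g \<in> borel_measurable borel" using weak_upper_gradient_measurable[OF g(1)] by simp
  have zero: "modulus p M UNIV ?bad = 0" using g(1) by (simp add: weak_upper_gradient_def)
  obtain \<rho> where \<rho>: "\<rho> \<in> borel_on UNIV"
    "\<And>c. c \<in> ?bad \<Longrightarrow> line_integral \<rho> c = \<infinity>" "energy UNIV \<rho> \<le> ennreal e"
    by (rule modulus_zero_infinite_witness[OF _ zero _ \<open>0 < e\<close>]) auto
  have \<rho>m [measurable]: "\<rho> \<in> borel_measurable borel" using \<rho>(1) by simp
  define h where "h x = g x + \<rho> x" for x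
  show thesis
  proof (rule that[of h])
    have "ug_ineq u h c" if c: "rectifiable_curve UNIV c" for c
    proof (cases "ug_ineq u g c")
      case True
      have "arc_integral g c 0 (total_length c) \<le> arc_integral h c 0 (total_length c)"
        by (intro arc_integral_mono) (simp add: h_def)
      then show ?thesis using True unfolding ug_ineq_iff[OF c] by (rule order_trans[rotated])
    next
      case False
      then have "\<infinity> = line_integral \<rho> c" using \<rho>(2) c by simp
      also have "\<dots> \<le> line_integral h c" by (rule line_integral_mono[OF c]) (simp add: h_def)
      finally show ?thesis unfolding ug_ineq_iff[OF c] line_integral_eq by (simp add: top_unique)
    qed
    then show "upper_gradient UNIV u h"
      using gm \<rho>m by (simp add: upper_gradient_def h_def[abs_def])
    have "AE x in M. epowr (g x) p * indicator UNIV x = 0"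
      using g(2) energy_integrand_measurable[of UNIV g] by (simp add: nn_integral_0_iff_AE)
    then have "energy UNIV h = energy UNIV \<rho>"
      by (intro nn_integral_cong_AE, eventually_elim) (auto simp: h_def)
    then show "energy UNIV h \<le> ennreal e" using \<rho>(3) by simp
  qed
qed

end


section \<open>Compactness in complete doubling spaces\<close>

lemma doublingE:
  assumes "doubling M"
  obtains C :: real where "1 \<le> C" "\<And>x r. 0 < r \<Longrightarrow> 0 < emeasure M (ball x r)"
    "\<And>x r. 0 < r \<Longrightarrow> emeasure M (ball x r) < \<infinity>"
    "\<And>x r. 0 < r \<Longrightarrow> emeasure M (ball x (2 * r)) \<le> ennreal C * emeasure M (ball x r)"
proof -
  obtain C where C: "1 \<le> C" "\<And>x r. 0 < r \<Longrightarrow> 0 < emeasure M (ball x (2 * r))"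
    "\<And>x r. 0 < r \<Longrightarrow> emeasure M (ball x (2 * r)) \<le> ennreal C * emeasure M (ball x r)"
    "\<And>x r. 0 < r \<Longrightarrow> ennreal C * emeasure M (ball x r) < \<infinity>"
    using assms unfolding doubling_def by blast
  show thesis
  proof (rule that[OF C(1) _ _ C(3)])
    show "0 < emeasure M (ball x r)" if "0 < r" for x r using C(2)[of "r / 2" x] that by simp
    show "emeasure M (ball x r) < \<infinity>" if "0 < r" for x r
      using C(4)[OF that, of x] C(1) by (auto simp: ennreal_mult_less_top)
  qed
qed

text \<open>Disjoint balls of one size centred in a bounded set each carry a fixed fraction of the measure
  of a large ball, so there are boundedly many of them; a maximal separated set is then a finite net.\<close>

lemma doubling_bounded_net:
  fixes M :: "'a::metric_space measure" and S :: "'a set"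
  assumes doub: "doubling M" and sets: "sets borel \<subseteq> sets M" and S: "bounded S" and "0 < \<epsilon>"
  shows "\<exists>T. finite T \<and> S \<subseteq> (\<Union>x\<in>T. ball x \<epsilon>)"
proof -
  obtain C where C: "1 \<le> C" and pos: "\<And>x r. 0 < r \<Longrightarrow> 0 < emeasure M (ball x r)"
    and fin: "\<And>x r. 0 < r \<Longrightarrow> emeasure M (ball x r) < \<infinity>"
    and double: "\<And>x r. 0 < r \<Longrightarrow> emeasure M (ball x (2 * r)) \<le> ennreal C * emeasure M (ball x r)"
    using doublingE[OF doub] by blast
  have iter: "emeasure M (ball x (2 ^ m * r)) \<le> ennreal (C ^ m) * emeasure M (ball x r)" if "0 < r" for x r m
  proof (induction m)
    case (Suc m)
    have "emeasure M (ball x (2 ^ Suc m * r)) \<le> ennreal C * emeasure M (ball x (2 ^ m * r))"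
      using double[of "2 ^ m * r" x] that by (simp add: mult.assoc)
    also have "\<dots> \<le> ennreal C * (ennreal (C ^ m) * emeasure M (ball x r))" by (intro mult_left_mono Suc) auto
    also have "\<dots> = ennreal (C ^ Suc m) * emeasure M (ball x r)"
      using C by (simp add: ennreal_mult mult.assoc)
    finally show ?case .
  qed simp
  obtain x0 R where R: "0 < R" "S \<subseteq> ball x0 R" using bounded_subset_ballD[OF S] by blast
  obtain m :: nat where m: "2 * R + \<epsilon> < 2 ^ m * (\<epsilon> / 2)"
  proof -
    obtain m :: nat where "(2 * R + \<epsilon>) / (\<epsilon> / 2) < 2 ^ m" using real_arch_pow[of 2] by auto
    then show ?thesis using \<open>0 < \<epsilon>\<close> that[of m] by (simp add: field_simps)
  qed
  define B where "B = ball x0 (R + \<epsilon>)"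
  have "0 < emeasure M B" "emeasure M B < \<infinity>"
    using pos[of "R + \<epsilon>" x0] fin[of "R + \<epsilon>" x0] R(1) \<open>0 < \<epsilon>\<close> by (simp_all add: B_def)
  then obtain \<mu> where \<mu>: "emeasure M B = ennreal \<mu>" "0 < \<mu>"
    by (cases "emeasure M B") (auto simp: ennreal_less_zero_iff)
  define sep where "sep T \<longleftrightarrow> finite T \<and> T \<subseteq> S \<and> (\<forall>x\<in>T. \<forall>y\<in>T. x \<noteq> y \<longrightarrow> \<epsilon> \<le> dist x y)" for T
  have ballM: "ball x r \<in> sets M" for x r using sets by auto
  have card_le: "real (card T) \<le> C ^ m" if "sep T" for T
  proof -
    have T: "finite T" "T \<subseteq> S" "\<And>x y. x \<in> T \<Longrightarrow> y \<in> T \<Longrightarrow> x \<noteq> y \<Longrightarrow> \<epsilon> \<le> dist x y"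
      using that by (auto simp: sep_def)
    have disj: "disjoint_family_on (\<lambda>t. ball t (\<epsilon> / 2)) T"
    proof (clarsimp simp: disjoint_family_on_def)
      fix x y assume xy: "x \<in> T" "y \<in> T" "x \<noteq> y"
      show "ball x (\<epsilon> / 2) \<inter> ball y (\<epsilon> / 2) = {}"
      proof (rule ccontr)
        assume "ball x (\<epsilon> / 2) \<inter> ball y (\<epsilon> / 2) \<noteq> {}"
        then obtain z where "dist x z < \<epsilon> / 2" "dist y z < \<epsilon> / 2" by auto
        then show False using T(3)[OF xy] dist_triangle2[of x y z] by simp
      qed
    qed
    have each: "emeasure M B \<le> ennreal (C ^ m) * emeasure M (ball t (\<epsilon> / 2))" if "t \<in> T" for t
    proof -
      have t: "dist x0 t < R" using that T(2) R(2) by auto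
      have "B \<subseteq> ball t (2 ^ m * (\<epsilon> / 2))"
      proof
        fix y assume "y \<in> B"
        then have "dist x0 y < R + \<epsilon>" by (simp add: B_def)
        then show "y \<in> ball t (2 ^ m * (\<epsilon> / 2))" using t m dist_triangle3[of t y x0] by simp
      qed
      then have "emeasure M B \<le> emeasure M (ball t (2 ^ m * (\<epsilon> / 2)))" by (intro emeasure_mono ballM)
      also have "\<dots> \<le> ennreal (C ^ m) * emeasure M (ball t (\<epsilon> / 2))" using \<open>0 < \<epsilon>\<close> by (intro iter) simp
      finally show ?thesis .
    qed
    have "of_nat (card T) * emeasure M B \<le> (\<Sum>t\<in>T. ennreal (C ^ m) * emeasure M (ball t (\<epsilon> / 2)))"
      using sum_mono[of T "\<lambda>_. emeasure M B", OF each] by simp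
    also have "\<dots> = ennreal (C ^ m) * emeasure M (\<Union>t\<in>T. ball t (\<epsilon> / 2))"
      using disj T(1) ballM by (subst sum_emeasure[symmetric]) (auto simp: sum_distrib_left)
    also have "\<dots> \<le> ennreal (C ^ m) * emeasure M B"
    proof (intro mult_left_mono emeasure_mono)
      show "(\<Union>t\<in>T. ball t (\<epsilon> / 2)) \<subseteq> B"
      proof
        fix y assume "y \<in> (\<Union>t\<in>T. ball t (\<epsilon> / 2))"
        then obtain t where t: "t \<in> T" "dist t y < \<epsilon> / 2" by auto
        then have "dist x0 t < R" using T(2) R(2) by auto
        then show "y \<in> B" using t(2) dist_triangle[of x0 y t] \<open>0 < \<epsilon>\<close> by (simp add: B_def)
      qed
    qed (auto simp: B_def ballM)
    finally have "ennreal (real (card T) * \<mu>) \<le> ennreal (C ^ m * \<mu>)"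
      using \<mu> C by (simp add: ennreal_mult ennreal_of_nat_eq_real_of_nat)
    then have "real (card T) * \<mu> \<le> C ^ m * \<mu>" using \<mu>(2) C by (subst (asm) ennreal_le_iff) auto
    then show ?thesis using \<mu>(2) by simp
  qed
  obtain N :: nat where N: "C ^ m < real N" using reals_Archimedean2 by blast
  have "\<exists>T. sep T \<and> (\<forall>T'. sep T' \<longrightarrow> card T' \<le> card T)"
  proof (rule ex_has_greatest_nat[where b = N])
    show "sep {}" by (simp add: sep_def)
    show "\<forall>T. sep T \<longrightarrow> card T < N"
    proof (intro allI impI)
      fix T assume "sep T"
      then have "real (card T) < real N" using card_le[of T] N by linarith
      then show "card T < N" by simp
    qed
  qed
  then obtain T where T: "sep T" "\<And>T'. sep T' \<Longrightarrow> card T' \<le> card T" by blast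
  have "S \<subseteq> (\<Union>x\<in>T. ball x \<epsilon>)"
  proof
    fix x assume x: "x \<in> S"
    show "x \<in> (\<Union>x\<in>T. ball x \<epsilon>)"
    proof (rule ccontr)
      assume "x \<notin> (\<Union>x\<in>T. ball x \<epsilon>)"
      then have far: "\<epsilon> \<le> dist y x" if "y \<in> T" for y using that by (auto simp: not_less)
      then have "x \<notin> T" using \<open>0 < \<epsilon>\<close> by fastforce
      moreover have "sep (insert x T)" using T(1) x far unfolding sep_def by (auto simp: dist_commute)
      ultimately show False using T(2)[of "insert x T"] T(1) by (auto simp: sep_def)
    qed
  qed
  then show ?thesis using T(1) by (auto simp: sep_def)
qed

lemma doubling_bounded_closed_compact:
  fixes M :: "'a::complete_space measure" and S :: "'a set"
  assumes "doubling M" "sets borel \<subseteq> sets M" "bounded S" "closed S"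
  shows "compact S"
  unfolding compact_eq_totally_bounded
  using doubling_bounded_net[OF assms(1-3)] assms(4) by (auto simp: complete_eq_closed)


section \<open>An exhausting sequence of cutoffs\<close>

text \<open>The cutoff vanishes at distance at most \<open>1/(k+1)\<close> from the complement of \<open>\<Omega>\<close> and is \<open>1\<close> from distance
  \<open>2/(k+1)\<close> on. The core starts at distance \<open>3/(k+1)\<close>, so that the cutoff is \<open>1\<close> in a whole
  \<open>1/(k+1)\<close>-neighbourhood of the core.\<close>

definition core :: "'a::metric_space set \<Rightarrow> nat \<Rightarrow> 'a set" where
  "core \<Omega> k = {x. 3 / real (Suc k) \<le> infdist x (- \<Omega>)}"

definition cutoff :: "'a::metric_space set \<Rightarrow> nat \<Rightarrow> 'a \<Rightarrow> real" where
  "cutoff \<Omega> k x = min 1 (max 0 (real (Suc k) * infdist x (- \<Omega>) - 1))"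

lemma closed_core: "closed (core \<Omega> k)"
  unfolding core_def by (intro closed_Collect_le continuous_intros)

lemma core_subset: "core \<Omega> k \<subseteq> \<Omega>"
proof
  fix x assume "x \<in> core \<Omega> k"
  then have "0 < infdist x (- \<Omega>)" unfolding core_def by (auto intro: less_le_trans[rotated])
  then show "x \<in> \<Omega>" using infdist_zero[of x "- \<Omega>"] by (cases "x \<in> \<Omega>") auto
qed

lemma core_mono: "core \<Omega> k \<subseteq> core \<Omega> (Suc k)"
proof
  fix x assume "x \<in> core \<Omega> k"
  moreover have "3 / real (Suc (Suc k)) \<le> 3 / real (Suc k)" by (intro divide_left_mono) auto
  ultimately show "x \<in> core \<Omega> (Suc k)" unfolding core_def by simp
qed

lemma UN_core:
  assumes "open \<Omega>" "\<Omega> \<noteq> UNIV" "x \<in> \<Omega>"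
  shows "\<exists>k. x \<in> core \<Omega> k"
proof -
  have "0 < infdist x (- \<Omega>)"
    using in_closed_iff_infdist_zero[of "- \<Omega>" x] assms infdist_nonneg[of x "- \<Omega>"] by (auto simp: less_le)
  then obtain k :: nat where "1 / real (Suc k) < infdist x (- \<Omega>) / 3"
    using nat_approx_posE[of "infdist x (- \<Omega>) / 3"] by auto
  then show ?thesis unfolding core_def by (intro exI[of _ k]) (simp add: field_simps)
qed

lemma cutoff_near_core:
  assumes "x \<in> core \<Omega> k" "dist x y < 1 / real (Suc k)"
  shows "y \<in> \<Omega>" "cutoff \<Omega> k y = 1"
proof -
  define N where "N = real (Suc k)"
  have N: "0 < N" by (simp add: N_def)
  have "3 / N < infdist y (- \<Omega>) + 1 / N"
    using assms infdist_triangle[of x "- \<Omega>" y] unfolding core_def N_def by simp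
  then have gt: "2 < N * infdist y (- \<Omega>)" using N by (simp add: field_simps)
  then show "cutoff \<Omega> k y = 1" by (simp add: cutoff_def N_def)
  have "0 < infdist y (- \<Omega>)" using gt N zero_less_mult_pos[of N] by (smt (verit))
  then show "y \<in> \<Omega>" using infdist_zero[of y "- \<Omega>"] by (cases "y \<in> \<Omega>") auto
qed

lemma cutoff_core: "x \<in> core \<Omega> k \<Longrightarrow> cutoff \<Omega> k x = 1"
  using cutoff_near_core(2)[of x \<Omega> k x] by simp

lemma lipschitz_cutoff_cutoff:
  fixes M :: "'a::complete_space measure" and \<Omega> :: "'a set"
  assumes "doubling M" "sets borel \<subseteq> sets M" "bounded \<Omega>"
  shows "lipschitz_cutoff \<Omega> (cutoff \<Omega> k)"
  unfolding lipschitz_cutoff_def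
proof (intro conjI allI)
  have "(real (Suc k))-lipschitz_on UNIV (cutoff \<Omega> k)"
  proof (rule lipschitz_onI)
    fix x y :: 'a
    have "\<bar>cutoff \<Omega> k x - cutoff \<Omega> k y\<bar> \<le> \<bar>real (Suc k) * infdist x (- \<Omega>) - real (Suc k) * infdist y (- \<Omega>)\<bar>"
      unfolding cutoff_def by linarith
    also have "\<dots> = real (Suc k) * \<bar>infdist x (- \<Omega>) - infdist y (- \<Omega>)\<bar>"
      unfolding right_diff_distrib[symmetric] abs_mult by simp
    also have "\<dots> \<le> real (Suc k) * dist x y" by (intro mult_left_mono infdist_triangle_abs) simp
    finally show "dist (cutoff \<Omega> k x) (cutoff \<Omega> k y) \<le> real (Suc k) * dist x y" by (simp only: dist_real_def)
  qed simp
  then show "is_lipschitz (cutoff \<Omega> k)" by (auto simp: is_lipschitz_def)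
  have "{x. cutoff \<Omega> k x \<noteq> 0} \<subseteq> {x. 1 / real (Suc k) \<le> infdist x (- \<Omega>)}" (is "_ \<subseteq> ?F")
    by (auto simp: cutoff_def max_def min_def field_simps split: if_splits)
  moreover have "closed ?F" by (intro closed_Collect_le continuous_intros)
  ultimately have sub: "closure {x. cutoff \<Omega> k x \<noteq> 0} \<subseteq> ?F" by (rule closure_minimal)
  have F\<Omega>: "?F \<subseteq> \<Omega>"
  proof
    fix x assume "x \<in> ?F"
    then have "0 < infdist x (- \<Omega>)" by (auto intro: less_le_trans[rotated])
    then show "x \<in> \<Omega>" using infdist_zero[of x "- \<Omega>"] by (cases "x \<in> \<Omega>") auto
  qed
  then show in_\<Omega>: "closure {x. cutoff \<Omega> k x \<noteq> 0} \<subseteq> \<Omega>" using sub by blast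
  show "compact (closure {x. cutoff \<Omega> k x \<noteq> 0})"
    using assms in_\<Omega> by (intro doubling_bounded_closed_compact[of M]) (auto intro: bounded_subset)
qed (auto simp: cutoff_def)

lemma lipschitz_cutoff_outside:
  assumes "lipschitz_cutoff \<Omega> \<eta>" "x \<notin> \<Omega>" shows "\<eta> x = 0"
  using assms closure_subset[of "{x. \<eta> x \<noteq> 0}"] by (auto simp: lipschitz_cutoff_def)

lemma lipschitz_cutoff_continuous:
  assumes "lipschitz_cutoff \<Omega> \<eta>" shows "continuous_on UNIV \<eta>"
  using assms by (auto simp: lipschitz_cutoff_def is_lipschitz_def intro: lipschitz_on_continuous_on)


section \<open>The Cheeger gradient on an open set\<close>

lemma inner_product_expansion:
  fixes b :: "real ^ 'n \<Rightarrow> real ^ 'n \<Rightarrow> real"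
  assumes "bilinear b"
  shows "b v w = (\<Sum>(i, j)\<in>UNIV \<times> UNIV. v $ i * w $ j * b (axis i 1) (axis j 1))"
proof -
  have "b v w = b (\<Sum>i\<in>UNIV. (v $ i) *\<^sub>R axis i 1) (\<Sum>j\<in>UNIV. (w $ j) *\<^sub>R axis j 1)"
    using basis_expansion[of v] basis_expansion[of w] by (simp add: scalar_mult_eq_scaleR)
  then show ?thesis
    using assms by (simp add: bilinear_sum[OF assms] bilinear_lmul bilinear_rmul split_def mult.assoc)
qed

lemma inner_product_zero_iff:
  assumes "inner_product b" shows "b v v = 0 \<longleftrightarrow> v = 0" "0 \<le> b v v"
proof -
  have "b 0 0 = 0" using assms bilinear_lzero by (auto simp: inner_product_def)
  then show "b v v = 0 \<longleftrightarrow> v = 0" "0 \<le> b v v"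
    using assms by (cases "v = 0"; auto simp: inner_product_def less_imp_le dest: less_imp_neq)+
qed

locale cheeger_space = metric_measure M p for M :: "'a::complete_space measure" and p :: real +
  fixes I :: "nat set" and U :: "nat \<Rightarrow> 'a set"
    and D :: "nat \<Rightarrow> ('a \<Rightarrow> real) \<Rightarrow> 'a \<Rightarrow> real ^ 'n::finite"
    and ip :: "'a \<Rightarrow> real ^ 'n \<Rightarrow> real ^ 'n \<Rightarrow> real"
    and nabla :: "('a \<Rightarrow> real) \<Rightarrow> 'a \<Rightarrow> real ^ 'n"
  assumes doubling: "doubling M" and gradient: "cheeger_gradient p M I U D ip nabla"
begin

lemma ip_inner_product: "AE x in M. inner_product (ip x)"
  using gradient by (simp add: cheeger_gradient_def)

lemma ip_measurable [measurable]: "(\<lambda>x. ip x v w) \<in> borel_measurable M"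
  using gradient by (simp add: cheeger_gradient_def)

lemma nabla_measurable: "newtonian p M UNIV u \<Longrightarrow> nabla u \<in> borel_measurable M"
  using gradient by (simp add: cheeger_gradient_def)

lemma nabla_lincomb:
  assumes "newtonian p M UNIV u" "newtonian p M UNIV v"
  shows "AE x in M. nabla (\<lambda>y. a * u y + b * v y) x = a *\<^sub>R nabla u x + b *\<^sub>R nabla v x"
  using gradient assms by (simp add: cheeger_gradient_def)

abbreviation gnorm :: "'a \<Rightarrow> real ^ 'n \<Rightarrow> real" where
  "gnorm x v \<equiv> sqrt (ip x v v)"

lemma nabla_bounds:
  assumes "newtonian p M UNIV u"
  shows "AE x in M. ennreal (gnorm x (nabla u x)) \<le> min_weak_ug p M UNIV u x"
    and "AE x in M. min_weak_ug p M UNIV u x \<le> ennreal (sqrt (real CARD('n)) * gnorm x (nabla u x))"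
  using gradient assms by (auto simp: cheeger_gradient_def)

lemma measurable_AE_eq:
  fixes f g :: "'a \<Rightarrow> 'b::topological_space"
  assumes "f \<in> borel_measurable M" and eq: "AE x in M. f x = g x"
  shows "g \<in> borel_measurable M"
proof (rule measurableI)
  fix A :: "'b set" assume "A \<in> sets borel"
  then have "f -` A \<inter> space M \<in> sets M" using assms(1) by (rule measurable_sets[rotated])
  then show "g -` A \<inter> space M \<in> sets M"
    by (rule in_sets_AE[rotated]) (use eq in \<open>auto simp: space_M elim: eventually_mono\<close>)
qed simp

text \<open>The inner products are bilinear only almost everywhere; by completeness of the measure this is enough
  to reduce to the measurability of their coefficients.\<close>

lemma measurable_ip:
  assumes [measurable]: "F \<in> borel_measurable M" "G \<in> borel_measurable M"
  shows "(\<lambda>x. ip x (F x) (G x)) \<in> borel_measurable M"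
proof (rule measurable_AE_eq)
  have [measurable]: "(\<lambda>x. F x $ i) \<in> borel_measurable M" "(\<lambda>x. G x $ i) \<in> borel_measurable M" for i
    using borel_measurable_continuous_onI[of "\<lambda>v :: real ^ 'n. v $ i"]
    by (auto intro!: measurable_compose[OF assms(1)] measurable_compose[OF assms(2)] continuous_intros)
  show "(\<lambda>x. \<Sum>(i, j)\<in>UNIV \<times> UNIV. F x $ i * G x $ j * ip x (axis i 1) (axis j 1)) \<in> borel_measurable M"
    unfolding split_def by (intro borel_measurable_sum) measurable
  show "AE x in M. (\<Sum>(i, j)\<in>UNIV \<times> UNIV. F x $ i * G x $ j * ip x (axis i 1) (axis j 1)) = ip x (F x) (G x)"
    using ip_inner_product
  proof eventually_elim
    case (elim x)
    then have "bilinear (ip x)" by (simp add: inner_product_def)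
    from inner_product_expansion[OF this, of "F x" "G x"] show ?case by simp
  qed
qed

text \<open>Locality of the gradient is inherited from that of the minimal weak upper gradient through the
  comparison of the two.\<close>

lemma nabla_zero_on:
  assumes w: "newtonian p M UNIV w" and K: "closed K" "\<And>x. x \<in> K \<Longrightarrow> w x = 0"
  shows "AE x in M. x \<in> K \<longrightarrow> nabla w x = 0"
proof -
  have "AE x in M. x \<in> K \<longrightarrow> min_weak_ug p M UNIV w x = 0" using w K by (rule min_weak_ug_zero_on)
  with nabla_bounds(1)[OF w] ip_inner_product show ?thesis
  proof eventually_elim
    case (elim x)
    show ?case
    proof
      assume "x \<in> K"
      then have "gnorm x (nabla w x) \<le> 0" using elim by (simp add: ennreal_eq_0_iff)
      then have "ip x (nabla w x) (nabla w x) = 0" using inner_product_zero_iff(2)[OF elim(2), of "nabla w x"] by simp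
      then show "nabla w x = 0" using inner_product_zero_iff(1)[OF elim(2)] by simp
    qed
  qed
qed

lemma nabla_eq_on:
  assumes u: "newtonian p M UNIV u" and v: "newtonian p M UNIV v"
    and K: "closed K" "\<And>x. x \<in> K \<Longrightarrow> u x = v x"
  shows "AE x in M. x \<in> K \<longrightarrow> nabla u x = nabla v x"
proof -
  have "newtonian p M UNIV (\<lambda>x. 1 * u x + (- 1) * v x)" by (rule newtonian_lincomb[OF _ u v]) simp
  from this K(1) have "AE x in M. x \<in> K \<longrightarrow> nabla (\<lambda>x. 1 * u x + (- 1) * v x) x = 0"
    by (rule nabla_zero_on) (use K(2) in auto)
  then show ?thesis using nabla_lincomb[OF u v, of 1 "- 1"] by eventually_elim auto
qed

end

locale cheeger_domain = cheeger_space M p I U D ip nabla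
  for M :: "'a::complete_space measure" and p :: real and I :: "nat set" and U :: "nat \<Rightarrow> 'a set"
    and D :: "nat \<Rightarrow> ('a \<Rightarrow> real) \<Rightarrow> 'a \<Rightarrow> real ^ 'n::finite"
    and ip :: "'a \<Rightarrow> real ^ 'n \<Rightarrow> real ^ 'n \<Rightarrow> real"
    and nabla :: "('a \<Rightarrow> real) \<Rightarrow> 'a \<Rightarrow> real ^ 'n" +
  fixes \<Omega> :: "'a set"
  assumes open_domain: "open \<Omega>" and bounded_domain: "bounded \<Omega>" and proper_domain: "\<Omega> \<noteq> UNIV"
begin

lemma domain_sets: "\<Omega> \<in> sets borel" "\<Omega> \<in> sets M"
  using open_domain sets_borel by auto

lemma cutoff: "lipschitz_cutoff \<Omega> (cutoff \<Omega> k)"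
  using doubling sets_borel bounded_domain by (rule lipschitz_cutoff_cutoff)

lemma newtonian_cut: "newtonian p M \<Omega> u \<Longrightarrow> lipschitz_cutoff \<Omega> \<eta> \<Longrightarrow> newtonian p M UNIV (\<lambda>x. \<eta> x * u x)"
  using open_domain by (rule newtonian_cutoff)

text \<open>At each point the first cutoff of the exhaustion that equals \<open>1\<close> there is used. By locality, any other
  cutoff that equals \<open>1\<close> at the point gives the same value almost everywhere.\<close>

lemma gradient_on_exists:
  assumes u: "newtonian p M \<Omega> u"
  shows "\<exists>G. is_gradient_on M nabla \<Omega> u G"
proof -
  define k where "k x = (LEAST k. cutoff \<Omega> k x = 1)" for x
  define G where "G x = nabla (\<lambda>y. cutoff \<Omega> (k x) y * u y) x" for x
  have [measurable]: "cutoff \<Omega> i \<in> borel_measurable M" for i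
    by (intro borel_imp_measurable borel_measurable_continuous_onI lipschitz_cutoff_continuous[OF cutoff])
  have "k \<in> measurable M (count_space UNIV)" unfolding k_def[abs_def] by measurable
  moreover have "nabla (\<lambda>y. cutoff \<Omega> i y * u y) \<in> borel_measurable M" for i
    by (intro nabla_measurable newtonian_cut[OF u cutoff])
  ultimately have "G \<in> borel_measurable M"
    unfolding G_def[abs_def] by (rule measurable_compose_countable[rotated])
  then have "G \<in> borel_measurable (restrict_space M \<Omega>)" by (rule measurable_restrict_space1)
  moreover have "AE x in M. \<eta> x = 1 \<longrightarrow> G x = nabla (\<lambda>y. \<eta> y * u y) x" if \<eta>: "lipschitz_cutoff \<Omega> \<eta>" for \<eta>
  proof -
    have "AE x in M. x \<in> cutoff \<Omega> i -` {1} \<inter> \<eta> -` {1} \<longrightarrow>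
        nabla (\<lambda>y. cutoff \<Omega> i y * u y) x = nabla (\<lambda>y. \<eta> y * u y) x" for i
    proof (rule nabla_eq_on[OF newtonian_cut[OF u cutoff] newtonian_cut[OF u \<eta>]])
      show "closed (cutoff \<Omega> i -` {1} \<inter> \<eta> -` {1})"
        using lipschitz_cutoff_continuous[OF cutoff[of i]] lipschitz_cutoff_continuous[OF \<eta>]
        by (intro closed_Int closed_vimage) (auto simp: continuous_on_eq_continuous_at)
    qed auto
    then have "AE x in M. \<forall>i. x \<in> cutoff \<Omega> i -` {1} \<inter> \<eta> -` {1} \<longrightarrow>
        nabla (\<lambda>y. cutoff \<Omega> i y * u y) x = nabla (\<lambda>y. \<eta> y * u y) x"
      by (simp add: AE_all_countable)
    then show ?thesis
    proof eventually_elim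
      case (elim x)
      show ?case
      proof
        assume one: "\<eta> x = 1"
        then have "x \<in> \<Omega>" using lipschitz_cutoff_outside[OF \<eta>] by force
        then obtain i where "cutoff \<Omega> i x = 1" using UN_core[OF open_domain proper_domain] cutoff_core by blast
        then have "cutoff \<Omega> (k x) x = 1" unfolding k_def by (rule LeastI)
        then show "G x = nabla (\<lambda>y. \<eta> y * u y) x" using elim one by (simp add: G_def)
      qed
    qed
  qed
  ultimately show ?thesis unfolding is_gradient_on_def by blast
qed

lemma gradient_on:
  assumes "newtonian p M \<Omega> u"
  shows "is_gradient_on M nabla \<Omega> u (gradient_on M nabla \<Omega> u)"
  unfolding gradient_on_def using gradient_on_exists[OF assms] by (rule someI_ex)

lemma is_gradient_on_unique:
  assumes "is_gradient_on M nabla \<Omega> u G" "is_gradient_on M nabla \<Omega> u G'"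
  shows "AE x in M. x \<in> \<Omega> \<longrightarrow> G x = G' x"
proof -
  have "AE x in M. \<forall>k. cutoff \<Omega> k x = 1 \<longrightarrow> G x = G' x"
    unfolding AE_all_countable
  proof
    fix k
    have "AE x in M. cutoff \<Omega> k x = 1 \<longrightarrow> G x = nabla (\<lambda>y. cutoff \<Omega> k y * u y) x"
      "AE x in M. cutoff \<Omega> k x = 1 \<longrightarrow> G' x = nabla (\<lambda>y. cutoff \<Omega> k y * u y) x"
      using assms cutoff[of k] by (auto simp: is_gradient_on_def)
    then show "AE x in M. cutoff \<Omega> k x = 1 \<longrightarrow> G x = G' x" by eventually_elim auto
  qed
  then show ?thesis
    by eventually_elim (use UN_core[OF open_domain proper_domain] cutoff_core in blast)
qed

lemma is_gradient_on_restriction: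
  assumes w: "newtonian p M UNIV w" and eq: "\<And>x. x \<in> \<Omega> \<Longrightarrow> w x = \<phi> x"
  shows "is_gradient_on M nabla \<Omega> \<phi> (nabla w)"
  unfolding is_gradient_on_def
proof (intro conjI allI impI)
  show "nabla w \<in> borel_measurable (restrict_space M \<Omega>)"
    using nabla_measurable[OF w] by (rule measurable_restrict_space1)
  fix \<eta> assume \<eta>: "lipschitz_cutoff \<Omega> \<eta>"
  have same: "(\<lambda>y. \<eta> y * w y) = (\<lambda>y. \<eta> y * \<phi> y)"
  proof (rule ext)
    fix y show "\<eta> y * w y = \<eta> y * \<phi> y" using eq[of y] lipschitz_cutoff_outside[OF \<eta>, of y] by (cases "y \<in> \<Omega>") auto
  qed
  have "newtonian p M \<Omega> w" by (rule newtonian_restrict[OF w domain_sets(1)]) simp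
  then have "newtonian p M UNIV (\<lambda>y. \<eta> y * w y)" using \<eta> by (rule newtonian_cut)
  from nabla_eq_on[OF w this, of "\<eta> -` {1}"]
  have "AE x in M. x \<in> \<eta> -` {1} \<longrightarrow> nabla w x = nabla (\<lambda>y. \<eta> y * w y) x"
    using lipschitz_cutoff_continuous[OF \<eta>] by (simp add: closed_vimage continuous_on_eq_continuous_at)
  then show "AE x in M. \<eta> x = 1 \<longrightarrow> nabla w x = nabla (\<lambda>y. \<eta> y * \<phi> y) x" by (simp add: same)
qed

lemma is_gradient_on_diff:
  assumes u: "newtonian p M \<Omega> u" and v: "newtonian p M \<Omega> v"
    and G: "is_gradient_on M nabla \<Omega> u G" and H: "is_gradient_on M nabla \<Omega> v H"
  shows "is_gradient_on M nabla \<Omega> (\<lambda>x. u x - v x) (\<lambda>x. G x - H x)"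
  unfolding is_gradient_on_def
proof (intro conjI allI impI)
  show "(\<lambda>x. G x - H x) \<in> borel_measurable (restrict_space M \<Omega>)"
    using G H by (intro borel_measurable_diff) (auto simp: is_gradient_on_def)
  fix \<eta> assume \<eta>: "lipschitz_cutoff \<Omega> \<eta>"
  have "AE x in M. \<eta> x = 1 \<longrightarrow> G x = nabla (\<lambda>y. \<eta> y * u y) x"
    "AE x in M. \<eta> x = 1 \<longrightarrow> H x = nabla (\<lambda>y. \<eta> y * v y) x"
    using G H \<eta> by (auto simp: is_gradient_on_def)
  moreover have "AE x in M. nabla (\<lambda>y. 1 * (\<eta> y * u y) + (- 1) * (\<eta> y * v y)) x
      = 1 *\<^sub>R nabla (\<lambda>y. \<eta> y * u y) x + (- 1) *\<^sub>R nabla (\<lambda>y. \<eta> y * v y) x"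
    by (intro nabla_lincomb newtonian_cut u v \<eta>)
  moreover have eq: "(\<lambda>y. 1 * (\<eta> y * u y) + (- 1) * (\<eta> y * v y)) = (\<lambda>y. \<eta> y * (u y - v y))"
    by (auto simp: algebra_simps)
  ultimately have "AE x in M. \<eta> x = 1 \<longrightarrow> G x = nabla (\<lambda>y. \<eta> y * u y) x"
    "AE x in M. \<eta> x = 1 \<longrightarrow> H x = nabla (\<lambda>y. \<eta> y * v y) x"
    "AE x in M. nabla (\<lambda>y. \<eta> y * (u y - v y)) x
      = 1 *\<^sub>R nabla (\<lambda>y. \<eta> y * u y) x + (- 1) *\<^sub>R nabla (\<lambda>y. \<eta> y * v y) x"
    unfolding eq by blast+
  then show "AE x in M. \<eta> x = 1 \<longrightarrow> G x - H x = nabla (\<lambda>y. \<eta> y * (u y - v y)) x"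
    by eventually_elim auto
qed

text \<open>On each set of the exhaustion the gradient is that of a cut-off function, whose minimal weak upper
  gradient has there at most the energy of an upper gradient of \<open>u\<close>; this bound does not involve
  the cutoff.\<close>

lemma gradient_on_Lp:
  assumes u: "newtonian p M \<Omega> u" and G: "is_gradient_on M nabla \<Omega> u G"
  shows "(\<integral>\<^sup>+x\<in>\<Omega>. ennreal (gnorm x (G x) powr p) \<partial>M) < \<infinity>"
proof -
  obtain h where h: "weak_upper_gradient p M \<Omega> u h" "energy \<Omega> h < \<infinity>"
    using u by (auto simp: newtonian_def)
  define F where "F x = (if x \<in> \<Omega> then G x else 0)" for x
  have Fm [measurable]: "F \<in> borel_measurable M"
  proof -
    have "(\<lambda>x. indicator \<Omega> x *\<^sub>R G x) \<in> borel_measurable M"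
      using G domain_sets by (subst borel_measurable_restrict_space_iff[symmetric]) (auto simp: is_gradient_on_def space_M)
    also have "(\<lambda>x. indicator \<Omega> x *\<^sub>R G x) = F" by (auto simp: F_def)
    finally show ?thesis .
  qed
  note [measurable] = measurable_ip[OF Fm Fm]
  have [measurable]: "core \<Omega> k \<in> sets M" for k
    using borel_closed[OF closed_core] sets_borel by blast
  have bound: "(\<integral>\<^sup>+x\<in>core \<Omega> k. ennreal (gnorm x (F x) powr p) \<partial>M) \<le> energy \<Omega> h" for k
  proof -
    define w where "w y = cutoff \<Omega> k y * u y" for y
    have w: "newtonian p M UNIV w" unfolding w_def[abs_def] by (rule newtonian_cut[OF u cutoff])
    have wug: "weak_upper_gradient p M UNIV w (min_weak_ug p M UNIV w)"
      using min_weak_ug_props[OF _ w] by simp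
    have "weak_upper_gradient p M UNIV w (\<lambda>x. if x \<in> core \<Omega> k then h x else min_weak_ug p M UNIV w x)"
    proof (rule weak_upper_gradient_glue[OF open_domain h wug closed_core])
      show "0 < 1 / real (Suc k)" by simp
      fix x y assume "x \<in> core \<Omega> k" "dist x y < 1 / real (Suc k)"
      then show "y \<in> \<Omega> \<and> w y = u y" using cutoff_near_core[of x \<Omega> k y] by (simp add: w_def)
    qed
    then have le: "energy (core \<Omega> k) (min_weak_ug p M UNIV w) \<le> energy (core \<Omega> k) h"
      by (rule energy_min_weak_ug_le[OF w borel_closed[OF closed_core]])
    have "AE x in M. cutoff \<Omega> k x = 1 \<longrightarrow> G x = nabla w x"
      using G cutoff[of k] unfolding is_gradient_on_def w_def[abs_def] by blast
    with nabla_bounds(1)[OF w] ip_inner_product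
    have "AE x in M. ennreal (gnorm x (F x) powr p) * indicator (core \<Omega> k) x
        \<le> epowr (min_weak_ug p M UNIV w x) p * indicator (core \<Omega> k) x"
    proof eventually_elim
      case (elim x)
      show ?case
      proof (cases "x \<in> core \<Omega> k")
        case True
        then have eq: "F x = nabla w x" using elim(3) cutoff_core core_subset[of \<Omega> k] by (auto simp: F_def)
        have "ennreal (gnorm x (F x) powr p) \<le> epowr (ennreal (gnorm x (nabla w x))) p"
          using inner_product_zero_iff(2)[OF elim(2)] by (simp add: epowr_ennreal eq)
        also have "\<dots> \<le> epowr (min_weak_ug p M UNIV w x) p" using elim(1) p_gt_1 by (intro epowr_mono) auto
        finally show ?thesis using True by simp
      qed simp
    qed
    then have "(\<integral>\<^sup>+x\<in>core \<Omega> k. ennreal (gnorm x (F x) powr p) \<partial>M) \<le> energy (core \<Omega> k) (min_weak_ug p M UNIV w)"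
      by (rule nn_integral_mono_AE)
    also have "\<dots> \<le> energy (core \<Omega> k) h" by (rule le)
    also have "\<dots> \<le> energy \<Omega> h" using core_subset[of \<Omega> k] by (intro nn_integral_mono) (auto simp: indicator_def)
    finally show ?thesis .
  qed
  have "(\<integral>\<^sup>+x\<in>\<Omega>. ennreal (gnorm x (G x) powr p) \<partial>M)
      = (\<integral>\<^sup>+x. (SUP k. ennreal (gnorm x (F x) powr p) * indicator (core \<Omega> k) x) \<partial>M)"
  proof (rule nn_integral_cong)
    fix x
    let ?s = "\<lambda>k. ennreal (gnorm x (F x) powr p) * indicator (core \<Omega> k) x"
    show "ennreal (gnorm x (G x) powr p) * indicator \<Omega> x = (SUP k. ?s k)"
    proof (cases "x \<in> \<Omega>")
      case True
      then obtain k where k: "x \<in> core \<Omega> k" using UN_core[OF open_domain proper_domain] by blast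
      have "(SUP k. ?s k) = ennreal (gnorm x (F x) powr p)"
      proof (rule antisym)
        show "(SUP k. ?s k) \<le> ennreal (gnorm x (F x) powr p)" by (intro SUP_least) (auto simp: indicator_def)
        show "ennreal (gnorm x (F x) powr p) \<le> (SUP k. ?s k)" by (rule SUP_upper2[of k]) (use k in auto)
      qed
      then show ?thesis using True by (simp add: F_def)
    next
      case False
      then have "x \<notin> core \<Omega> k" for k using core_subset[of \<Omega> k] by blast
      then show ?thesis using False by simp
    qed
  qed
  also have "\<dots> = (SUP k. \<integral>\<^sup>+x\<in>core \<Omega> k. ennreal (gnorm x (F x) powr p) \<partial>M)"
  proof (rule nn_integral_monotone_convergence_SUP)
    show "incseq (\<lambda>k x. ennreal (gnorm x (F x) powr p) * indicator (core \<Omega> k) x)"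
      using core_mono[of \<Omega>] by (intro incseq_SucI) (auto simp: le_fun_def indicator_def)
  qed measurable
  also have "\<dots> \<le> energy \<Omega> h" by (intro SUP_least bound)
  finally show ?thesis using h(2) by (rule order_le_less_trans)
qed

end


section \<open>Strict monotonicity of the flux\<close>

lemma inner_product_Cauchy_Schwarz:
  fixes b :: "real ^ 'n \<Rightarrow> real ^ 'n \<Rightarrow> real"
  assumes b: "inner_product b"
  shows "\<bar>b v w\<bar> \<le> sqrt (b v v) * sqrt (b w w)"
proof -
  have bil: "bilinear b" and sym: "b w v = b v w" using b by (auto simp: inner_product_def)
  have nonneg: "0 \<le> b x x" for x using inner_product_zero_iff[OF b] by simp
  define r s c where "r = sqrt (b v v)" and "s = sqrt (b w w)" and "c = b v w"
  have rs: "0 \<le> r" "0 \<le> s" "b v v = r * r" "b w w = s * s" using nonneg by (auto simp: r_def s_def)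
  have zero: "b 0 x = 0" "b x 0 = 0" for x using bil bilinear_lzero bilinear_rzero by blast+
  show ?thesis
  proof (cases "r = 0 \<or> s = 0")
    case True
    then have "v = 0 \<or> w = 0" using inner_product_zero_iff(1)[OF b] by (auto simp: r_def s_def)
    then show ?thesis using zero by auto
  next
    case False
    then have pos: "0 < 2 * (r * s)" using rs by simp
    have "0 \<le> b (s *\<^sub>R v - r *\<^sub>R w) (s *\<^sub>R v - r *\<^sub>R w)" by (rule nonneg)
    also have "\<dots> = 2 * (r * s) * (r * s - c)"
      using bil rs sym by (simp add: bilinear_lsub bilinear_rsub bilinear_lmul bilinear_rmul c_def algebra_simps)
    finally have 1: "c \<le> r * s" using pos by (simp add: zero_le_mult_iff)
    have "0 \<le> b (s *\<^sub>R v + r *\<^sub>R w) (s *\<^sub>R v + r *\<^sub>R w)" by (rule nonneg)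
    also have "\<dots> = 2 * (r * s) * (r * s + c)"
      using bil rs sym by (simp add: bilinear_ladd bilinear_radd bilinear_lmul bilinear_rmul c_def algebra_simps)
    finally have 2: "- c \<le> r * s" using pos by (simp add: zero_le_mult_iff)
    show ?thesis using 1 2 by (simp add: r_def s_def c_def abs_le_iff)
  qed
qed

text \<open>With \<open>r = \<bar>v\<bar>\<close>, \<open>s = \<bar>w\<bar>\<close> the pairing of the flux difference with \<open>v - w\<close> equals
  \<open>(r\<^sup>p\<^sup>-\<^sup>1 - s\<^sup>p\<^sup>-\<^sup>1) (r - s) + (r\<^sup>p\<^sup>-\<^sup>2 + s\<^sup>p\<^sup>-\<^sup>2) (r s - \<langle>v, w\<rangle>)\<close>; the first summand controls the difference
  of the lengths, the second one, by the Cauchy-Schwarz inequality, that of the directions.\<close>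

lemma flux_strictly_monotone:
  fixes b :: "real ^ 'n \<Rightarrow> real ^ 'n \<Rightarrow> real"
  assumes b: "inner_product b" and p: "1 < p"
  defines "T v w \<equiv> sqrt (b v v) powr (p - 2) * b v (v - w) - sqrt (b w w) powr (p - 2) * b w (v - w)"
  shows "0 \<le> T v w" "T v w = 0 \<Longrightarrow> v = w"
proof -
  have bil: "bilinear b" and sym: "b w v = b v w" using b by (auto simp: inner_product_def)
  have nonneg: "0 \<le> b x x" for x using inner_product_zero_iff[OF b] by simp
  define r s c where "r = sqrt (b v v)" and "s = sqrt (b w w)" and "c = b v w"
  have rs: "0 \<le> r" "0 \<le> s" "b v v = r * r" "b w w = s * s" using nonneg by (auto simp: r_def s_def)
  have r0: "r = 0 \<longleftrightarrow> v = 0" and s0: "s = 0 \<longleftrightarrow> w = 0"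
    using inner_product_zero_iff(1)[OF b] by (auto simp: r_def s_def)
  have cs: "c \<le> r * s" using inner_product_Cauchy_Schwarz[OF b, of v w] by (simp add: r_def s_def c_def)
  have pw: "x powr (p - 2) * (x * y) = x powr (p - 1) * y" if "0 \<le> x" for x y :: real
  proof (cases "x = 0")
    case False
    then have "x powr (p - 1) = x powr (p - 2) * x" using that powr_add[of x "p - 2" 1] by simp
    then show ?thesis by simp
  qed simp
  have "T v w = r powr (p - 2) * (r * r - c) - s powr (p - 2) * (c - s * s)"
    using bil rs sym by (simp add: T_def r_def[symmetric] s_def[symmetric] bilinear_rsub c_def)
  also have "\<dots> = r powr (p - 2) * (r * (r - s)) - s powr (p - 2) * (s * (r - s))
      + (r powr (p - 2) + s powr (p - 2)) * (r * s - c)"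
    by (simp add: algebra_simps)
  also have "\<dots> = (r powr (p - 1) - s powr (p - 1)) * (r - s) + (r powr (p - 2) + s powr (p - 2)) * (r * s - c)"
    using rs by (simp add: pw left_diff_distrib)
  finally have T: "T v w = (r powr (p - 1) - s powr (p - 1)) * (r - s) + (r powr (p - 2) + s powr (p - 2)) * (r * s - c)" .
  have first: "0 \<le> (r powr (p - 1) - s powr (p - 1)) * (r - s)"
  proof (cases "r \<le> s")
    case True
    then have "r powr (p - 1) \<le> s powr (p - 1)" using rs p by (intro powr_mono2) auto
    then show ?thesis using True by (simp add: mult_nonpos_nonpos)
  next
    case False
    then have "s powr (p - 1) \<le> r powr (p - 1)" using rs p by (intro powr_mono2) auto
    then show ?thesis using False by simp
  qed
  have second: "0 \<le> (r powr (p - 2) + s powr (p - 2)) * (r * s - c)" using cs by simp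
  show "0 \<le> T v w" unfolding T using first second by simp
  assume "T v w = 0"
  then have eq: "(r powr (p - 1) - s powr (p - 1)) * (r - s) = 0" "(r powr (p - 2) + s powr (p - 2)) * (r * s - c) = 0"
    using T first second by linarith+
  have "r = s"
  proof (rule ccontr)
    assume "r \<noteq> s"
    then have "r powr (p - 1) = s powr (p - 1)" using eq(1) by simp
    then have "(r powr (p - 1)) powr (1 / (p - 1)) = (s powr (p - 1)) powr (1 / (p - 1))" by simp
    then show False using \<open>r \<noteq> s\<close> rs p by (simp add: powr_powr)
  qed
  show "v = w"
  proof (cases "r = 0")
    case True
    then show ?thesis using r0 s0 \<open>r = s\<close> by simp
  next
    case False
    then have "c = r * r" using eq(2) \<open>r = s\<close> rs by simp
    then have "b (v - w) (v - w) = 0"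
      using bil rs sym \<open>r = s\<close> by (simp add: bilinear_lsub bilinear_rsub c_def)
    then show ?thesis using inner_product_zero_iff(1)[OF b] by simp
  qed
qed

context cheeger_domain
begin

abbreviation flux_pairing :: "'a \<Rightarrow> real ^ 'n \<Rightarrow> real ^ 'n \<Rightarrow> real" where
  "flux_pairing x v w \<equiv> gnorm x v powr (p - 2) * ip x v w"

lemma zero_extension_gradient_measurable:
  assumes "is_gradient_on M nabla \<Omega> u G"
  shows "(\<lambda>x. indicator \<Omega> x *\<^sub>R G x) \<in> borel_measurable M"
  using assms domain_sets
  by (subst borel_measurable_restrict_space_iff[symmetric]) (auto simp: is_gradient_on_def space_M)

text \<open>By the Cauchy-Schwarz inequality the pairing is at most \<open>max \<bar>\<nabla>u\<bar> \<bar>\<nabla>\<phi>\<bar>\<close> to the power \<open>p\<close>.\<close>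

lemma flux_integrable:
  assumes u: "newtonian p M \<Omega> u" "is_gradient_on M nabla \<Omega> u G"
    and \<phi>: "newtonian p M \<Omega> \<phi>" "is_gradient_on M nabla \<Omega> \<phi> H"
  shows "integrable M (\<lambda>x. indicator \<Omega> x *\<^sub>R flux_pairing x (G x) (H x))"
proof -
  define G0 H0 where "G0 x = indicator \<Omega> x *\<^sub>R G x" and "H0 x = indicator \<Omega> x *\<^sub>R H x" for x
  have [measurable]: "G0 \<in> borel_measurable M" "H0 \<in> borel_measurable M"
    using zero_extension_gradient_measurable u(2) \<phi>(2) by (auto simp: G0_def[abs_def] H0_def[abs_def])
  have [measurable]: "(\<lambda>x. ip x (G0 x) (G0 x)) \<in> borel_measurable M" "(\<lambda>x. ip x (G0 x) (H0 x)) \<in> borel_measurable M"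
    "(\<lambda>x. ip x (H0 x) (H0 x)) \<in> borel_measurable M" by (intro measurable_ip; measurable)+
  have [measurable]: "\<Omega> \<in> sets M" by (rule domain_sets)
  have eq: "indicator \<Omega> x *\<^sub>R flux_pairing x (G x) (H x) = indicator \<Omega> x *\<^sub>R flux_pairing x (G0 x) (H0 x)" for x
    by (auto simp: G0_def H0_def indicator_def)
  have Lp: "integrable M (\<lambda>x. indicator \<Omega> x * gnorm x (F0 x) powr p)"
    if F: "newtonian p M \<Omega> w" "is_gradient_on M nabla \<Omega> w F" and F0: "F0 = (\<lambda>x. indicator \<Omega> x *\<^sub>R F x)"
    for w F F0
  proof -
    have [measurable]: "F0 \<in> borel_measurable M" using zero_extension_gradient_measurable[OF F(2)] F0 by simp
    have [measurable]: "(\<lambda>x. ip x (F0 x) (F0 x)) \<in> borel_measurable M" by (intro measurable_ip) measurable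
    have "(\<integral>\<^sup>+x. ennreal (indicator \<Omega> x * gnorm x (F0 x) powr p) \<partial>M)
        = (\<integral>\<^sup>+x\<in>\<Omega>. ennreal (gnorm x (F x) powr p) \<partial>M)"
      by (intro nn_integral_cong) (auto simp: F0 indicator_def)
    also have "\<dots> < \<infinity>" by (rule gradient_on_Lp[OF F])
    finally show ?thesis by (intro integrableI_nonneg) auto
  qed
  have "integrable M (\<lambda>x. indicator \<Omega> x * gnorm x (G0 x) powr p + indicator \<Omega> x * gnorm x (H0 x) powr p)"
    by (intro Bochner_Integration.integrable_add Lp[OF u] Lp[OF \<phi>]) (auto simp: G0_def H0_def)
  then have "integrable M (\<lambda>x. indicator \<Omega> x *\<^sub>R flux_pairing x (G0 x) (H0 x))"
  proof (rule Bochner_Integration.integrable_bound)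
    show "(\<lambda>x. indicator \<Omega> x *\<^sub>R flux_pairing x (G0 x) (H0 x)) \<in> borel_measurable M" by measurable
    show "AE x in M. norm (indicator \<Omega> x *\<^sub>R flux_pairing x (G0 x) (H0 x))
        \<le> norm (indicator \<Omega> x * gnorm x (G0 x) powr p + indicator \<Omega> x * gnorm x (H0 x) powr p)"
      using ip_inner_product
    proof eventually_elim
      case (elim x)
      define r s where "r = gnorm x (G0 x)" and "s = gnorm x (H0 x)"
      have rs: "0 \<le> r" "0 \<le> s" using inner_product_zero_iff(2)[OF elim] by (auto simp: r_def s_def)
      have "\<bar>flux_pairing x (G0 x) (H0 x)\<bar> \<le> r powr (p - 2) * (r * s)"
        using inner_product_Cauchy_Schwarz[OF elim, of "G0 x" "H0 x"]
        by (simp add: abs_mult r_def s_def mult_left_mono)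
      also have "\<dots> \<le> max r s powr (p - 1) * max r s"
      proof (cases "r = 0")
        case False
        then have "r powr (p - 1) = r powr (p - 2) * r" using rs powr_add[of r "p - 2" 1] by simp
        then have "r powr (p - 2) * (r * s) = r powr (p - 1) * s" by simp
        also have "\<dots> \<le> max r s powr (p - 1) * max r s"
          using rs p_gt_1 by (intro mult_mono powr_mono2) auto
        finally show ?thesis .
      qed (use rs in auto)
      also have "\<dots> = max r s powr p"
      proof (cases "max r s = 0")
        case False
        then have "max r s powr ((p - 1) + 1) = max r s powr (p - 1) * max r s" using rs by (subst powr_add) auto
        then show ?thesis by simp
      qed (use p_gt_1 in simp)
      also have "\<dots> \<le> r powr p + s powr p" by (auto simp: max_def)
      finally show ?case by (auto simp: indicator_def r_def s_def)
    qed
  qed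
  then show ?thesis by (simp only: eq)
qed

text \<open>Both solutions satisfy the equation with the test function \<open>u - v\<close>. The difference of the two
  equations is an integral of a nonnegative function, which therefore vanishes almost everywhere.\<close>

lemma solutions_gradients_agree:
  assumes u: "p_poisson_solution p M ip nabla \<Omega> f g u" and v: "p_poisson_solution p M ip nabla \<Omega> f g v"
    and test: "newtonian0 p M \<Omega> (\<lambda>x. u x - v x)" and w: "newtonian p M \<Omega> (\<lambda>x. u x - v x)"
  shows "AE x in M. x \<in> \<Omega> \<longrightarrow> gradient_on M nabla \<Omega> u x = gradient_on M nabla \<Omega> v x"
proof -
  define Gu Gv Gw where "Gu = gradient_on M nabla \<Omega> u" and "Gv = gradient_on M nabla \<Omega> v"
    and "Gw = gradient_on M nabla \<Omega> (\<lambda>x. u x - v x)"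
  have Nu: "newtonian p M \<Omega> u" and Nv: "newtonian p M \<Omega> v" using u v by (auto simp: p_poisson_solution_def)
  have Gu: "is_gradient_on M nabla \<Omega> u Gu" and Gv: "is_gradient_on M nabla \<Omega> v Gv"
    and Gw: "is_gradient_on M nabla \<Omega> (\<lambda>x. u x - v x) Gw"
    unfolding Gu_def Gv_def Gw_def by (intro gradient_on Nu Nv w)+
  have diff: "AE x in M. x \<in> \<Omega> \<longrightarrow> Gw x = Gu x - Gv x"
    by (rule is_gradient_on_unique[OF Gw is_gradient_on_diff[OF Nu Nv Gu Gv]])
  let ?F = "\<lambda>x. indicator \<Omega> x *\<^sub>R flux_pairing x (Gu x) (Gw x) - indicator \<Omega> x *\<^sub>R flux_pairing x (Gv x) (Gw x)"
  have int: "integrable M (\<lambda>x. indicator \<Omega> x *\<^sub>R flux_pairing x (Gu x) (Gw x))"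
    "integrable M (\<lambda>x. indicator \<Omega> x *\<^sub>R flux_pairing x (Gv x) (Gw x))"
    using flux_integrable[OF Nu Gu w Gw] flux_integrable[OF Nv Gv w Gw] by auto
  have "(LINT x:\<Omega>|M. flux_pairing x (Gu x) (Gw x)) = (LINT x:\<Omega>|M. flux_pairing x (Gv x) (Gw x))"
  proof -
    have "(LINT x:\<Omega>|M. flux_pairing x (Gu x) (Gw x)) = (LINT x:\<Omega>|M. f x * (u x - v x))"
      using u test unfolding p_poisson_solution_def Let_def Gu_def Gw_def by blast
    moreover have "(LINT x:\<Omega>|M. flux_pairing x (Gv x) (Gw x)) = (LINT x:\<Omega>|M. f x * (u x - v x))"
      using v test unfolding p_poisson_solution_def Let_def Gv_def Gw_def by blast
    ultimately show ?thesis by simp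
  qed
  then have zero: "integral\<^sup>L M ?F = 0"
    using int by (simp add: set_lebesgue_integral_def)
  have F: "AE x in M. x \<in> \<Omega> \<longrightarrow> ?F x = flux_pairing x (Gu x) (Gu x - Gv x) - flux_pairing x (Gv x) (Gu x - Gv x)"
    using diff by eventually_elim simp
  have "AE x in M. 0 \<le> ?F x"
    using F ip_inner_product
  proof eventually_elim
    case (elim x)
    then show ?case using flux_strictly_monotone(1)[OF elim(2) p_gt_1, of "Gu x" "Gv x"] by (cases "x \<in> \<Omega>") auto
  qed
  then have "AE x in M. ?F x = 0"
    using integral_nonneg_eq_0_iff_AE[of M ?F] int zero by auto
  with F ip_inner_product have "AE x in M. x \<in> \<Omega> \<longrightarrow> Gu x = Gv x"
  proof eventually_elim
    case (elim x)
    then show ?case using flux_strictly_monotone(2)[OF elim(2) p_gt_1, of "Gu x" "Gv x"] by (cases "x \<in> \<Omega>") auto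
  qed
  then show ?thesis by (simp add: Gu_def Gv_def)
qed

end


section \<open>Vanishing of functions without energy\<close>

context metric_measure
begin

text \<open>The Poincare inequality for upper gradients of energy \<open>e\<close> bounds the mean of \<open>\<bar>w - w\<^sub>B\<bar>\<^sup>p\<close> on a
  ball \<open>B\<close> by a multiple of \<open>e\<close>, with a factor that depends on the ball only, and \<open>e\<close> is arbitrarily small.\<close>

lemma poincare_zero_energy:
  assumes poin: "poincare p M" and doub: "doubling M"
    and w: "integrable M w" and g: "weak_upper_gradient p M UNIV w g" "energy UNIV g = 0" and "0 < r"
  shows "AE y in M. y \<in> ball x r \<longrightarrow> w y = average M (ball x r) w"
proof -
  obtain C lam :: real where C: "0 < C" "1 \<le> lam" and ineq: "\<And>u x r h. integrable M u \<Longrightarrow> 0 < r \<Longrightarrow>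
      upper_gradient UNIV u h \<Longrightarrow>
      epowr (eaverage M (ball x r) (\<lambda>y. ennreal (\<bar>u y - average M (ball x r) u\<bar> powr p))) (1 / p)
      \<le> ennreal (C * r) * epowr (eaverage M (ball x (lam * r)) (\<lambda>y. epowr (h y) p)) (1 / p)"
    using poin unfolding poincare_def by blast
  have ball_pos: "0 < emeasure M (ball x r)" and ball_fin: "emeasure M (ball x r) < \<infinity>" if "0 < r" for x r
    using doublingE[OF doub] that by metis+
  define B where "B = ball x r"
  define c where "c = average M B w"
  define X where "X = eaverage M B (\<lambda>y. ennreal (\<bar>w y - c\<bar> powr p))"
  have lr: "0 < lam * r" using C \<open>0 < r\<close> by simp
  obtain m where m: "emeasure M (ball x (lam * r)) = ennreal m" "0 < m"
    using ball_pos[OF lr, of x] ball_fin[OF lr, of x]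
    by (cases "emeasure M (ball x (lam * r))") (auto simp: ennreal_less_zero_iff)
  have bound: "X \<le> ennreal ((C * r) powr p * (e / m))" if "0 < e" for e
  proof -
    obtain h where h: "upper_gradient UNIV w h" "energy UNIV h \<le> ennreal e"
      using upper_gradient_of_small_energy[OF g \<open>0 < e\<close>] by blast
    define Y where "Y = eaverage M (ball x (lam * r)) (\<lambda>y. epowr (h y) p)"
    have "energy (ball x (lam * r)) h \<le> energy UNIV h" by (intro nn_integral_mono) (auto simp: indicator_def)
    then have "Y \<le> ennreal e / ennreal m"
      unfolding Y_def eaverage_def m(1) using h(2) by (intro divide_right_mono_ennreal) (rule order_trans)
    also have "\<dots> = ennreal (e / m)" using m that by (simp add: divide_ennreal)
    finally have Y: "Y \<le> ennreal (e / m)" .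
    have "epowr (epowr X (1 / p)) p \<le> epowr (ennreal (C * r) * epowr Y (1 / p)) p"
      using ineq[OF w \<open>0 < r\<close> h(1), of x] p_gt_1 by (intro epowr_mono) (auto simp: X_def Y_def B_def c_def)
    then have "X \<le> ennreal ((C * r) powr p) * Y"
      using p_gt_1 C \<open>0 < r\<close> epowr_ennreal[of "C * r" p] by (simp add: epowr_epowr epowr_mult)
    also have "\<dots> \<le> ennreal ((C * r) powr p) * ennreal (e / m)" using Y by (intro mult_left_mono) auto
    finally show ?thesis using m that by (subst ennreal_mult) simp_all
  qed
  have "X \<le> 0"
  proof (rule ennreal_le_epsilon)
    fix d :: real assume "0 < d"
    define e where "e = d * m / (C * r) powr p"
    have "0 < (C * r) powr p" using C \<open>0 < r\<close> by simp
    then have e: "0 < e" "(C * r) powr p * (e / m) = d" using \<open>0 < d\<close> m by (auto simp: e_def)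
    show "X \<le> 0 + ennreal d" using bound[OF e(1)] e(2) by simp
  qed
  then have "(\<integral>\<^sup>+y\<in>B. ennreal (\<bar>w y - c\<bar> powr p) \<partial>M) = 0"
    using ball_fin[OF \<open>0 < r\<close>, of x] unfolding X_def eaverage_def B_def by (auto simp: ennreal_divide_eq_0_iff)
  moreover have "B \<in> sets M" using sets_borel by (auto simp: B_def)
  ultimately have "AE y in M. ennreal (\<bar>w y - c\<bar> powr p) * indicator B y = 0"
    using borel_measurable_integrable[OF w] by (subst (asm) nn_integral_0_iff_AE) auto
  then show ?thesis
    by eventually_elim (auto simp: B_def c_def indicator_def split: if_splits)
qed

text \<open>On a ball that contains \<open>\<Omega>\<close> and a part of the complement of positive measure, \<open>w\<close> is almost
  everywhere equal to a constant, whose value is that of \<open>w\<close> outside \<open>\<Omega>\<close>.\<close>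

lemma zero_energy_vanishes:
  assumes poin: "poincare p M" and doub: "doubling M"
    and \<Omega>: "\<Omega> \<in> sets borel" "bounded \<Omega>" "0 < emeasure M (UNIV - \<Omega>)"
    and w: "newtonian p M UNIV w" "\<And>x. x \<notin> \<Omega> \<Longrightarrow> w x = 0"
    and g: "weak_upper_gradient p M UNIV w g" "energy UNIV g = 0"
  shows "AE x in M. w x = 0"
proof -
  have \<Omega>M [measurable]: "\<Omega> \<in> sets M" using \<Omega> sets_borel by auto
  have ballM [measurable]: "ball x r \<in> sets M" for x r using sets_borel by auto
  have wm [measurable]: "w \<in> borel_measurable M" using w(1) by (simp add: newtonian_def Lp_on_def)
  obtain x0 R where R: "0 < R" "\<Omega> \<subseteq> ball x0 R" using bounded_subset_ballD[OF \<Omega>(2)] by blast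
  have fin: "emeasure M (ball x0 R) < \<infinity>" using doublingE[OF doub] R(1) by metis
  have int: "integrable M w"
  proof (rule integrableI_bounded[OF wm])
    have "(\<integral>\<^sup>+x. ennreal (norm (w x)) \<partial>M) \<le> (\<integral>\<^sup>+x. indicator (ball x0 R) x + ennreal (\<bar>w x\<bar> powr p) \<partial>M)"
    proof (rule nn_integral_mono)
      fix x
      show "ennreal (norm (w x)) \<le> indicator (ball x0 R) x + ennreal (\<bar>w x\<bar> powr p)"
      proof (cases "x \<in> \<Omega>")
        case True
        have "\<bar>w x\<bar> \<le> 1 + \<bar>w x\<bar> powr p"
        proof (cases "1 \<le> \<bar>w x\<bar>")
          case True
          then have "\<bar>w x\<bar> powr 1 \<le> \<bar>w x\<bar> powr p" using p_gt_1 by (intro powr_mono) auto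
          then show ?thesis using True by simp
        qed (simp add: add_increasing2)
        then have "ennreal \<bar>w x\<bar> \<le> ennreal (1 + \<bar>w x\<bar> powr p)" by (rule ennreal_leI)
        then show ?thesis using True R(2) by (auto simp: subset_iff)
      next
        case False
        then show ?thesis using w(2) by simp
      qed
    qed
    also have "\<dots> = emeasure M (ball x0 R) + (\<integral>\<^sup>+x. ennreal (\<bar>w x\<bar> powr p) \<partial>M)"
      by (subst nn_integral_add) auto
    also have "\<dots> < \<infinity>" using fin w(1) by (auto simp: newtonian_def Lp_on_def)
    finally show "(\<integral>\<^sup>+x. ennreal (norm (w x)) \<partial>M) < \<infinity>" .
  qed
  obtain n :: nat where n: "0 < emeasure M (ball x0 (real n) - \<Omega>)"
  proof (rule ccontr)
    assume "\<not> thesis"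
    then have "emeasure M (ball x0 (real n) - \<Omega>) = 0" for n using that[of n] by (auto simp: zero_less_iff_neq_zero)
    then have "(\<Union>n. ball x0 (real n) - \<Omega>) \<in> null_sets M" by (intro null_sets_UN) auto
    moreover have "(\<Union>n. ball x0 (real n) - \<Omega>) = UNIV - \<Omega>" using reals_Archimedean2 by auto
    ultimately show False using \<Omega>(3) by auto
  qed
  define r where "r = max R (real n)"
  have r: "0 < r" "\<Omega> \<subseteq> ball x0 r" "ball x0 (real n) \<subseteq> ball x0 r" using R by (auto simp: r_def)
  define c where "c = average M (ball x0 r) w"
  have AE_c: "AE y in M. y \<in> ball x0 r \<longrightarrow> w y = c"
    unfolding c_def by (rule poincare_zero_energy[OF poin doub int g r(1)])
  have "c = 0"
  proof (rule ccontr)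
    assume "c \<noteq> 0"
    have "AE y in M. y \<notin> ball x0 (real n) - \<Omega>"
      using AE_c by eventually_elim (use w(2) r(3) \<open>c \<noteq> 0\<close> in auto)
    then have "ball x0 (real n) - \<Omega> \<in> null_sets M" by (subst null_sets_iff_AE) (auto simp: space_M)
    then show False using n by auto
  qed
  from AE_c show ?thesis
  proof eventually_elim
    case (elim x)
    show ?case using elim \<open>c = 0\<close> w(2)[of x] r(2) by (cases "x \<in> \<Omega>") auto
  qed
qed

end

section \<open>Uniqueness of solutions\<close>

context cheeger_domain
begin

lemma p_poisson_unique:
  assumes poin: "poincare p M" and pos: "0 < emeasure M (UNIV - \<Omega>)"
    and u: "p_poisson_solution p M ip nabla \<Omega> f g u" and v: "p_poisson_solution p M ip nabla \<Omega> f g v"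
  shows "newtonian_norm p M \<Omega> (\<lambda>x. u x - v x) = 0"
proof -
  let ?d = "\<lambda>x. u x - v x"
  obtain w1 where w1: "newtonian p M UNIV w1" "\<And>x. x \<notin> \<Omega> \<Longrightarrow> w1 x = 0" "\<And>x. x \<in> \<Omega> \<Longrightarrow> w1 x = u x - g x"
    using u unfolding p_poisson_solution_def newtonian0_def by blast
  obtain w2 where w2: "newtonian p M UNIV w2" "\<And>x. x \<notin> \<Omega> \<Longrightarrow> w2 x = 0" "\<And>x. x \<in> \<Omega> \<Longrightarrow> w2 x = v x - g x"
    using v unfolding p_poisson_solution_def newtonian0_def by blast
  define w where "w x = 1 * w1 x + (- 1) * w2 x" for x
  have w: "newtonian p M UNIV w" "\<And>x. x \<notin> \<Omega> \<Longrightarrow> w x = 0" "\<And>x. x \<in> \<Omega> \<Longrightarrow> w x = ?d x"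
    unfolding w_def[abs_def] using newtonian_lincomb[OF _ w1(1) w2(1), of 1 "- 1"] w1 w2 by auto
  have test: "newtonian0 p M \<Omega> ?d" unfolding newtonian0_def using w by blast
  have Nd: "newtonian p M \<Omega> ?d" by (rule newtonian_restrict[OF w(1) domain_sets(1) w(3)])
  have Nu: "newtonian p M \<Omega> u" and Nv: "newtonian p M \<Omega> v" using u v by (auto simp: p_poisson_solution_def)
  have "AE x in M. x \<in> \<Omega> \<longrightarrow> nabla w x = gradient_on M nabla \<Omega> u x - gradient_on M nabla \<Omega> v x"
    using is_gradient_on_restriction[OF w(1,3)] is_gradient_on_diff[OF Nu Nv gradient_on[OF Nu] gradient_on[OF Nv]]
    by (rule is_gradient_on_unique)
  moreover have "AE x in M. x \<in> \<Omega> \<longrightarrow> gradient_on M nabla \<Omega> u x = gradient_on M nabla \<Omega> v x"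
    by (rule solutions_gradients_agree[OF u v test Nd])
  moreover have "AE x in M. x \<in> - \<Omega> \<longrightarrow> nabla w x = 0"
    using w open_domain by (intro nabla_zero_on) auto
  ultimately have nabla0: "AE x in M. nabla w x = 0" by eventually_elim auto
  define G where "G = min_weak_ug p M UNIV w"
  have G: "weak_upper_gradient p M UNIV w G" using min_weak_ug_props(1)[OF _ w(1)] by (simp add: G_def)
  have "AE x in M. G x = 0"
    using nabla0 nabla_bounds(2)[OF w(1)] ip_inner_product
  proof eventually_elim
    case (elim x)
    then show ?case using inner_product_zero_iff(1)[OF elim(3), of 0] by (simp add: G_def)
  qed
  then have E: "energy UNIV G = 0"
    by (subst nn_integral_cong_AE[where v = "\<lambda>_. 0"]) (auto elim!: eventually_mono)
  have w0: "AE x in M. w x = 0"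
    by (rule zero_energy_vanishes[OF poin doubling domain_sets(1) bounded_domain pos w(1,2) G E])
  define H where "H = min_weak_ug p M \<Omega> ?d"
  have H: "weak_upper_gradient p M \<Omega> ?d H" using min_weak_ug_props(1)[OF domain_sets(1) Nd] by (simp add: H_def)
  have "weak_upper_gradient p M \<Omega> ?d G"
    by (rule weak_upper_gradient_restrict[OF G]) (use domain_sets w(3) in auto)
  then have "energy \<Omega> H \<le> energy \<Omega> G"
    unfolding H_def by (rule min_weak_ug_props(3)[OF domain_sets(1) Nd])
  also have "\<dots> \<le> energy UNIV G" by (intro nn_integral_mono) (auto simp: indicator_def)
  finally have "energy \<Omega> H = 0" using E by simp
  then have "AE x in M. epowr (H x) p * indicator \<Omega> x = 0"
    using energy_integrand_measurable[OF domain_sets(1) weak_upper_gradient_measurable[OF H]]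
    by (simp add: nn_integral_0_iff_AE)
  with w0 have "AE x in M. (ennreal (\<bar>?d x\<bar> powr p) + epowr (H x) p) * indicator \<Omega> x = 0"
    by eventually_elim (use w(3) in \<open>auto simp: indicator_def split: if_splits\<close>)
  then have "(\<integral>\<^sup>+x\<in>\<Omega>. (ennreal (\<bar>?d x\<bar> powr p) + epowr (H x) p) \<partial>M) = 0"
    by (subst nn_integral_cong_AE[where v = "\<lambda>_. 0"]) auto
  then show ?thesis by (simp add: newtonian_norm_def H_def)
qed

end

theorem corollary5p15:
  fixes M :: "'a::complete_space measure"
    and p :: real
    and \<Omega> :: "'a set"
    and I :: "nat set"
    and U :: "nat \<Rightarrow> 'a set"
    and J :: "nat \<Rightarrow> 'n::finite set"
    and F :: "nat \<Rightarrow> 'n \<Rightarrow> 'a \<Rightarrow> real"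
    and D :: "nat \<Rightarrow> ('a \<Rightarrow> real) \<Rightarrow> 'a \<Rightarrow> real ^ 'n"
    and ip :: "'a \<Rightarrow> real ^ 'n \<Rightarrow> real ^ 'n \<Rightarrow> real"
    and nabla :: "('a \<Rightarrow> real) \<Rightarrow> 'a \<Rightarrow> real ^ 'n"
    and f g u v :: "'a \<Rightarrow> real"
  assumes "1 < p"
    and "borel_regular M" and "doubling M" and "geodesic (UNIV :: 'a set)" and "poincare p M"
    and "\<Omega> \<noteq> {}" and "bounded \<Omega>" and "open \<Omega>" and "connected \<Omega>"
    and "emeasure M (UNIV - \<Omega>) > 0"
    and "cheeger_charts p M I U J F D"
    and "cheeger_gradient p M I U D ip nabla"
    and "Lp_on (p / (p - 1)) M \<Omega> f"
    and "newtonian p M \<Omega> g"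
    and "p_poisson_solution p M ip nabla \<Omega> f g u"
    and "p_poisson_solution p M ip nabla \<Omega> f g v"
  shows "newtonian_norm p M \<Omega> (\<lambda>x. u x - v x) = 0"
proof -
  interpret cheeger_domain M p I U D ip nabla \<Omega>
    using assms by unfold_locales auto
  show ?thesis using assms by (intro p_poisson_unique) auto
qed

end
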